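(* Let $k$ be an algebraically closed field of characteristic zero, $G$ a group, $a\in Z(G)$, $\chi\in\hat G$ with $\chi(a)\neq 1$, and $H=kG(\chi^{-1},a,0)$. Assume that $|\chi|=s<\infty$ and that $q=\chi^{-1}(a)$ is a primitive $s$-th root of unity. Let $\lambda,\sigma\in\hat G$ and let $n\geq t\geq 1$ be integers. Write $n=r's+l'$ and $t=rs+l$ with integers $r,r'\ge 0$ and $0\leq l',l\leq s-1$. Then the following isomorphisms of $H$-modules hold. (1) Suppose $l+l'\leq s$. If $l\leq l'$, then $$\begin{aligned}V_n(\lambda)\otimes V_t(\sigma)\cong{}&V_t(\sigma)\otimes V_n(\lambda)\\ \cong{}&\Big(\bigoplus_{i=0}^{r}\bigoplus_{0\leq j\leq l-1}V_{n+t-1-2is-2j}(\chi^j\lambda\sigma)\Big)\oplus\Big(\bigoplus_{0\leq i\leq r-1}\bigoplus_{l\leq j\leq l'-1}V_{(r+r'-2i)s}(\chi^j\lambda\sigma)\Big)\\ &\oplus\Big(\bigoplus_{0\leq i\leq r-1}\bigoplus_{l'\leq j\leq l+l'-1}V_{n+t-1-2is-2j}(\chi^j\lambda\sigma)\Big)\oplus\Big(\bigoplus_{0\leq i\leq r-1}\bigoplus_{l+l'\leq j\leq s-1}V_{(r+r'-1-2i)s}(\chi^j\lambda\sigma)\Big),\end{aligned}$$ and if $l\geq l'$, then $$\begin{aligned}V_n(\lambda)\otimes V_t(\sigma)\cong{}&V_t(\sigma)\otimes V_n(\lambda)\\ \cong{}&\Big(\bigoplus_{i=0}^{r}\bigoplus_{0\leq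 j\leq l'-1}V_{n+t-1-2is-2j}(\chi^j\lambda\sigma)\Big)\oplus\Big(\bigoplus_{i=0}^{r}\bigoplus_{l'\leq j\leq l-1}V_{(r+r'-2i)s}(\chi^j\lambda\sigma)\Big)\\ &\oplus\Big(\bigoplus_{0\leq i\leq r-1}\bigoplus_{l\leq j\leq l+l'-1}V_{n+t-1-2is-2j}(\chi^j\lambda\sigma)\Big)\oplus\Big(\bigoplus_{0\leq i\leq r-1}\bigoplus_{l+l'\leq j\leq s-1}V_{(r+r'-1-2i)s}(\chi^j\lambda\sigma)\Big).\end{aligned}$$ (2) Suppose $l+l'\geq s+1$ and let $m=l+l'-s-1$. If $l\leq l'$, then $$\begin{aligned}V_n(\lambda)\otimes V_t(\sigma)\cong{}&V_t(\sigma)\otimes V_n(\lambda)\\ \cong{}&\Big(\bigoplus_{i=0}^{r}\bigoplus_{j=0}^{m}V_{(r+r'+1-2i)s}(\chi^j\lambda\sigma)\Big)\oplus\Big(\bigoplus_{i=0}^{r}\bigoplus_{j=m+1}^{l-1}V_{n+t-1-2is-2j}(\chi^j\lambda\sigma)\Big)\\ &\oplus\Big(\bigoplus_{0\leq i\leq r-1}\bigoplus_{l\leq j\leq l'-1}V_{(r+r'-2i)s}(\chi^j\lambda\sigma)\Big)\oplus\Big(\bigoplus_{0\leq i\leq r-1}\bigoplus_{j=l'}^{s-1}V_{n+t-1-2is-2j}(\chi^j\lambda\sigma)\Big),\end{aligned}$$ and if $l\geq l'$, then $$\begin{aligned}V_n(\lambda)\otimes V_t(\sigma)\cong{}&V_t(\sigma)\otimes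 V_n(\lambda)\\ \cong{}&\Big(\bigoplus_{i=0}^{r}\bigoplus_{j=0}^{m}V_{(r+r'+1-2i)s}(\chi^j\lambda\sigma)\Big)\oplus\Big(\bigoplus_{i=0}^{r}\bigoplus_{j=m+1}^{l'-1}V_{n+t-1-2is-2j}(\chi^j\lambda\sigma)\Big)\\ &\oplus\Big(\bigoplus_{i=0}^{r}\bigoplus_{l'\leq j\leq l-1}V_{(r+r'-2i)s}(\chi^j\lambda\sigma)\Big)\oplus\Big(\bigoplus_{0\leq i\leq r-1}\bigoplus_{j=l}^{s-1}V_{n+t-1-2is-2j}(\chi^j\lambda\sigma)\Big).\end{aligned}$$
   Context: $Z(G)$ is the center of $G$; $\hat G$ is the group (under pointwise product) of characters, i.e. group homomorphisms $G\to k^\times=k\setminus\{0\}$; $|\chi|$ is the order of $\chi$ in $\hat G$. The Hopf algebra $H=kG(\chi^{-1},a,0)$ is generated as a $k$-algebra by the group algebra $kG$ and an element $x$ subject to $xg=\chi^{-1}(g)gx$ for $g\in G$; it has $k$-basis $\{gx^i\mid g\in G,\ i\geq 0\}$. Its coalgebra structure and antipode are given by $\Delta(x)=x\otimes a+1\otimes x$, $\varepsilon(x)=0$, $S(x)=-xa^{-1}$, $\Delta(g)=g\otimes g$, $\varepsilon(g)=1$, $S(g)=g^{-1}$ for $g\in G$. Modules are left modules, $\otimes=\otimes_k$, and $H$ acts on a tensor product of modules via $\Delta$. For $\lambda\in\hat G$ and an integer $t\geq 1$, $V_t(\lambda)$ is the $t$-dimensional $H$-module with $k$-basis $m_0,\dots,m_{t-1}$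 and action $g\cdot m_i=\chi^i(g)\lambda(g)m_i$ for $g\in G$, $0\le i\le t-1$; $x\cdot m_i=m_{i+1}$ for $0\leq i\leq t-2$; $x\cdot m_{t-1}=0$. Set $V_0(\lambda)=0$. Convention: a direct sum over an empty index range is $0$. *)

theory Defs
  imports
    "HOL-Computational_Algebra.Polynomial"
    "HOL-Algebra.Multiplicative_Group"
    "HOL-Algebra.Module"
    "HOL-Library.Poly_Mapping"
begin

section \<open>Characters\<close>

definition group_center :: "('g, 'z) monoid_scheme \<Rightarrow> 'g set" where
  "group_center G = {a \<in> carrier G. \<forall>g\<in>carrier G. a \<otimes>\<^bsub>G\<^esub> g = g \<otimes>\<^bsub>G\<^esub> a}"

definition field_units :: "'k::field monoid" where
  "field_units = \<lparr>carrier = - {0}, monoid.mult = (*), one = 1\<rparr>"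

text \<open>Characters are made \<^const>\<open>extensional\<close> so that equality of characters (and hence
  the order of a character) only depends on their values on the carrier of the group.\<close>

definition char_group :: "('g, 'z) monoid_scheme \<Rightarrow> ('g \<Rightarrow> 'k::field) monoid" where
  "char_group G =
     \<lparr>carrier = hom G field_units \<inter> extensional (carrier G),
      monoid.mult = (\<lambda>\<phi> \<psi>. \<lambda>g\<in>carrier G. \<phi> g * \<psi> g),
      one = (\<lambda>g\<in>carrier G. 1)\<rparr>"

definition primitive_root_unity :: "nat \<Rightarrow> 'k::field \<Rightarrow> bool" where
  "primitive_root_unity s q \<longleftrightarrow> s > 0 \<and> q ^ s = 1 \<and> (\<forall>i. 0 < i \<and> i < s \<longrightarrow> q ^ i \<noteq> 1)"


section \<open>Free vector spaces\<close>

text \<open>The type \<open>'b \<Rightarrow>\<^sub>0 'k\<close> is the vector space over \<open>'k\<close> with basis \<open>'b\<close>, the basis vector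
  \<open>b\<close> being \<open>basis_vec b\<close>; \<open>free_on B\<close> is the subspace spanned by the basis vectors in \<open>B\<close>.\<close>

definition scale :: "'k::field \<Rightarrow> ('b \<Rightarrow>\<^sub>0 'k) \<Rightarrow> ('b \<Rightarrow>\<^sub>0 'k)" where
  "scale c = Poly_Mapping.map ((*) c)"

abbreviation basis_vec :: "'b \<Rightarrow> ('b \<Rightarrow>\<^sub>0 'k::field)" where
  "basis_vec b \<equiv> Poly_Mapping.single b 1"

definition free_on :: "'b set \<Rightarrow> ('b \<Rightarrow>\<^sub>0 'k::field) set" where
  "free_on B = {v. Poly_Mapping.keys v \<subseteq> B}"

definition lin_ext :: "('b \<Rightarrow> ('c \<Rightarrow>\<^sub>0 'k)) \<Rightarrow> ('b \<Rightarrow>\<^sub>0 'k) \<Rightarrow> ('c \<Rightarrow>\<^sub>0 'k::field)" where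
  "lin_ext f p = (\<Sum>b\<in>Poly_Mapping.keys p. scale (Poly_Mapping.lookup p b) (f b))"

definition bilin_ext ::
    "('b \<Rightarrow> 'c \<Rightarrow> ('d \<Rightarrow>\<^sub>0 'k)) \<Rightarrow> ('b \<Rightarrow>\<^sub>0 'k) \<Rightarrow> ('c \<Rightarrow>\<^sub>0 'k) \<Rightarrow> ('d \<Rightarrow>\<^sub>0 'k::field)" where
  "bilin_ext f p q = lin_ext (\<lambda>b. lin_ext (f b) q) p"


section \<open>Left modules over a ring\<close>

text \<open>The locale \<^locale>\<open>module\<close> of the library is restricted to commutative rings.
  As there, the multiplicative fields of the record of a module carry no information.\<close>

locale left_module = R?: ring R + M?: abelian_group M
  for R :: "('h, 'y) ring_scheme" (structure) and M :: "('h, 'm, 'z) module_scheme" (structure) +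
  assumes smult_closed:
      "\<lbrakk>a \<in> carrier R; x \<in> carrier M\<rbrakk> \<Longrightarrow> a \<odot>\<^bsub>M\<^esub> x \<in> carrier M"
    and smult_l_distr:
      "\<lbrakk>a \<in> carrier R; b \<in> carrier R; x \<in> carrier M\<rbrakk> \<Longrightarrow>
        (a \<oplus>\<^bsub>R\<^esub> b) \<odot>\<^bsub>M\<^esub> x = a \<odot>\<^bsub>M\<^esub> x \<oplus>\<^bsub>M\<^esub> b \<odot>\<^bsub>M\<^esub> x"
    and smult_r_distr:
      "\<lbrakk>a \<in> carrier R; x \<in> carrier M; y \<in> carrier M\<rbrakk> \<Longrightarrow>
        a \<odot>\<^bsub>M\<^esub> (x \<oplus>\<^bsub>M\<^esub> y) = a \<odot>\<^bsub>M\<^esub> x \<oplus>\<^bsub>M\<^esub> a \<odot>\<^bsub>M\<^esub> y"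
    and smult_assoc1:
      "\<lbrakk>a \<in> carrier R; b \<in> carrier R; x \<in> carrier M\<rbrakk> \<Longrightarrow>
        (a \<otimes>\<^bsub>R\<^esub> b) \<odot>\<^bsub>M\<^esub> x = a \<odot>\<^bsub>M\<^esub> (b \<odot>\<^bsub>M\<^esub> x)"
    and smult_one:
      "x \<in> carrier M \<Longrightarrow> \<one>\<^bsub>R\<^esub> \<odot>\<^bsub>M\<^esub> x = x"

definition left_module_iso ::
    "('h, 'z) ring_scheme \<Rightarrow> ('h, 'm) module \<Rightarrow> ('h, 'n) module \<Rightarrow> bool" where
  "left_module_iso R M N \<longleftrightarrow>
     left_module R M \<and> left_module R N \<and>
     (\<exists>f. bij_betw f (carrier M) (carrier N) \<and>
        (\<forall>x\<in>carrier M. \<forall>y\<in>carrier M. f (x \<oplus>\<^bsub>M\<^esub> y) = f x \<oplus>\<^bsub>N\<^esub> f y) \<and>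
        (\<forall>h\<in>carrier R. \<forall>x\<in>carrier M. f (h \<odot>\<^bsub>M\<^esub> x) = h \<odot>\<^bsub>N\<^esub> f x))"

definition direct_sum :: "'i set \<Rightarrow> ('i \<Rightarrow> ('h, 'm) module) \<Rightarrow> ('h, 'i \<Rightarrow> 'm) module" where
  "direct_sum I M =
     \<lparr>carrier = {f \<in> (\<Pi>\<^sub>E i\<in>I. carrier (M i)). finite {i \<in> I. f i \<noteq> \<zero>\<^bsub>M i\<^esub>}},
      monoid.mult = undefined, one = undefined,
      zero = (\<lambda>i\<in>I. \<zero>\<^bsub>M i\<^esub>),
      add = (\<lambda>f f'. \<lambda>i\<in>I. f i \<oplus>\<^bsub>M i\<^esub> f' i),
      smult = (\<lambda>h f. \<lambda>i\<in>I. h \<odot>\<^bsub>M i\<^esub> f i)\<rparr>"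

definition binary_sum :: "('h, 'm) module \<Rightarrow> ('h, 'n) module \<Rightarrow> ('h, 'm \<times> 'n) module"
    (infixr \<open>\<boxplus>\<close> 65) where
  "M \<boxplus> N =
     \<lparr>carrier = carrier M \<times> carrier N,
      monoid.mult = undefined, one = undefined,
      zero = (\<zero>\<^bsub>M\<^esub>, \<zero>\<^bsub>N\<^esub>),
      add = (\<lambda>(x, y) (x', y'). (x \<oplus>\<^bsub>M\<^esub> x', y \<oplus>\<^bsub>N\<^esub> y')),
      smult = (\<lambda>h (x, y). (h \<odot>\<^bsub>M\<^esub> x, h \<odot>\<^bsub>N\<^esub> y))\<rparr>"


section \<open>The Hopf algebra \<open>kG(\<eta>, a, 0)\<close>\<close>

text \<open>The basis element \<open>g x\<^sup>i\<close> is indexed by \<open>(g, i)\<close>. The relation \<open>x g = \<eta>(g) g x\<close> gives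
  \<open>(g x\<^sup>i) (h x\<^sup>j) = \<eta>(h)\<^sup>i g h x\<^sup>i\<^sup>+\<^sup>j\<close>.\<close>

type_synonym ('g, 'k) hopf = "('g \<times> nat) \<Rightarrow>\<^sub>0 'k"

definition mult_basis ::
    "('g, 'z) monoid_scheme \<Rightarrow> ('g \<Rightarrow> 'k::field) \<Rightarrow> 'g \<times> nat \<Rightarrow> 'g \<times> nat \<Rightarrow> ('g, 'k) hopf" where
  "mult_basis G \<eta> = (\<lambda>(g, i) (h, j). Poly_Mapping.single (g \<otimes>\<^bsub>G\<^esub> h, i + j) (\<eta> h ^ i))"

definition hopf_ring :: "('g, 'z) monoid_scheme \<Rightarrow> ('g \<Rightarrow> 'k::field) \<Rightarrow> ('g, 'k) hopf ring" where
  "hopf_ring G \<eta> =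
     \<lparr>carrier = free_on (carrier G \<times> UNIV),
      monoid.mult = bilin_ext (mult_basis G \<eta>),
      one = basis_vec (\<one>\<^bsub>G\<^esub>, 0),
      zero = 0,
      add = (+)\<rparr>"

text \<open>The algebra \<open>H \<otimes> H\<close>, as a vector space on the products of the basis elements of \<open>H\<close>.\<close>

type_synonym ('g, 'k) hopf2 = "(('g \<times> nat) \<times> ('g \<times> nat)) \<Rightarrow>\<^sub>0 'k"

definition pure :: "('g, 'k) hopf \<Rightarrow> ('g, 'k) hopf \<Rightarrow> ('g, 'k::field) hopf2" where
  "pure = bilin_ext (\<lambda>b c. basis_vec (b, c))"

definition hopf2_ring :: "('g, 'z) monoid_scheme \<Rightarrow> ('g \<Rightarrow> 'k::field) \<Rightarrow> ('g, 'k) hopf2 ring" where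
  "hopf2_ring G \<eta> =
     \<lparr>carrier = free_on ((carrier G \<times> UNIV) \<times> (carrier G \<times> UNIV)),
      monoid.mult = bilin_ext (\<lambda>(b, c) (b', c'). pure (mult_basis G \<eta> b b') (mult_basis G \<eta> c c')),
      one = basis_vec ((\<one>\<^bsub>G\<^esub>, 0), (\<one>\<^bsub>G\<^esub>, 0)),
      zero = 0,
      add = (+)\<rparr>"

text \<open>\<open>\<Delta>(g x\<^sup>i) = (g \<otimes> g) (x \<otimes> a + 1 \<otimes> x)\<^sup>i\<close>\<close>

definition comult ::
    "('g, 'z) monoid_scheme \<Rightarrow> ('g \<Rightarrow> 'k::field) \<Rightarrow> 'g \<Rightarrow> ('g, 'k) hopf \<Rightarrow> ('g, 'k) hopf2" where
  "comult G \<eta> a = lin_ext (\<lambda>(g, i).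
     basis_vec ((g, 0), (g, 0)) \<otimes>\<^bsub>hopf2_ring G \<eta>\<^esub>
     (basis_vec ((\<one>\<^bsub>G\<^esub>, 1), (a, 0)) + basis_vec ((\<one>\<^bsub>G\<^esub>, 0), (\<one>\<^bsub>G\<^esub>, 1))) [^]\<^bsub>hopf2_ring G \<eta>\<^esub> i)"


section \<open>Tensor products of modules\<close>

text \<open>\<open>M \<otimes>\<^sub>k N\<close> is the quotient of the vector space on \<open>M \<times> N\<close> by the subspace spanned by
  the bilinearity relations; its elements are cosets. A scalar \<open>c\<close> acts on an \<open>H\<close>-module as the
  element \<open>c 1\<close> of \<open>H\<close>.\<close>

definition tensor_rels ::
    "('g, 'z) monoid_scheme \<Rightarrow> (('g, 'k::field) hopf, 'm) module \<Rightarrow> (('g, 'k) hopf, 'n) module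
      \<Rightarrow> ('m \<times> 'n \<Rightarrow>\<^sub>0 'k) set" where
  "tensor_rels G M N =
     {basis_vec (u \<oplus>\<^bsub>M\<^esub> u', v) - basis_vec (u, v) - basis_vec (u', v) | u u' v.
        u \<in> carrier M \<and> u' \<in> carrier M \<and> v \<in> carrier N} \<union>
     {basis_vec (u, v \<oplus>\<^bsub>N\<^esub> v') - basis_vec (u, v) - basis_vec (u, v') | u v v'.
        u \<in> carrier M \<and> v \<in> carrier N \<and> v' \<in> carrier N} \<union>
     {basis_vec (Poly_Mapping.single (\<one>\<^bsub>G\<^esub>, 0) c \<odot>\<^bsub>M\<^esub> u, v) - scale c (basis_vec (u, v)) | c u v.
        u \<in> carrier M \<and> v \<in> carrier N} \<union>
     {basis_vec (u, Poly_Mapping.single (\<one>\<^bsub>G\<^esub>, 0) c \<odot>\<^bsub>N\<^esub> v) - scale c (basis_vec (u, v)) | c u v.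
        u \<in> carrier M \<and> v \<in> carrier N}"

definition tensor_coset ::
    "('g, 'z) monoid_scheme \<Rightarrow> (('g, 'k::field) hopf, 'm) module \<Rightarrow> (('g, 'k) hopf, 'n) module
      \<Rightarrow> ('m \<times> 'n \<Rightarrow>\<^sub>0 'k) \<Rightarrow> ('m \<times> 'n \<Rightarrow>\<^sub>0 'k) set" where
  "tensor_coset G M N p = {p + z | z. z \<in> Modules.module.span scale (tensor_rels G M N)}"

text \<open>If \<open>\<Delta>(h)\<close> is the sum of the \<open>h\<^sub>1 \<otimes> h\<^sub>2\<close>, then \<open>h\<close> maps the generator \<open>(u, v)\<close> to the sum of
  the \<open>(h\<^sub>1 u, h\<^sub>2 v)\<close>.\<close>

definition tensor_act ::
    "('g, 'z) monoid_scheme \<Rightarrow> ('g \<Rightarrow> 'k::field) \<Rightarrow> 'g \<Rightarrow> (('g, 'k) hopf, 'm) module \<Rightarrow>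
     (('g, 'k) hopf, 'n) module \<Rightarrow> ('g, 'k) hopf \<Rightarrow> ('m \<times> 'n \<Rightarrow>\<^sub>0 'k) \<Rightarrow> ('m \<times> 'n \<Rightarrow>\<^sub>0 'k)" where
  "tensor_act G \<eta> a M N h =
     bilin_ext (\<lambda>(b, c) (u, v). basis_vec (basis_vec b \<odot>\<^bsub>M\<^esub> u, basis_vec c \<odot>\<^bsub>N\<^esub> v)) (comult G \<eta> a h)"

definition tensor ::
    "('g, 'z) monoid_scheme \<Rightarrow> ('g \<Rightarrow> 'k::field) \<Rightarrow> 'g \<Rightarrow> (('g, 'k) hopf, 'm) module \<Rightarrow>
     (('g, 'k) hopf, 'n) module \<Rightarrow> (('g, 'k) hopf, ('m \<times> 'n \<Rightarrow>\<^sub>0 'k) set) module" where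
  "tensor G \<eta> a M N =
     \<lparr>carrier = tensor_coset G M N ` free_on (carrier M \<times> carrier N),
      monoid.mult = undefined, one = undefined,
      zero = tensor_coset G M N 0,
      add = (\<lambda>X Y. {p + q | p q. p \<in> X \<and> q \<in> Y}),
      smult = (\<lambda>h X. \<Union>p\<in>X. tensor_coset G M N (tensor_act G \<eta> a M N h p))\<rparr>"


section \<open>The modules \<open>V\<^sub>t(\<mu>)\<close>\<close>

text \<open>The basis vector \<open>m\<^sub>i\<close> is \<open>basis_vec i\<close>.\<close>

definition V_grp :: "('g \<Rightarrow> 'k::field) \<Rightarrow> ('g \<Rightarrow> 'k) \<Rightarrow> 'g \<Rightarrow> (nat \<Rightarrow>\<^sub>0 'k) \<Rightarrow> (nat \<Rightarrow>\<^sub>0 'k)" where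
  "V_grp \<chi> \<mu> g = lin_ext (\<lambda>i. scale (\<chi> g ^ i * \<mu> g) (basis_vec i))"

definition V_x :: "nat \<Rightarrow> (nat \<Rightarrow>\<^sub>0 'k::field) \<Rightarrow> (nat \<Rightarrow>\<^sub>0 'k)" where
  "V_x t = lin_ext (\<lambda>i. if i + 1 < t then basis_vec (i + 1) else 0)"

definition V :: "('g \<Rightarrow> 'k::field) \<Rightarrow> nat \<Rightarrow> ('g \<Rightarrow> 'k) \<Rightarrow> (('g, 'k) hopf, nat \<Rightarrow>\<^sub>0 'k) module" where
  "V \<chi> t \<mu> =
     \<lparr>carrier = free_on {..<t},
      monoid.mult = undefined, one = undefined,
      zero = 0,
      add = (+),
      smult = bilin_ext (\<lambda>(g, i) j. V_grp \<chi> \<mu> g ((V_x t ^^ i) (basis_vec j)))\<rparr>"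


section \<open>Well-formedness\<close>

lemma lookup_scale: "Poly_Mapping.lookup (scale c v) b = c * Poly_Mapping.lookup v b"
  by (simp add: scale_def map.rep_eq when_def)

lemma vector_space_scale: "vector_space (scale :: 'k::field \<Rightarrow> ('b \<Rightarrow>\<^sub>0 'k) \<Rightarrow> _)"
  by unfold_locales (auto intro!: poly_mapping_eqI simp: lookup_scale lookup_add algebra_simps)

interpretation free: vector_space "scale :: 'k::field \<Rightarrow> ('b \<Rightarrow>\<^sub>0 'k) \<Rightarrow> _"
  by (rule vector_space_scale)

lemma scale_single: "scale c (Poly_Mapping.single b d) = Poly_Mapping.single b (c * d)"
  by (rule poly_mapping_eqI) (simp add: lookup_scale lookup_single when_def)

lemma lin_ext_superset:
  assumes "finite S" "Poly_Mapping.keys p \<subseteq> S"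
  shows "lin_ext f p = (\<Sum>b\<in>S. scale (Poly_Mapping.lookup p b) (f b))"
  unfolding lin_ext_def by (rule sum.mono_neutral_left) (use assms in \<open>auto simp: in_keys_iff\<close>)

lemma lin_ext_add: "lin_ext f (p + q) = lin_ext f p + lin_ext f q"
proof -
  let ?S = "Poly_Mapping.keys p \<union> Poly_Mapping.keys q"
  have "lin_ext f (p + q) = (\<Sum>b\<in>?S. scale (Poly_Mapping.lookup (p+q) b) (f b))"
    by (rule lin_ext_superset) (use Poly_Mapping.keys_add[of p q] in auto)
  also have "\<dots> = lin_ext f p + lin_ext f q"
    by (simp add: lookup_add free.scale_left_distrib sum.distrib lin_ext_superset[of ?S])
  finally show ?thesis .
qed

lemma lin_ext_scale: "lin_ext f (scale c p) = scale c (lin_ext f p)"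
proof -
  have "lin_ext f (scale c p) = (\<Sum>b\<in>Poly_Mapping.keys p. scale (Poly_Mapping.lookup (scale c p) b) (f b))"
    by (rule lin_ext_superset) (auto simp: in_keys_iff lookup_scale)
  thus ?thesis by (simp add: lin_ext_def lookup_scale free.scale_sum_right)
qed

lemma lin_ext_zero [simp]: "lin_ext f 0 = 0"
  by (simp add: lin_ext_def)

lemma lin_ext_single [simp]: "lin_ext f (Poly_Mapping.single b c) = scale c (f b)"
  by (cases "c = 0") (simp_all add: lin_ext_def)

lemma lin_ext_fun_add: "lin_ext (\<lambda>b. f b + g b) p = lin_ext f p + lin_ext g p"
  by (simp add: lin_ext_def free.scale_right_distrib sum.distrib)

lemma lin_ext_fun_scale: "lin_ext (\<lambda>b. scale c (f b)) p = scale c (lin_ext f p)"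
  by (simp add: lin_ext_def free.scale_sum_right mult.commute)

lemma free_on_subspace: "free.subspace (free_on B)"
  by (auto simp: free.subspace_def free_on_def in_keys_iff lookup_scale subset_iff lookup_add)
    (metis add_0)

lemma free_on_induct [consumes 1, case_names single add]:
  assumes "p \<in> free_on B"
    and "\<And>b c. b \<in> B \<Longrightarrow> P (Poly_Mapping.single b c)" and "P 0"
    and "\<And>p q. \<lbrakk>p \<in> free_on B; q \<in> free_on B; P p; P q\<rbrakk> \<Longrightarrow> P (p + q)"
  shows "P p"
proof -
  have "\<forall>S. finite S \<longrightarrow> (\<forall>p. Poly_Mapping.keys p = S \<longrightarrow> S \<subseteq> B \<longrightarrow> P p)"
  proof (intro allI impI)
    fix S :: "'a set" and p :: "'a \<Rightarrow>\<^sub>0 'b"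
    assume "finite S" "Poly_Mapping.keys p = S" "S \<subseteq> B"
    thus "P p"
    proof (induction S arbitrary: p)
      case empty thus ?case using assms(3) by simp
    next
      case (insert x F)
      let ?q = "p - Poly_Mapping.single x (Poly_Mapping.lookup p x)"
      have k: "Poly_Mapping.keys ?q = F"
        using insert by (auto simp: in_keys_iff lookup_minus lookup_single when_def set_eq_iff split: if_splits)
      have "P (Poly_Mapping.single x (Poly_Mapping.lookup p x) + ?q)"
        by (rule assms(4)) (use insert k assms(2) in \<open>auto simp: free_on_def\<close>)
      thus ?case by simp
    qed
  qed
  thus ?thesis using assms(1) unfolding free_on_def by (metis finite_keys mem_Collect_eq)
qed

lemma lin_ext_closed:
  assumes "p \<in> free_on B" "\<And>b. b \<in> B \<Longrightarrow> f b \<in> free_on C"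
  shows "lin_ext f p \<in> free_on C"
  unfolding lin_ext_def using assms
  by (intro free.subspace_sum[OF free_on_subspace] free.subspace_scale[OF free_on_subspace])
     (auto simp: free_on_def)

lemma bilin_ext_single [simp]:
  "bilin_ext f (Poly_Mapping.single b c) (Poly_Mapping.single b' c') = scale (c * c') (f b b')"
  by (simp add: bilin_ext_def)

lemma bilin_ext_single_left [simp]:
  "bilin_ext f (Poly_Mapping.single b c) q = scale c (lin_ext (f b) q)"
  by (simp add: bilin_ext_def)

lemma bilin_ext_closed:
  assumes "p \<in> free_on B" "q \<in> free_on C" "\<And>b c. b \<in> B \<Longrightarrow> c \<in> C \<Longrightarrow> f b c \<in> free_on D"
  shows "bilin_ext f p q \<in> free_on D"
  unfolding bilin_ext_def by (intro lin_ext_closed[OF assms(1)] lin_ext_closed[OF assms(2)] assms(3))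

lemma bilin_ext_add_left: "bilin_ext f (p + p') q = bilin_ext f p q + bilin_ext f p' q"
  by (simp add: bilin_ext_def lin_ext_add)

lemma bilin_ext_add_right: "bilin_ext f p (q + q') = bilin_ext f p q + bilin_ext f p q'"
  by (simp add: bilin_ext_def lin_ext_add lin_ext_fun_add)

lemma bilin_ext_zero_left [simp]: "bilin_ext f 0 q = 0"
  by (simp add: bilin_ext_def)

lemma bilin_ext_zero_right [simp]: "bilin_ext f p 0 = 0"
  by (simp add: bilin_ext_def) (simp add: lin_ext_def)

lemma single_in_free_on [simp]: "b \<in> B \<Longrightarrow> Poly_Mapping.single b c \<in> free_on B"
  by (auto simp: free_on_def)

lemma free_on_add [simp, intro]: "p \<in> free_on B \<Longrightarrow> q \<in> free_on B \<Longrightarrow> p + q \<in> free_on B"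
  using free.subspace_add[OF free_on_subspace] .

lemma free_on_uminus [simp, intro]: "p \<in> free_on B \<Longrightarrow> - p \<in> free_on B"
  using free.subspace_neg[OF free_on_subspace] .

lemma free_on_zero [simp, intro]: "0 \<in> free_on B"
  by (auto simp: free_on_def)

lemma bilin_assoc:
  assumes p: "p \<in> free_on A" and q: "q \<in> free_on B" and r: "r \<in> free_on C"
    and eq: "\<And>x y z. x \<in> A \<Longrightarrow> y \<in> B \<Longrightarrow> z \<in> C \<Longrightarrow> 
       bilin_ext F (f x y) (basis_vec z) = bilin_ext g (basis_vec x) (h y z)"
  shows "bilin_ext F (bilin_ext f p q) r = bilin_ext g p (bilin_ext h q r)"
  using p
proof (induction rule: free_on_induct)
  case (single x cx)
  show ?case using q
  proof (induction rule: free_on_induct)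
    case (single y cy)
    show ?case using r
    proof (induction rule: free_on_induct)
      case (single z cz)
      have b1: "bilin_ext F (scale c u) (Poly_Mapping.single z cz) = scale (c*cz) (bilin_ext F u (basis_vec z))" for c u
        by (simp add: bilin_ext_def lin_ext_scale lin_ext_fun_scale[symmetric])
      show ?case using eq[of x y z] single \<open>x \<in> A\<close> \<open>y\<in>B\<close> by (simp add: b1 lin_ext_scale mult.assoc)
    qed (simp_all add: bilin_ext_add_right del: bilin_ext_single bilin_ext_single_left)
  qed (simp_all add: bilin_ext_add_right bilin_ext_add_left del: bilin_ext_single bilin_ext_single_left)
qed (simp_all add: bilin_ext_add_left)

lemma abelian_group_free_on:
  assumes "carrier R = free_on B" "zero R = 0" "add R = (+)"
  shows "abelian_group R"
proof (rule abelian_groupI, goal_cases)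
  case (6 x)
  show ?case by (rule bexI[of _ "- x"]) (use 6 assms in auto)
qed (use assms in \<open>auto simp: add_ac\<close>)

lemma char_one: 
  assumes "group G" "\<eta> \<in> carrier (char_group G)" shows "\<eta> \<one>\<^bsub>G\<^esub> = (1::'k::field)"
proof -
  interpret group G by fact
  have "\<eta> \<one>\<^bsub>G\<^esub> \<noteq> 0" "\<eta> (\<one>\<^bsub>G\<^esub> \<otimes>\<^bsub>G\<^esub> \<one>\<^bsub>G\<^esub>) = \<eta> \<one>\<^bsub>G\<^esub> * \<eta> \<one>\<^bsub>G\<^esub>"
    using assms(2) unfolding char_group_def field_units_def hom_def by force+
  thus ?thesis by simp
qed

lemma char_mult: 
  assumes "\<eta> \<in> carrier (char_group G)" "g \<in> carrier G" "h \<in> carrier G"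
  shows "\<eta> (g \<otimes>\<^bsub>G\<^esub> h) = \<eta> g * (\<eta> h::'k::field)"
  using assms unfolding char_group_def field_units_def hom_def by auto

lemma ring_hopf_ring:
  fixes \<eta> :: "'g \<Rightarrow> 'k::field"
  assumes "group G" "\<eta> \<in> carrier (char_group G)"
  shows "ring (hopf_ring G \<eta>)"
proof -
  interpret group G by fact
  note c = char_one[OF assms] char_mult[OF assms(2)]
  note [simp del] = bilin_ext_single_left
  show ?thesis
  proof (rule ringI)
    show "abelian_group (hopf_ring G \<eta>)"
      by (rule abelian_group_free_on) (auto simp: hopf_ring_def)
    show "monoid (hopf_ring G \<eta>)"
    proof (rule monoidI, goal_cases)
      case (1 x y)
      thus ?case by (auto simp: hopf_ring_def mult_basis_def intro!: bilin_ext_closed)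
    next
      case 2 show ?case by (auto simp: hopf_ring_def)
    next
      case (3 x y z)
      show ?case unfolding hopf_ring_def monoid.simps
        by (rule bilin_assoc) (use 3 in \<open>auto simp: hopf_ring_def mult_basis_def c m_assoc add_ac
              mult_ac scale_single power_mult_distrib power_add\<close>)
    next
      case (4 x)
      hence "x \<in> free_on (carrier G \<times> UNIV)" by (simp add: hopf_ring_def)
      thus ?case by (induction rule: free_on_induct)
          (auto simp: hopf_ring_def mult_basis_def c scale_single bilin_ext_add_right)
    next
      case (5 x)
      hence "x \<in> free_on (carrier G \<times> UNIV)" by (simp add: hopf_ring_def)
      thus ?case by (induction rule: free_on_induct)
          (auto simp: hopf_ring_def mult_basis_def c scale_single bilin_ext_add_left)
    qed
  qed (simp_all add: hopf_ring_def bilin_ext_add_left bilin_ext_add_right)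
qed

lemma bilin_ext_scale_left: "bilin_ext f (scale c p) q = scale c (bilin_ext f p q)"
  by (simp add: bilin_ext_def lin_ext_scale)

lemma bilin_ext_scale_right: "bilin_ext f p (scale c q) = scale c (bilin_ext f p q)"
  by (simp add: bilin_ext_def lin_ext_scale lin_ext_fun_scale)

lemma V_x_pow: "(V_x t ^^ i) (basis_vec j) = (if i + j < t \<or> i = 0 then basis_vec (i + j) else 0)"
  by (induction i) (auto simp: V_x_def scale_single)

lemma left_module_V:
  fixes \<chi> :: "'g \<Rightarrow> 'k::field"
  assumes "group G" "\<chi> \<in> carrier (char_group G)" "\<mu> \<in> carrier (char_group G)"
    "\<eta> \<in> carrier (char_group G)" "\<And>g. g \<in> carrier G \<Longrightarrow> \<eta> g * \<chi> g = 1"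
  shows "left_module (hopf_ring G \<eta>) (V \<chi> t \<mu>)"
proof -
  interpret group G by fact
  note c = char_one[OF assms(1)] char_mult[OF assms(2)] char_mult[OF assms(3)]
  note [simp del] = bilin_ext_single_left
  have inv: "\<eta> g ^ i * \<chi> g ^ i = 1" if "g \<in> carrier G" for g i
    using assms(5)[OF that] by (simp flip: power_mult_distrib)
  show ?thesis
  proof (intro left_module.intro ring_hopf_ring assms left_module_axioms.intro, goal_cases)
    case 1
    show ?case by (rule abelian_group_free_on) (auto simp: V_def)
  next
    case 2
    thus ?case by (auto simp: hopf_ring_def V_def V_grp_def V_x_pow scale_single intro!: bilin_ext_closed)
  next
    case (5 p q v)
    show ?case unfolding hopf_ring_def V_def module.simps monoid.simps
    proof (rule bilin_assoc[symmetric, symmetric, of _ "carrier G \<times> UNIV" _ "carrier G \<times> UNIV" _ "{..<t}"], goal_cases)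
      case (4 x y z)
      obtain g i h j where xy: "x = (g, i)" "y = (h, j)" by fastforce
      have nz: "\<chi> h \<noteq> 0" and e: "\<eta> h = inverse (\<chi> h)"
        using assms(5)[of h] 4 xy inverse_unique[of "\<chi> h" "\<eta> h"] by (auto simp: mult.commute)
      show ?case using 4 nz
        by (auto simp: xy e mult_basis_def V_grp_def V_x_pow scale_single c power_add power_mult_distrib field_simps)
    qed (use 5 in \<open>auto simp: hopf_ring_def V_def\<close>)
  next
    case (6 v)
    hence "v \<in> free_on {..<t}" by (simp add: V_def)
    thus ?case by (induction rule: free_on_induct)
        (auto simp: hopf_ring_def V_def V_grp_def c assms scale_single bilin_ext_add_right)
  qed (simp_all add: hopf_ring_def V_def bilin_ext_add_left bilin_ext_add_right)
qed

lemma ring_hopf2: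
  fixes \<eta> :: "'g \<Rightarrow> 'k::field"
  assumes "group G" "\<eta> \<in> carrier (char_group G)"
  shows "ring (hopf2_ring G \<eta>)"
proof -
  interpret group G by fact
  note c = char_one[OF assms] char_mult[OF assms(2)]
  note [simp del] = bilin_ext_single_left
  show ?thesis
  proof (rule ringI)
    show "abelian_group (hopf2_ring G \<eta>)"
      by (rule abelian_group_free_on) (auto simp: hopf2_ring_def)
    show "monoid (hopf2_ring G \<eta>)"
    proof (rule monoidI, goal_cases)
      case (1 x y)
      show ?case unfolding hopf2_ring_def monoid.simps partial_object.simps
        by (rule bilin_ext_closed) (use 1 in \<open>auto simp: hopf2_ring_def mult_basis_def pure_def scale_single\<close>)
    next
      case 2 show ?case by (auto simp: hopf2_ring_def)
    next
      case (3 x y z)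
      show ?case unfolding hopf2_ring_def monoid.simps
        by (rule bilin_assoc) (use 3 in \<open>auto simp: hopf2_ring_def mult_basis_def c m_assoc add_ac
              mult_ac scale_single power_mult_distrib power_add pure_def\<close>)
    next
      case (4 x)
      hence "x \<in> free_on ((carrier G \<times> UNIV) \<times> (carrier G \<times> UNIV))" by (simp add: hopf2_ring_def)
      thus ?case by (induction rule: free_on_induct)
          (auto simp: hopf2_ring_def mult_basis_def c scale_single bilin_ext_add_right pure_def)
    next
      case (5 x)
      hence "x \<in> free_on ((carrier G \<times> UNIV) \<times> (carrier G \<times> UNIV))" by (simp add: hopf2_ring_def)
      thus ?case by (induction rule: free_on_induct)
          (auto simp: hopf2_ring_def mult_basis_def c scale_single bilin_ext_add_left pure_def)
    qed
  qed (simp_all add: hopf2_ring_def bilin_ext_add_left bilin_ext_add_right)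
qed

lemma
  fixes \<eta> :: "'g \<Rightarrow> 'k::field"
  assumes "group G" "\<eta> \<in> carrier (char_group G)" "a \<in> carrier G" "g \<in> carrier G"
  shows comult_x: "comult G \<eta> a (basis_vec (\<one>\<^bsub>G\<^esub>, 1)) = 
      pure (basis_vec (\<one>\<^bsub>G\<^esub>, 1)) (basis_vec (a, 0)) + pure (basis_vec (\<one>\<^bsub>G\<^esub>, 0)) (basis_vec (\<one>\<^bsub>G\<^esub>, 1))"
   and comult_g: "comult G \<eta> a (basis_vec (g, 0)) = pure (basis_vec (g,0)) (basis_vec (g,0))"
   and act_x: "tensor_act G \<eta> a M N (basis_vec (\<one>\<^bsub>G\<^esub>, 1)) (basis_vec (u,v)) = 
     basis_vec (basis_vec (\<one>\<^bsub>G\<^esub>, 1) \<odot>\<^bsub>M\<^esub> u, basis_vec (a,0) \<odot>\<^bsub>N\<^esub> v) + 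
     basis_vec (basis_vec (\<one>\<^bsub>G\<^esub>, 0) \<odot>\<^bsub>M\<^esub> u, basis_vec (\<one>\<^bsub>G\<^esub>, 1) \<odot>\<^bsub>N\<^esub> v)"
   and act_g: "tensor_act G \<eta> a M N (basis_vec (g, 0)) (basis_vec (u,v)) = 
     basis_vec (basis_vec (g,0) \<odot>\<^bsub>M\<^esub> u, basis_vec (g,0) \<odot>\<^bsub>N\<^esub> v)"
proof -
  interpret group G by fact
  interpret H: ring "hopf_ring G \<eta>" by (rule ring_hopf_ring) fact+
  interpret H2: ring "hopf2_ring G \<eta>" by (rule ring_hopf2) fact+
  have eq: "basis_vec ((\<one>\<^bsub>G\<^esub>,0),(\<one>\<^bsub>G\<^esub>,0)) = one (hopf2_ring G \<eta>)" "(+) = add (hopf2_ring G \<eta>)"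
    by (auto simp: hopf2_ring_def)
  have c1: "basis_vec ((g,0),(g,0)) \<in> carrier (hopf2_ring G \<eta>)" 
    using assms(4) by (simp add: hopf2_ring_def)
  have c2: "basis_vec ((\<one>\<^bsub>G\<^esub>, 1), (a, 0)) + basis_vec ((\<one>\<^bsub>G\<^esub>, 0), (\<one>\<^bsub>G\<^esub>, 1)) \<in> carrier (hopf2_ring G \<eta>)"
    using assms(3) by (simp add: hopf2_ring_def)
  show x: "comult G \<eta> a (basis_vec (\<one>\<^bsub>G\<^esub>, 1)) = 
      pure (basis_vec (\<one>\<^bsub>G\<^esub>, 1)) (basis_vec (a, 0)) + pure (basis_vec (\<one>\<^bsub>G\<^esub>, 0)) (basis_vec (\<one>\<^bsub>G\<^esub>, 1))"
    using c2 by (simp add: comult_def eq(1)) (simp add: pure_def scale_single)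
  show g: "comult G \<eta> a (basis_vec (g, 0)) = pure (basis_vec (g,0)) (basis_vec (g,0))"
    using c1 by (simp add: comult_def) (simp add: pure_def scale_single)
  show "tensor_act G \<eta> a M N (basis_vec (\<one>\<^bsub>G\<^esub>, 1)) (basis_vec (u,v)) = 
     basis_vec (basis_vec (\<one>\<^bsub>G\<^esub>, 1) \<odot>\<^bsub>M\<^esub> u, basis_vec (a,0) \<odot>\<^bsub>N\<^esub> v) + 
     basis_vec (basis_vec (\<one>\<^bsub>G\<^esub>, 0) \<odot>\<^bsub>M\<^esub> u, basis_vec (\<one>\<^bsub>G\<^esub>, 1) \<odot>\<^bsub>N\<^esub> v)"
    unfolding tensor_act_def x by (simp add: pure_def scale_single bilin_ext_add_left)
  show "tensor_act G \<eta> a M N (basis_vec (g, 0)) (basis_vec (u,v)) = 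
     basis_vec (basis_vec (g,0) \<odot>\<^bsub>M\<^esub> u, basis_vec (g,0) \<odot>\<^bsub>N\<^esub> v)"
    unfolding tensor_act_def g by (simp add: pure_def scale_single bilin_ext_add_left)
qed

lemma group_char_group:
  assumes "group G"
  shows "group (char_group G :: ('g \<Rightarrow> 'k::field) monoid)"
    and "\<chi> \<in> carrier (char_group G) \<Longrightarrow> g \<in> carrier G \<Longrightarrow> (inv\<^bsub>char_group G\<^esub> \<chi>) g = inverse (\<chi> g :: 'k)"
proof -
  interpret group G by fact
  have inv: "(\<lambda>g\<in>carrier G. inverse (\<chi> g)) \<in> carrier (char_group G)"
    "(\<lambda>g\<in>carrier G. inverse (\<chi> g)) \<otimes>\<^bsub>char_group G\<^esub> \<chi> = \<one>\<^bsub>char_group G\<^esub>" 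
    if "\<chi> \<in> carrier (char_group G)" for \<chi> :: "'g \<Rightarrow> 'k"
    using that by (auto simp: char_group_def field_units_def hom_def fun_eq_iff restrict_def Pi_def extensional_def)
  show *: "group (char_group G :: ('g \<Rightarrow> 'k::field) monoid)"
  proof (rule groupI, goal_cases)
    case (5 x)
    show ?case using inv[OF 5] by blast
  qed (auto simp: char_group_def field_units_def hom_def fun_eq_iff restrict_def Pi_def extensional_def)
  interpret C: group "char_group G :: ('g \<Rightarrow> 'k::field) monoid" by fact
  assume \<chi>: "\<chi> \<in> carrier (char_group G)" and g: "g \<in> carrier G"
  have "inv\<^bsub>char_group G\<^esub> \<chi> = (\<lambda>g\<in>carrier G. inverse (\<chi> g))"
    by (rule C.inv_equality) (use inv[OF \<chi>] \<chi> in auto)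
  thus "(inv\<^bsub>char_group G\<^esub> \<chi>) g = inverse (\<chi> g)" using g by simp
qed

end

theory Submission
  imports Defs
begin

text \<open>Both tensor products are graded with \<open>x\<close> acting in degree \<open>1\<close> and \<open>G\<close> acting by
  characters in each degree. Up to a rescaling of the basis, \<open>x\<close> is left multiplication by
  \<open>z = X + Y\<close> on \<open>A / (A X\<^sup>n + A Y\<^sup>t)\<close>, where \<open>A\<close> is the quantum plane \<open>Y X = q X Y\<close> and \<open>q\<close> or
  \<open>q\<^sup>-\<^sup>1\<close> equals \<open>\<chi> a\<close>. Since \<open>A / z A\<close> is one-dimensional in every degree, homogeneous elements
  \<open>w\<^sub>d\<close> of degree \<open>d < t\<close> outside \<open>z A\<close> generate the quotient over \<open>k[z]\<close>. If moreover
  \<open>z\<^bsup>p(d)\<^esup> w\<^sub>d = 0\<close> with the \<open>p(d)\<close> adding up to \<open>n t\<close>, then the quotient is the direct sum of the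
  strings of the \<open>w\<^sub>d\<close>. To find the \<open>w\<^sub>d\<close>, note that \<open>u = X\<^sup>s\<close> and \<open>v = Y\<^sup>s\<close> are central and
  \<open>z\<^sup>s = u + v\<close>. When the length is a multiple of \<open>s\<close>, a monomial times a lowest weight vector of
  \<open>k[u, v] / (u\<^sup>N, v\<^sup>T)\<close> works. The other strings come in pairs: with \<open>c\<close> a lowest weight vector of
  \<open>V\<^sub>l\<^sub>' \<otimes> V\<^sub>l\<close> one has \<open>z\<^sup>\<delta> c = f + g\<close> with \<open>f\<close> divisible by \<open>X\<^bsup>l'\<^esup>\<close> and \<open>g\<close> by \<open>Y\<^sup>l\<close>, and
  \<open>w\<^sub>d\<close> is a combination of \<open>c\<close> and \<open>f\<close> with coefficients in \<open>k[u, v, z]\<close> built from lowest weight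
  vectors for two different pairs \<open>(N, T)\<close>.\<close>

section \<open>Linear maps on free vector spaces\<close>

text \<open>Membership in \<open>z A\<close> is tested by one functional \<open>ev\<close> per
  degree, and \<open>ev\<close> is multiplicative for the action of k[u, v]. A generator is thus
  certified by nonzero Gaussian binomials, at q because the upper index stays below s, at 1 by
  characteristic zero. The obstacle is the splitting f + g: f needs a coefficient that dies modulo
  (u^r', v^(r+1)), and g one that dies modulo (u^(r'+1), v^r). Two lowest weight vectors of the same
  degree, scaled to the same value of \<open>ev\<close>, differ by a multiple of u + v = z^s, and
  this difference is what the correction terms absorb. The larger tensor factor always plays X.
  Exchanging the factors then inverts q but leaves all lengths unchanged, so both products are
  isomorphic to the same sum of strings. The module laws of a tensor product are not verified on
  cosets; they are transported from the direct sum of strings.\<close>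

abbreviation lin :: "(('b \<Rightarrow>\<^sub>0 'k::field) \<Rightarrow> ('c \<Rightarrow>\<^sub>0 'k)) \<Rightarrow> bool" where
  "lin f \<equiv> module_hom scale scale f"

lemma module_scale: "Modules.module (scale :: 'k::field \<Rightarrow> ('b \<Rightarrow>\<^sub>0 'k) \<Rightarrow> _)"
  using vector_space_scale module_iff_vector_space by blast

lemma linI:
  assumes "\<And>p q. f (p + q) = f p + f q" "\<And>c p. f (scale c p) = scale c (f p)"
  shows "lin f"
  by (intro module_hom.intro module_scale module_hom_axioms.intro assms)

lemma lin_lin_ext: "lin (lin_ext f)"
  by (intro linI lin_ext_add lin_ext_scale)

lemma lin_bilin_ext_left: "lin (\<lambda>p. bilin_ext f p q)"
  by (intro linI bilin_ext_add_left bilin_ext_scale_left)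

lemma lin_bilin_ext_right: "lin (bilin_ext f p)"
  by (intro linI bilin_ext_add_right bilin_ext_scale_right)

lemma lin_id: "lin id" "lin (\<lambda>p. p)"
  by (auto intro: linI)

lemma lin_compose: "lin f \<Longrightarrow> lin g \<Longrightarrow> lin (\<lambda>p. f (g p))"
  by (intro linI) (simp_all add: module_hom.add module_hom.scale)

lemma lin_add: "lin f \<Longrightarrow> lin g \<Longrightarrow> lin (\<lambda>p. f p + g p)"
  by (intro linI) (simp_all add: module_hom.add module_hom.scale free.scale_right_distrib)

lemma lin_scale: "lin f \<Longrightarrow> lin (\<lambda>p. scale c (f p))"
  by (intro linI) (simp_all add: module_hom.add module_hom.scale free.scale_right_distrib mult.commute)

lemma lin_funpow:
  fixes f :: "('b \<Rightarrow>\<^sub>0 'k::field) \<Rightarrow> ('b \<Rightarrow>\<^sub>0 'k)"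
  shows "lin f \<Longrightarrow> lin (f ^^ m)"
  by (induction m) (simp_all add: lin_id comp_def lin_compose)

lemma lin_eq_on_free:
  assumes "lin f" "lin g" "\<And>b. b \<in> B \<Longrightarrow> f (basis_vec b) = g (basis_vec b)" "p \<in> free_on B"
  shows "f p = g p"
  using assms(4)
proof (induction rule: free_on_induct)
  case (single b c)
  have "Poly_Mapping.single b c = scale c (basis_vec b)" by (simp add: scale_single)
  then show ?case using single assms(1-3) by (simp only: module_hom.scale)
qed (use assms(1,2) in \<open>simp_all add: module_hom.add module_hom.zero\<close>)

lemma lin_closed_on_free:
  assumes "lin f" "\<And>b. b \<in> B \<Longrightarrow> f (basis_vec b) \<in> free_on C" "p \<in> free_on B"
  shows "f p \<in> free_on C"
  using assms(3)
proof (induction rule: free_on_induct)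
  case (single b c)
  have "Poly_Mapping.single b c = scale c (basis_vec b)" by (simp add: scale_single)
  then have "f (Poly_Mapping.single b c) = scale c (f (basis_vec b))"
    by (simp only: module_hom.scale[OF assms(1)])
  then show ?case using assms(2)[OF single] free.subspace_scale[OF free_on_subspace] by metis
qed (use assms(1) in \<open>simp_all add: module_hom.add module_hom.zero\<close>)

lemma free_on_UNIV: "p \<in> free_on UNIV"
  by (simp add: free_on_def)

lemma lin_eqI: "lin f \<Longrightarrow> lin g \<Longrightarrow> (\<And>b. f (basis_vec b) = g (basis_vec b)) \<Longrightarrow> f = g"
  using lin_eq_on_free[OF _ _ _ free_on_UNIV] by (intro ext) blast

lemma bilin_eqI:
  assumes "\<And>q. lin (\<lambda>p. f p q)" "\<And>p. lin (f p)" "\<And>q. lin (\<lambda>p. g p q)" "\<And>p. lin (g p)"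
    and "\<And>b c. f (basis_vec b) (basis_vec c) = g (basis_vec b) (basis_vec c)"
  shows "f p q = g p q"
proof -
  have "f (basis_vec b) = g (basis_vec b)" for b
    by (rule lin_eqI) (use assms in auto)
  then have "(\<lambda>p. f p q) = (\<lambda>p. g p q)"
    by (intro lin_eqI assms) simp
  then show ?thesis by meson
qed

lemma free_on_mono: "B \<subseteq> C \<Longrightarrow> p \<in> free_on B \<Longrightarrow> p \<in> free_on C"
  by (auto simp: free_on_def)

lemma free_on_diff [intro]: "p \<in> free_on B \<Longrightarrow> q \<in> free_on B \<Longrightarrow> p - q \<in> free_on B"
  using free.subspace_diff[OF free_on_subspace] .

lemma free_on_scale [intro]: "p \<in> free_on B \<Longrightarrow> scale c p \<in> free_on B"
  using free.subspace_scale[OF free_on_subspace] .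

lemma free_on_iff: "p \<in> free_on B \<longleftrightarrow> (\<forall>b. Poly_Mapping.lookup p b \<noteq> 0 \<longrightarrow> b \<in> B)"
  by (auto simp: free_on_def in_keys_iff)

lemma free_on_Un_split:
  fixes p :: "'b \<Rightarrow>\<^sub>0 'c::field"
  assumes "p \<in> free_on (B \<union> C)"
  obtains p1 p2 where "p = p1 + p2" "p1 \<in> free_on B" "p2 \<in> free_on C"
proof -
  have "\<exists>p1 p2. p = p1 + p2 \<and> p1 \<in> free_on B \<and> p2 \<in> free_on C"
    using assms
  proof (induction rule: free_on_induct)
    case (single b c)
    then show ?case
    proof
      assume "b \<in> B"
      then show ?thesis by (intro exI[of _ "Poly_Mapping.single b c"] exI[of _ 0]) auto
    next
      assume "b \<in> C"
      then show ?thesis by (intro exI[of _ 0] exI[of _ "Poly_Mapping.single b c"]) auto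
    qed
  next
    fix p q :: "'b \<Rightarrow>\<^sub>0 'c"
    assume "\<exists>p1 p2. p = p1 + p2 \<and> p1 \<in> free_on B \<and> p2 \<in> free_on C"
      "\<exists>p1 p2. q = p1 + p2 \<and> p1 \<in> free_on B \<and> p2 \<in> free_on C"
    then obtain p1 p2 q1 q2 where "p = p1 + p2" "q = q1 + q2" "p1 \<in> free_on B" "q1 \<in> free_on B"
        "p2 \<in> free_on C" "q2 \<in> free_on C" by blast
    then show "\<exists>p1 p2. p + q = p1 + p2 \<and> p1 \<in> free_on B \<and> p2 \<in> free_on C"
      by (intro exI[of _ "p1 + q1"] exI[of _ "p2 + q2"]) (auto simp: algebra_simps)
  next
    \<comment> \<open>The induction rule names only two of its three cases: \<open>add\<close> is
      the case of the zero vector, and the case of a sum stays unnamed.\<close>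
    case add
    show ?case by (intro exI[of _ 0]) auto
  qed
  then show ?thesis using that by blast
qed

section \<open>Complete homogeneous symmetric functions of a geometric progression\<close>

text \<open>\<open>qhom q b i\<close> is the complete homogeneous symmetric function of degree \<open>i\<close> in
  \<open>1, q, \<dots>, q\<^bsup>b-1\<^esup>\<close>, that is, the Gaussian binomial coefficient of \<open>b + i - 1\<close> over \<open>i\<close>.\<close>

fun qhom :: "'k::comm_ring_1 \<Rightarrow> nat \<Rightarrow> nat \<Rightarrow> 'k" where
  "qhom q b 0 = 1"
| "qhom q 0 (Suc i) = 0"
| "qhom q (Suc b) (Suc i) = qhom q b (Suc i) + q ^ b * qhom q (Suc b) i"

lemma qhom_one [simp]: "qhom q (Suc 0) i = 1"
  by (induction i) auto

text \<open>The defining recursion splits off the last variable q^b. This one splits off the first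
  variable 1: the others are q times a progression of length b, which gives q^(i+1) by
  homogeneity.\<close>

lemma qhom_rec2: "qhom q (Suc b) (Suc i) = q ^ Suc i * qhom q b (Suc i) + qhom q (Suc b) i"
proof (induction b arbitrary: i)
  case (Suc b)
  show ?case
  proof (induction i)
    case 0
    have "qhom q (Suc (Suc b)) (Suc 0) = (q ^ Suc 0 * qhom q b (Suc 0) + 1) + q * q ^ b"
      unfolding qhom.simps(3)[of _ "Suc b"] Suc[of 0] by simp
    also have "\<dots> = q * (qhom q b (Suc 0) + q ^ b) + 1" by (simp add: algebra_simps)
    finally show ?case by simp
  next
    case IH: (Suc i)
    have "qhom q (Suc (Suc b)) (Suc (Suc i)) =
        (q ^ Suc (Suc i) * qhom q b (Suc (Suc i)) + qhom q (Suc b) (Suc i)) +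
        q ^ Suc b * (q ^ Suc i * qhom q (Suc b) (Suc i) + qhom q (Suc (Suc b)) i)"
      unfolding Suc[of "Suc i", symmetric] IH[symmetric] by simp
    also have "\<dots> = q ^ Suc (Suc i) * qhom q (Suc b) (Suc (Suc i)) + qhom q (Suc (Suc b)) (Suc i)"
      by (simp add: algebra_simps)
    finally show ?case .
  qed
qed simp

text \<open>Eliminating the term in b variables between the two recursions gives this identity
  without division, so it is available at roots of unity.\<close>

lemma qhom_absorb: "(q ^ Suc i - 1) * qhom q (Suc b) (Suc i) = (q ^ Suc (b + i) - 1) * qhom q (Suc b) i"
proof -
  have "q ^ Suc i * qhom q (Suc b) (Suc i) - qhom q (Suc b) (Suc i) =
      q ^ Suc i * (qhom q b (Suc i) + q ^ b * qhom q (Suc b) i) -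
      (q ^ Suc i * qhom q b (Suc i) + qhom q (Suc b) i)"
    unfolding qhom_rec2[symmetric] by simp
  then show ?thesis by (simp add: algebra_simps power_add)
qed

text \<open>The Gaussian binomial of s over i + 1: in \<open>qhom_absorb\<close> the factor q^s - 1
  vanishes, while q^(i+1) - 1 does not because i + 1 < s.\<close>

lemma qhom_zero_of_root:
  fixes q :: "'k::field"
  assumes "primitive_root_unity s q" "Suc (b + i) = s" "b > 0"
  shows "qhom q (Suc b) (Suc i) = 0"
proof -
  have "q ^ Suc i \<noteq> 1" "q ^ Suc (b + i) = 1"
    using assms by (auto simp: primitive_root_unity_def simp del: power_Suc)
  then show ?thesis
    using qhom_absorb[of q i b] by (simp del: power_Suc qhom.simps)
qed

lemma qhom_nonzero_of_root:
  fixes q :: "'k::field"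
  assumes "primitive_root_unity s q" "b + i < s"
  shows "qhom q (Suc b) i \<noteq> 0"
  using assms(2)
proof (induction i)
  case (Suc i)
  have "q ^ Suc (b + i) \<noteq> 1"
    using assms(1) Suc.prems unfolding primitive_root_unity_def
    by (metis add_Suc_right zero_less_Suc)
  then show ?case
    using qhom_absorb[of q i b] Suc by (auto simp del: power_Suc qhom.simps)
qed auto

lemma qhom_1_eq_binomial: "qhom (1 :: 'k::field_char_0) (Suc b) i = of_nat ((b + i) choose i)"
proof (induction b arbitrary: i)
  case (Suc b)
  show ?case
  proof (induction i)
    case IH: (Suc i)
    have "(Suc b + Suc i) choose Suc i = ((b + Suc i) choose Suc i) + ((Suc b + i) choose i)"
      by simp
    then show ?case by (simp only: qhom.simps(3)[of _ "Suc b"] Suc IH of_nat_add power_one mult_1)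
  qed simp
qed simp

lemma qhom_1_nonzero: "b > 0 \<Longrightarrow> qhom (1 :: 'k::field_char_0) b i \<noteq> 0"
  by (cases b) (simp_all add: qhom_1_eq_binomial)


section \<open>The quantum plane as a module over \<open>x\<close>\<close>

text \<open>The basis vector \<open>(i, j)\<close> stands for the monomial \<open>X\<^sup>i Y\<^sup>j\<close> of the quantum plane
  \<open>Y X = q X Y\<close>, and \<open>qz q\<close> is left multiplication by \<open>X + Y\<close>.\<close>

definition qz :: "'k::field \<Rightarrow> (nat \<times> nat \<Rightarrow>\<^sub>0 'k) \<Rightarrow> (nat \<times> nat \<Rightarrow>\<^sub>0 'k)" where
  "qz q = lin_ext (\<lambda>(i, j). basis_vec (Suc i, j) + Poly_Mapping.single (i, Suc j) (q ^ i))"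

definition homog :: "nat \<Rightarrow> (nat \<times> nat \<Rightarrow>\<^sub>0 'k::field) set" where
  "homog d = free_on {(i, j). i + j = d}"

lemma lin_qz: "lin (qz q)" "lin (qz q ^^ m)"
  by (simp_all add: qz_def lin_lin_ext lin_funpow)

lemmas qz_add = module_hom.add[OF lin_qz(1)] module_hom.add[OF lin_qz(2)]
lemmas qz_diff = module_hom.diff[OF lin_qz(1)] module_hom.diff[OF lin_qz(2)]
lemmas qz_scale = module_hom.scale[OF lin_qz(1)] module_hom.scale[OF lin_qz(2)]
lemmas qz_zero = module_hom.zero[OF lin_qz(1)] module_hom.zero[OF lin_qz(2)]

lemma qz_single: "qz q (Poly_Mapping.single (i, j) c) =
    Poly_Mapping.single (Suc i, j) c + Poly_Mapping.single (i, Suc j) (c * q ^ i)"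
  by (simp add: qz_def free.scale_right_distrib scale_single)

lemma lookup_qz: "Poly_Mapping.lookup (qz q p) (i, j) =
    (case i of 0 \<Rightarrow> 0 | Suc i' \<Rightarrow> Poly_Mapping.lookup p (i', j)) +
    (case j of 0 \<Rightarrow> 0 | Suc j' \<Rightarrow> q ^ i * Poly_Mapping.lookup p (i, j'))"
  using free_on_UNIV[of p]
proof (induction rule: free_on_induct)
  case (single b c)
  then show ?case
    by (cases b) (auto simp: qz_single lookup_add lookup_single when_def split: nat.split)
qed (auto simp: qz_add qz_zero lookup_add algebra_simps split: nat.split)

text \<open>The q-binomial theorem. The power of q in front is the cost of moving j' - j factors Y
  past X^i.\<close>

lemma lookup_qz_pow_basis:
  "Poly_Mapping.lookup ((qz q ^^ m) (basis_vec (i, j))) (i', j') =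
    (if i \<le> i' \<and> j \<le> j' \<and> (i' - i) + (j' - j) = m
     then q ^ (i * (j' - j)) * qhom q (Suc (i' - i)) (j' - j) else 0)"
proof (induction m arbitrary: i' j')
  case 0
  then show ?case by (auto simp: lookup_single when_def)
next
  case (Suc m)
  show ?case
  proof (cases "i \<le> i' \<and> j \<le> j' \<and> (i' - i) + (j' - j) = Suc m")
    case False
    have 1: "Poly_Mapping.lookup ((qz q ^^ m) (basis_vec (i, j))) (x, j') = 0" if "i' = Suc x" for x
      unfolding Suc.IH using False that by (intro if_not_P) linarith
    have 2: "Poly_Mapping.lookup ((qz q ^^ m) (basis_vec (i, j))) (i', y) = 0" if "j' = Suc y" for y
      unfolding Suc.IH using False that by (intro if_not_P) linarith
    show ?thesis
      unfolding funpow.simps comp_def lookup_qz if_not_P[OF False] using 1 2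
      by (auto split: nat.split)
  next
    case True
    then obtain a b where ab: "i' = i + a" "j' = j + b" "a + b = Suc m"
      by (metis add_diff_cancel_left' le_iff_add)
    let ?f = "\<lambda>a b. q ^ (i * b) * qhom q (Suc a) b"
    have IH: "Poly_Mapping.lookup ((qz q ^^ m) (basis_vec (i, j))) (i + x, j + y) = ?f x y"
      if "x + y = m" for x y
      unfolding Suc.IH using that by simp
    have IH0: "Poly_Mapping.lookup ((qz q ^^ m) (basis_vec (i, j))) (x, y) = 0"
      if "x < i \<or> y < j" for x y
      unfolding Suc.IH using that by auto
    have "Poly_Mapping.lookup (qz q ((qz q ^^ m) (basis_vec (i, j)))) (i + a, j + b) = ?f a b"
    proof (cases a)
      case 0
      with ab have b: "b = Suc m" by simp
      have "(case i of 0 \<Rightarrow> 0 | Suc x \<Rightarrow>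
          Poly_Mapping.lookup ((qz q ^^ m) (basis_vec (i, j))) (x, j + b)) = 0"
        using IH0 by (auto split: nat.split)
      then show ?thesis using IH[of 0 m] unfolding 0 b lookup_qz by (simp add: power_add)
    next
      case a: (Suc a')
      show ?thesis
      proof (cases b)
        case 0
        have "(case j of 0 \<Rightarrow> 0 | Suc y \<Rightarrow>
            q ^ (i + a) * Poly_Mapping.lookup ((qz q ^^ m) (basis_vec (i, j))) (i + a, y)) = 0"
          using IH0 by (auto split: nat.split)
        then show ?thesis using IH[of a' 0] ab(3) unfolding 0 a lookup_qz by simp
      next
        case (Suc b')
        then show ?thesis using IH[of a' b] IH[of a b'] ab(3)
          unfolding a lookup_qz by (simp add: algebra_simps power_add)
      qed
    qed
    then show ?thesis using True ab by simp
  qed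
qed

lemma qz_pow_root_basis:
  assumes "primitive_root_unity s q"
  shows "(qz q ^^ s) (basis_vec (i, j)) = basis_vec (i + s, j) + basis_vec (i, j + s)"
proof (rule poly_mapping_eqI, clarify)
  fix i' j'
  have qs: "q ^ s = 1" "s > 0" using assms by (auto simp: primitive_root_unity_def)
  consider "i \<le> i' \<and> j \<le> j' \<and> (i' - i) + (j' - j) = s \<and> i' \<noteq> i \<and> j' \<noteq> j"
    | "\<not> (i \<le> i' \<and> j \<le> j' \<and> (i' - i) + (j' - j) = s)" | "i' = i + s" "j' = j" | "i' = i" "j' = j + s"
    by fastforce
  then show "Poly_Mapping.lookup ((qz q ^^ s) (basis_vec (i, j))) (i', j') =
    Poly_Mapping.lookup (basis_vec (i + s, j) + basis_vec (i, j + s)) (i', j')"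
  proof cases
    case 1
    \<comment> \<open>An inner coefficient: both differences are positive and add up to s.\<close>
    then have "qhom q (Suc (i' - i)) (Suc (j' - j - 1)) = 0"
      by (intro qhom_zero_of_root[OF assms]) auto
    then show ?thesis using 1 qs
      by (auto simp: lookup_qz_pow_basis lookup_add lookup_single when_def Suc_diff_Suc simp del: qhom.simps)
  qed (use qs in \<open>auto simp: lookup_qz_pow_basis lookup_add lookup_single when_def power_mult
        mult.commute[of i]\<close>)
qed

text \<open>\<open>ev q\<close> is the functional, unique up to scalars in every degree, that vanishes on the
  range of \<open>qz q\<close>.\<close>

definition alt_wt :: "'k::field \<Rightarrow> nat \<Rightarrow> 'k" where
  "alt_wt q i = (\<Prod>k<i. - (q ^ k))"

text \<open>Valued in the free space on \<open>unit\<close> because \<open>lin\<close> only speaks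
  of maps between free vector spaces; \<open>ev\<close> reads off the scalar.\<close>

definition evp :: "'k::field \<Rightarrow> (nat \<times> nat \<Rightarrow>\<^sub>0 'k) \<Rightarrow> (unit \<Rightarrow>\<^sub>0 'k)" where
  "evp q = lin_ext (\<lambda>(i, j). Poly_Mapping.single () (alt_wt q i))"

definition ev :: "'k::field \<Rightarrow> (nat \<times> nat \<Rightarrow>\<^sub>0 'k) \<Rightarrow> 'k" where
  "ev q p = Poly_Mapping.lookup (evp q p) ()"

lemma lin_evp: "lin (evp q)"
  by (simp add: evp_def lin_lin_ext)

lemma alt_wt_simps [simp]: "alt_wt q 0 = 1" "alt_wt q (Suc i) = - (q ^ i) * alt_wt q i"
  by (simp_all add: alt_wt_def)

lemma
  shows ev_add: "ev q (p + p') = ev q p + ev q p'"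
    and ev_scale: "ev q (scale c p) = c * ev q p"
    and ev_zero [simp]: "ev q 0 = 0"
    and ev_diff: "ev q (p - p') = ev q p - ev q p'"
  by (simp_all add: ev_def module_hom.add[OF lin_evp] module_hom.scale[OF lin_evp]
      module_hom.zero[OF lin_evp] module_hom.diff[OF lin_evp] lookup_add lookup_scale lookup_minus)

lemma evp_single: "evp q (Poly_Mapping.single (i, j) c) = Poly_Mapping.single () (c * alt_wt q i)"
  by (simp add: evp_def scale_single)

lemma ev_single [simp]: "ev q (Poly_Mapping.single (i, j) c) = c * alt_wt q i"
  by (simp add: ev_def evp_def scale_single)

text \<open>This dictates \<open>alt_wt\<close>: the values of X^(i+1) Y^j and q^i X^i Y^(j+1) must
  cancel.\<close>

lemma ev_qz [simp]: "ev q (qz q p) = 0"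
  using free_on_UNIV[of p]
  by (induction rule: free_on_induct) (auto simp: qz_single ev_add qz_add qz_zero)

lemma ev_qz_pow: "m > 0 \<Longrightarrow> ev q ((qz q ^^ m) p) = 0"
  by (cases m) auto

text \<open>Modulo the range of z, X^(i+1) Y^j equals - q^i X^i Y^(j+1), so every monomial can be
  pushed to a multiple of Y^d, where \<open>ev\<close> is normalised to 1. Writing the degree of p'
  with \<open>Suc\<close> forces p' = 0 when d = 0.\<close>

lemma ev_reduce:
  assumes "p \<in> homog d"
  obtains p' where "p' \<in> free_on {(i, j). Suc (i + j) = d}"
    "p = Poly_Mapping.single (0, d) (ev q p) + qz q p'"
proof -
  let ?D = "free_on {(i, j). Suc (i + j) = d} :: (nat \<times> nat \<Rightarrow>\<^sub>0 'a) set"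
  have "\<exists>p'\<in>?D. p = Poly_Mapping.single (0, d) (ev q p) + qz q p'"
    using assms unfolding homog_def
  proof (induction rule: free_on_induct)
    case (single b c)
    have "i + j = d \<Longrightarrow> \<exists>p'\<in>?D. Poly_Mapping.single (i, j) c =
        Poly_Mapping.single (0, d) (c * alt_wt q i) + qz q p'" for i j
    proof (induction i arbitrary: j c)
      case 0
      then show ?case by (intro bexI[of _ 0]) (auto simp: qz_zero)
    next
      case (Suc i)
      obtain p' where p': "p' \<in> ?D" "Poly_Mapping.single (i, Suc j) (c * q ^ i) =
        Poly_Mapping.single (0, d) (c * q ^ i * alt_wt q i) + qz q p'"
        using Suc.IH[of "Suc j" "c * q ^ i"] Suc.prems by auto
      have "Poly_Mapping.single (Suc i, j) c = qz q (Poly_Mapping.single (i, j) c) -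
          Poly_Mapping.single (i, Suc j) (c * q ^ i)" by (simp add: qz_single)
      also have "\<dots> = Poly_Mapping.single (0, d) (c * alt_wt q (Suc i)) +
          qz q (Poly_Mapping.single (i, j) c - p')"
        unfolding p'(2) by (simp add: qz_diff single_uminus mult.assoc)
      finally show ?case using p'(1) Suc.prems
        by (intro bexI[of _ "Poly_Mapping.single (i, j) c - p'"] free_on_diff) auto
    qed
    then show ?case using single by (cases b) auto
  next
    case add
    show ?case by (intro bexI[of _ 0]) (auto simp: qz_zero)
  next
    fix p1 p2
    assume "\<exists>p'\<in>?D. p1 = Poly_Mapping.single (0, d) (ev q p1) + qz q p'"
      "\<exists>p'\<in>?D. p2 = Poly_Mapping.single (0, d) (ev q p2) + qz q p'"
    then obtain r1 r2 where r: "r1 \<in> ?D" "r2 \<in> ?D"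
      and e: "p1 = Poly_Mapping.single (0, d) (ev q p1) + qz q r1"
        "p2 = Poly_Mapping.single (0, d) (ev q p2) + qz q r2" by blast
    have "p1 + p2 = Poly_Mapping.single (0, d) (ev q (p1 + p2)) + qz q (r1 + r2)"
      by (rule trans[OF arg_cong2[OF e, of "(+)"]]) (simp only: ev_add qz_add(1) single_add add_ac)
    with r show "\<exists>p'\<in>?D. p1 + p2 = Poly_Mapping.single (0, d) (ev q (p1 + p2)) + qz q p'"
      by (intro bexI[of _ "r1 + r2"]) auto
  qed
  then show ?thesis using that by blast
qed


section \<open>The monomial ideal of X^n and Y^t, and its stability under z\<close>

definition trunc :: "nat \<Rightarrow> nat \<Rightarrow> (nat \<times> nat \<Rightarrow>\<^sub>0 'k::field) set" where
  "trunc n t = free_on {(i, j). n \<le> i \<or> t \<le> j}"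

lemma qz_closed:
  assumes "p \<in> free_on A" "\<And>i j. (i, j) \<in> A \<Longrightarrow> (Suc i, j) \<in> B \<and> (i, Suc j) \<in> B"
  shows "qz q p \<in> free_on B"
  by (rule lin_closed_on_free[OF lin_qz(1) _ assms(1)]) (use assms(2) in \<open>auto simp: qz_single\<close>)

lemma qz_pow_closed:
  assumes "p \<in> free_on A" "\<And>i j. (i, j) \<in> A \<Longrightarrow> (Suc i, j) \<in> A \<and> (i, Suc j) \<in> A"
  shows "(qz q ^^ m) p \<in> free_on A"
proof (induction m)
  case (Suc m)
  have "qz q ((qz q ^^ m) p) \<in> free_on A"
    by (rule qz_closed[OF Suc]) (use assms(2) in auto)
  then show ?case by simp
qed (use assms(1) in simp)

lemma qz_pow_trunc: "p \<in> trunc n t \<Longrightarrow> (qz q ^^ m) p \<in> trunc n t"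
  unfolding trunc_def by (erule qz_pow_closed) auto

lemma qz_pow_closed_homog:
  assumes "p \<in> free_on {(i, j). i + j = d \<and> P i j}"
    and "\<And>i j. P i j \<Longrightarrow> P (Suc i) j \<and> P i (Suc j)"
  shows "(qz q ^^ m) p \<in> free_on {(i, j). i + j = d + m \<and> P i j}"
proof (induction m)
  case (Suc m)
  have "qz q ((qz q ^^ m) p) \<in> free_on {(i, j). i + j = d + Suc m \<and> P i j}"
    by (rule qz_closed[OF Suc]) (use assms(2) in auto)
  then show ?case by simp
qed (use assms(1) in simp)

lemma qz_pow_homog: "p \<in> homog d \<Longrightarrow> (qz q ^^ m) p \<in> homog (d + m)"
  using qz_pow_closed_homog[where P = "\<lambda>_ _. True"] by (simp add: homog_def)

section \<open>Action of the central polynomials in \<open>X\<^sup>s\<close> and \<open>Y\<^sup>s\<close>\<close>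

text \<open>A polynomial P in u = X^s and v = Y^s acts on c. No power of q appears, which agrees
  with the product of the quantum plane once q^s = 1 makes u and v central.\<close>

definition star :: "nat \<Rightarrow> (nat \<times> nat \<Rightarrow>\<^sub>0 'k::field) \<Rightarrow> (nat \<times> nat \<Rightarrow>\<^sub>0 'k) \<Rightarrow> (nat \<times> nat \<Rightarrow>\<^sub>0 'k)" where
  "star s = bilin_ext (\<lambda>(a, b) (i, j). basis_vec (i + a * s, j + b * s))"

lemma lin_star: "lin (\<lambda>P. star s P c)" "lin (star s P)"
  by (simp_all add: star_def lin_bilin_ext_left lin_bilin_ext_right)

lemmas star_add = module_hom.add[OF lin_star(1)] module_hom.add[OF lin_star(2)]
lemmas star_diff = module_hom.diff[OF lin_star(1)] module_hom.diff[OF lin_star(2)]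

lemma star_basis: "star s (basis_vec (a, b)) (basis_vec (i, j)) = basis_vec (i + a * s, j + b * s)"
  by (simp add: star_def)

lemma star_closed:
  assumes "P \<in> free_on A" "c \<in> free_on C"
    and "\<And>a b i j. (a, b) \<in> A \<Longrightarrow> (i, j) \<in> C \<Longrightarrow> (i + a * s, j + b * s) \<in> D"
  shows "star s P c \<in> free_on D"
  unfolding star_def by (rule bilin_ext_closed[OF assms(1,2)]) (use assms(3) in auto)

lemma star_homog:
  assumes "P \<in> homog i" "c \<in> homog j"
  shows "star s P c \<in> homog (i * s + j)"
  unfolding homog_def
  by (rule star_closed[OF assms[unfolded homog_def]]) (auto simp: algebra_simps)

lemma qz_star:
  assumes "q ^ s = 1"
  shows "qz q (star s P c) = star s P (qz q c)"
proof (rule bilin_eqI[where f = "\<lambda>P c. qz q (star s P c)" and g = "\<lambda>P c. star s P (qz q c)"])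
  fix b c :: "nat \<times> nat"
  obtain a1 a2 i j where bc: "b = (a1, a2)" "c = (i, j)" by (metis surj_pair)
  have *: "Poly_Mapping.single x (q ^ i) = scale (q ^ i) (basis_vec x)" for x :: "nat \<times> nat"
    by (simp add: scale_single)
  have "q ^ (a1 * s) = 1" using assms by (simp add: mult.commute[of a1] power_mult)
  then show "qz q (star s (basis_vec b) (basis_vec c)) = star s (basis_vec b) (qz q (basis_vec c))"
    by (simp add: bc star_basis qz_single star_add power_add)
      (simp add: * module_hom.scale[OF lin_star(2)] star_basis)
qed (rule lin_compose[OF lin_qz(1) lin_star(1)] lin_compose[OF lin_qz(1) lin_star(2)]
    lin_star(1) lin_compose[OF lin_star(2) lin_qz(1)])+

lemma qz_pow_star: "q ^ s = 1 \<Longrightarrow> (qz q ^^ m) (star s P c) = star s P ((qz q ^^ m) c)"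
  by (induction m) (simp_all add: qz_star)

text \<open>z^s acts as u + v, and multiplication by u + v on k[u, v] is \<open>qz 1\<close>. The
  commutative strings are thus the case q = 1 of the same theory.\<close>

lemma qz_pow_s_star:
  assumes "primitive_root_unity s q"
  shows "(qz q ^^ s) (star s P c) = star s (qz 1 P) c"
proof (rule bilin_eqI[where f = "\<lambda>P c. (qz q ^^ s) (star s P c)" and g = "\<lambda>P c. star s (qz 1 P) c"])
  fix b c :: "nat \<times> nat"
  show "(qz q ^^ s) (star s (basis_vec b) (basis_vec c)) = star s (qz 1 (basis_vec b)) (basis_vec c)"
    by (cases b; cases c) (simp add: star_basis qz_pow_root_basis[OF assms] qz_single star_add add_ac)
qed (rule lin_compose[OF lin_qz(2) lin_star(1)] lin_compose[OF lin_qz(2) lin_star(2)]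
    lin_compose[OF lin_star(1) lin_qz(1)] lin_star(2))+

lemma qz_pow_mult_star:
  assumes "primitive_root_unity s q"
  shows "(qz q ^^ (m * s)) (star s P c) = star s ((qz 1 ^^ m) P) c"
proof (induction m)
  case (Suc m)
  have "(qz q ^^ (Suc m * s)) (star s P c) = (qz q ^^ s) ((qz q ^^ (m * s)) (star s P c))"
    by (simp add: funpow_add)
  also have "\<dots> = star s ((qz 1 ^^ Suc m) P) c"
    by (simp add: Suc qz_pow_s_star[OF assms])
  finally show ?case .
qed simp

text \<open>\<open>ev\<close> vanishes on z^s X^(i+as) = X^(i+(a+1)s) + X^(i+as) Y^s, so each shift
  by s changes the sign.\<close>

lemma alt_wt_add_root:
  assumes "primitive_root_unity s q"
  shows "alt_wt q (i + a * s) = alt_wt 1 a * alt_wt q i"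
proof (induction a)
  case (Suc a)
  have "s > 0" using assms by (simp add: primitive_root_unity_def)
  then have "ev q ((qz q ^^ s) (basis_vec (i + a * s, 0))) = 0" by (rule ev_qz_pow)
  then show ?case using Suc
    by (simp add: qz_pow_root_basis[OF assms] ev_add add_eq_0_iff2 algebra_simps)
qed simp

lemma ev_star:
  assumes "primitive_root_unity s q"
  shows "ev q (star s P c) = ev 1 P * ev q c"
proof -
  have "evp q (star s P c) = scale (ev 1 P) (evp q c)"
  proof (rule bilin_eqI[where f = "\<lambda>P c. evp q (star s P c)" and g = "\<lambda>P c. scale (ev 1 P) (evp q c)"])
    show "lin (\<lambda>P. scale (ev 1 P) (evp q c))" for c
      by (intro linI) (simp_all add: ev_add ev_scale free.scale_left_distrib)
  next
    fix b c :: "nat \<times> nat"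
    show "evp q (star s (basis_vec b) (basis_vec c)) = scale (ev 1 (basis_vec b)) (evp q (basis_vec c))"
      by (cases b; cases c) (simp add: star_basis evp_single scale_single alt_wt_add_root[OF assms])
  qed (rule lin_compose[OF lin_evp lin_star(1)] lin_compose[OF lin_evp lin_star(2)] lin_scale[OF lin_evp])+
  then show ?thesis by (simp add: ev_def lookup_scale)
qed

section \<open>Lowest weight vectors\<close>

text \<open>For a + b > 0 this is a lowest weight vector of degree d in V_(a+d) \<otimes> V_(b+d),
  in coordinates of the quantum plane: z^(a+b-1) carries it into the ideal of X^(a+d) and Y^(b+d).
  The parameters are the excesses over the degree, in which the effect of z is a simple
  recursion.\<close>

definition lowvec :: "'k::field \<Rightarrow> nat \<Rightarrow> nat \<Rightarrow> nat \<Rightarrow> (nat \<times> nat \<Rightarrow>\<^sub>0 'k)" where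
  "lowvec q a b d = (\<Sum>i\<le>d. Poly_Mapping.single (i, d - i)
     (alt_wt (inverse q) i * inverse q ^ (b * i) * qhom q b i * qhom q a (d - i)))"

lemma lookup_lowvec: "Poly_Mapping.lookup (lowvec q a b d) (i, j) =
    (if i + j = d then alt_wt (inverse q) i * inverse q ^ (b * i) * qhom q b i * qhom q a j else 0)"
proof -
  have "Poly_Mapping.lookup (lowvec q a b d) (i, j) = (\<Sum>k\<le>d. if k = i then (if i + j = d then
      alt_wt (inverse q) i * inverse q ^ (b * i) * qhom q b i * qhom q a j else 0) else 0)"
    unfolding lowvec_def lookup_sum
    by (intro sum.cong) (auto simp: lookup_single when_def)
  then show ?thesis by auto
qed

lemma lowvec_homog: "lowvec q a b d \<in> homog d"
  by (auto simp: homog_def free_on_iff lookup_lowvec split: if_splits)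

lemma qhom_0: "qhom q 0 i = (if i = 0 then 1 else 0)"
  by (cases i) auto

lemma lowvec_0_left: "lowvec q 0 b d \<in> free_on {(i, j). i + j = d \<and> j = 0}"
  by (auto simp: free_on_iff lookup_lowvec qhom_0 split: if_splits)

lemma lowvec_0_right: "lowvec q a 0 d = Poly_Mapping.single (0, d) (qhom q a d)"
  by (rule poly_mapping_eqI)
    (auto simp: lookup_lowvec lookup_single when_def qhom_0 split_paired_all)

text \<open>Comparison of coefficients: one \<open>qhom\<close> factor is expanded by splitting off
  the first variable, the other by splitting off the last, and two terms cancel. On the right the
  degree has grown by one and a + b has dropped by one.\<close>

lemma qz_lowvec:
  assumes "q \<noteq> 0"
  shows "qz q (lowvec q (Suc a) (Suc b) d) =
    lowvec q (Suc a) b (Suc d) - scale (q ^ Suc d) (lowvec q a (Suc b) (Suc d))"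
proof (rule poly_mapping_eqI, clarify)
  fix i j
  let ?Q = "inverse q"
  have inv: "q ^ k * (?Q ^ k * x) = x" for k x
    using assms by (simp flip: mult.assoc power_mult_distrib)
  show "Poly_Mapping.lookup (qz q (lowvec q (Suc a) (Suc b) d)) (i, j) =
     Poly_Mapping.lookup (lowvec q (Suc a) b (Suc d) - scale (q ^ Suc d) (lowvec q a (Suc b) (Suc d))) (i, j)"
  proof (cases "i + j = Suc d")
    case True
    show ?thesis
    proof (cases i)
      case 0
      then show ?thesis using True qhom_rec2[of q a d]
        by (simp add: lookup_qz lookup_lowvec lookup_minus lookup_scale del: qhom.simps(3))
    next
      case (Suc i')
      \<comment> \<open>\<open>A\<close> is the \<open>qhom\<close> value at j - 1, read as 0 for j
        = 0, and \<open>E\<close> is the weight of the coefficient at i - 1. With them the claim is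
        a polynomial identity.\<close>
      define A where "A = (case j of 0 \<Rightarrow> 0 | Suc j' \<Rightarrow> qhom q (Suc a) j')"
      define E where "E = alt_wt ?Q i' * ?Q ^ i' * ?Q ^ (b * i')"
      have A: "qhom q (Suc a) j = q ^ j * qhom q a j + A"
        unfolding A_def by (cases j) (simp_all add: qhom_rec2 del: qhom.simps(3))
      have B: "?Q ^ b * qhom q (Suc b) i = ?Q ^ b * qhom q b i + qhom q (Suc b) i'"
        using assms by (simp add: Suc algebra_simps flip: power_mult_distrib)
      have t: "alt_wt ?Q i * ?Q ^ (b * i) = - E * ?Q ^ b"
        "alt_wt ?Q i' * ?Q ^ (Suc b * i') = E"
        by (simp_all add: E_def Suc power_add)
      have t': "q ^ i * (alt_wt ?Q i * ?Q ^ (Suc b * i)) = - E * ?Q ^ b"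
      proof -
        have "q ^ i * (alt_wt ?Q i * ?Q ^ (Suc b * i)) = q ^ i * (?Q ^ i * (alt_wt ?Q i * ?Q ^ (b * i)))"
          unfolding mult_Suc power_add by (simp only: mult_ac)
        then show ?thesis by (simp only: inv t)
      qed
      have "Poly_Mapping.lookup (lowvec q (Suc a) (Suc b) d) (i', j) =
          E * qhom q (Suc b) i' * qhom q (Suc a) j"
        unfolding lookup_lowvec t(2) using True Suc by simp
      moreover have "(case j of 0 \<Rightarrow> 0 | Suc j' \<Rightarrow>
          q ^ i * Poly_Mapping.lookup (lowvec q (Suc a) (Suc b) d) (i, j')) =
          (- E * ?Q ^ b) * qhom q (Suc b) i * A"
      proof (cases j)
        case j: (Suc j')
        have "Poly_Mapping.lookup (lowvec q (Suc a) (Suc b) d) (i, j') =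
            (alt_wt ?Q i * ?Q ^ (Suc b * i)) * qhom q (Suc b) i * qhom q (Suc a) j'"
          unfolding lookup_lowvec using True j by simp
        then show ?thesis unfolding t'[symmetric] j A_def by (simp only: nat.case mult.assoc)
      qed (simp add: A_def)
      ultimately have "Poly_Mapping.lookup (qz q (lowvec q (Suc a) (Suc b) d)) (i, j) =
          E * qhom q (Suc b) i' * qhom q (Suc a) j + (- E * ?Q ^ b) * qhom q (Suc b) i * A"
        unfolding lookup_qz by (simp add: Suc del: qhom.simps(3))
      also have "\<dots> = (- E * ?Q ^ b) * qhom q b i * qhom q (Suc a) j -
          q ^ j * (- E * ?Q ^ b) * qhom q (Suc b) i * qhom q a j"
      proof -
        have "E * B0 * A1 + (- E * Qb) * B1 * A0 = (- E * Qb) * b1 * A1 - qj * (- E * Qb) * B1 * a1"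
          if "A1 = qj * a1 + A0" "Qb * B1 = Qb * b1 + B0" for A1 A0 a1 B1 B0 b1 qj Qb :: 'a
        proof -
          have B0: "B0 = Qb * B1 - Qb * b1" using that(2) by simp
          show ?thesis unfolding that(1) B0 by (simp add: algebra_simps)
        qed
        from this[OF A B] show ?thesis .
      qed
      also have "q ^ j * (- E * ?Q ^ b) = q ^ Suc d * (alt_wt ?Q i * ?Q ^ (Suc b * i))"
        unfolding t'[symmetric] True[symmetric] by (simp only: power_add mult_ac)
      finally show ?thesis
        unfolding t(1)[symmetric] lookup_minus lookup_scale lookup_lowvec if_P[OF True]
        by (simp only: mult.assoc)
    qed
  qed (auto simp: lookup_qz lookup_lowvec lookup_minus lookup_scale split: nat.split)
qed


text \<open>\<open>ev\<close> kills the left side of \<open>qz_lowvec\<close>, so excess can be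
  moved from b to a at the price of a power of q, until b = 0 and the vector is a multiple of
  Y^d.\<close>

lemma ev_lowvec:
  assumes "q \<noteq> 0"
  shows "ev q (lowvec q a b d) = inverse q ^ (b * d) * qhom q (a + b) d"
proof (induction b arbitrary: a)
  case (Suc b)
  show ?case
  proof (cases d)
    case (Suc d')
    have "ev q (lowvec q (Suc a) b d) = q ^ d * ev q (lowvec q a (Suc b) d)"
      using arg_cong[OF qz_lowvec[OF assms, of a b d'], of "ev q"]
      by (simp add: ev_diff ev_scale Suc del: power_Suc)
    then have "inverse q ^ d * (q ^ d * ev q (lowvec q a (Suc b) d)) =
        inverse q ^ d * (inverse q ^ (b * d) * qhom q (Suc a + b) d)"
      unfolding Suc.IH by simp
    then show ?thesis using assms
      by (simp add: power_add flip: mult.assoc power_mult_distrib)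
  qed (simp add: lowvec_def)
qed (simp add: lowvec_0_right)

text \<open>The value of \<open>ev q\<close> on the first summand of \<open>lowvec_split\<close> below.\<close>

fun rho :: "'k::field \<Rightarrow> nat \<Rightarrow> nat \<Rightarrow> nat \<Rightarrow> 'k" where
  "rho q a 0 d = 0"
| "rho q 0 (Suc b) d = (if b = 0 then inverse q ^ d else 0)"
| "rho q (Suc a) (Suc b) d = rho q (Suc a) b (Suc d) - q ^ Suc d * rho q a (Suc b) (Suc d)"

text \<open>The closed form shows that, for q nonzero, a single Gaussian binomial decides whether
  the value is nonzero.\<close>

lemma rho_eq:
  assumes "q \<noteq> 0"
  shows "rho q (Suc a) (Suc b) d = - (\<Prod>k<a. - (q ^ (Suc d + k))) * qhom q (Suc a) b"
proof (induction a arbitrary: b d)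
  case 0
  show ?case
  proof (induction b arbitrary: d)
    case 0
    then show ?case using assms by (simp flip: power_Suc power_mult_distrib)
  next
    case (Suc b)
    show ?case unfolding rho.simps(3)[of q 0 "Suc b"] Suc by simp
  qed
next
  case (Suc a)
  have c: "(\<Prod>k<Suc a. - (q ^ (Suc d + k))) = - (q ^ Suc d) * (\<Prod>k<a. - (q ^ (Suc (Suc d) + k)))" for d
    by (simp add: prod.lessThan_Suc_shift del: prod.lessThan_Suc power_Suc)
  have c': "(\<Prod>k<m. - (q ^ (Suc (Suc d) + k))) = q ^ m * (\<Prod>k<m. - (q ^ (Suc d + k)))" for d m
    by (induction m) (simp_all add: mult_ac)
  show ?case
  proof (induction b arbitrary: d)
    case 0
    show ?case unfolding rho.simps(3)[of q "Suc a"] Suc c by simp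
  next
    case IH: (Suc b)
    show ?case
      unfolding rho.simps(3)[of q "Suc a" "Suc b" d] Suc IH c' qhom.simps(3)[of q "Suc a" b] c
      by (simp add: algebra_simps)
  qed
qed

text \<open>By \<open>qz_lowvec\<close> one application of z leaves two vectors of smaller total
  excess, whose splittings are combined. The bounds d + a and d + b survive because d grows by one
  while only one of a, b drops by one. When an excess reaches 0, the vector is a multiple of X^d or
  Y^d and belongs to one side.\<close>

lemma lowvec_split:
  assumes "q \<noteq> 0" "a + b = Suc m"
  obtains F G where "(qz q ^^ m) (lowvec q a b d) = F + G"
    "F \<in> free_on {(i, j). i + j = d + m \<and> d + a \<le> i}"
    "G \<in> free_on {(i, j). i + j = d + m \<and> d + b \<le> j}"
    "ev q F = rho q a b d"
proof -
  have "\<exists>F G. (qz q ^^ m) (lowvec q a b d) = F + G \<and>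
    F \<in> free_on {(i, j). i + j = d + m \<and> d + a \<le> i} \<and>
    G \<in> free_on {(i, j). i + j = d + m \<and> d + b \<le> j} \<and> ev q F = rho q a b d"
    using assms(2)
  proof (induction m arbitrary: a b d)
    case (0 a b d)
    then consider "a = 0" "b = 1" | "a = 1" "b = 0" by fastforce
    then show ?case
    proof cases
      case 1
      have "lowvec q 0 1 d \<in> free_on {(i, j). i + j = d \<and> d \<le> i}"
        using lowvec_0_left by (rule free_on_mono[rotated]) auto
      then show ?thesis using 1 ev_lowvec[OF assms(1), of 0 1 d]
        by (intro exI[of _ "lowvec q 0 1 d"] exI[of _ 0]) (auto simp del: qhom.simps(3))
    next
      case 2
      then show ?thesis by (intro exI[of _ 0] exI[of _ "lowvec q 1 0 d"]) (auto simp: lowvec_0_right)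
    qed
  next
    case (Suc m a b d)
    consider "a = 0" "b = Suc (Suc m)" | "b = 0" "a = Suc (Suc m)"
      | a' b' where "a = Suc a'" "b = Suc b'" "Suc a' + b' = Suc m" "a' + Suc b' = Suc m"
      using Suc.prems by (cases a; cases b) auto
    then show ?case
    proof cases
      case 1
      have "lowvec q 0 b d \<in> free_on {(i, j). i + j = d \<and> d \<le> i}"
        using lowvec_0_left by (rule free_on_mono[rotated]) auto
      then have "(qz q ^^ Suc m) (lowvec q 0 b d) \<in> free_on {(i, j). i + j = d + Suc m \<and> d \<le> i}"
        by (rule qz_pow_closed_homog) auto
      then show ?thesis using 1
        by (intro exI[of _ "(qz q ^^ Suc m) (lowvec q 0 b d)"] exI[of _ 0]) auto
    next
      case 2
      have "lowvec q a 0 d \<in> free_on {(i, j). i + j = d \<and> d \<le> j}"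
        by (simp add: lowvec_0_right)
      then have "(qz q ^^ Suc m) (lowvec q a 0 d) \<in> free_on {(i, j). i + j = d + Suc m \<and> d \<le> j}"
        by (rule qz_pow_closed_homog) auto
      then show ?thesis using 2
        by (intro exI[of _ 0] exI[of _ "(qz q ^^ Suc m) (lowvec q a 0 d)"]) auto
    next
      case 3
      obtain F1 G1 where 1: "(qz q ^^ m) (lowvec q a b' (Suc d)) = F1 + G1"
        "F1 \<in> free_on {(i, j). i + j = Suc d + m \<and> Suc d + a \<le> i}"
        "G1 \<in> free_on {(i, j). i + j = Suc d + m \<and> Suc d + b' \<le> j}" "ev q F1 = rho q a b' (Suc d)"
        using Suc.IH[of a b' "Suc d"] 3 by blast
      obtain F2 G2 where 2: "(qz q ^^ m) (lowvec q a' b (Suc d)) = F2 + G2"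
        "F2 \<in> free_on {(i, j). i + j = Suc d + m \<and> Suc d + a' \<le> i}"
        "G2 \<in> free_on {(i, j). i + j = Suc d + m \<and> Suc d + b \<le> j}" "ev q F2 = rho q a' b (Suc d)"
        using Suc.IH[of a' b "Suc d"] 3 by blast
      have "(qz q ^^ Suc m) (lowvec q a b d) = (qz q ^^ m) (qz q (lowvec q a b d))"
        by (simp add: funpow_swap1)
      also have "\<dots> = (F1 + G1) - scale (q ^ Suc d) (F2 + G2)"
        unfolding 1(1)[symmetric] 2(1)[symmetric] 3(1,2) qz_lowvec[OF assms(1)] qz_diff qz_scale by simp
      also have "\<dots> = (F1 - scale (q ^ Suc d) F2) + (G1 - scale (q ^ Suc d) G2)"
        by (simp add: free.scale_right_distrib)
      finally have "(qz q ^^ Suc m) (lowvec q a b d) = \<dots>" .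
      moreover have "F1 - scale (q ^ Suc d) F2 \<in> free_on {(i, j). i + j = d + Suc m \<and> d + a \<le> i}"
        by (intro free_on_diff free_on_scale free_on_mono[OF _ 1(2)] free_on_mono[OF _ 2(2)]) (use 3 in auto)
      moreover have "G1 - scale (q ^ Suc d) G2 \<in> free_on {(i, j). i + j = d + Suc m \<and> d + b \<le> j}"
        by (intro free_on_diff free_on_scale free_on_mono[OF _ 1(3)] free_on_mono[OF _ 2(3)]) (use 3 in auto)
      moreover have "ev q (F1 - scale (q ^ Suc d) F2) = rho q a b d"
        using 1(4) 2(4) 3 by (simp add: ev_diff ev_scale)
      ultimately show ?thesis by blast
    qed
  qed
  then show ?thesis using that by blast
qed

lemma homog_ev_0_in_range:
  assumes "p \<in> homog d" "ev q p = 0"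
  obtains p' where "p' \<in> free_on {(i, j). Suc (i + j) = d}" "p = qz q p'"
  using ev_reduce[OF assms(1), of q] assms(2) by auto

text \<open>Lowest weight vectors of k[u, v] / (u^N, v^T). Characteristic zero enters here: the
  value of \<open>ev\<close> is a binomial coefficient.\<close>

lemma lowvec_1:
  fixes i N T :: nat
  defines "P \<equiv> lowvec (1 :: 'k::field_char_0) (N - i) (T - i) i"
  assumes "i \<le> N" "i \<le> T" "2 * i < N + T"
  shows "P \<in> homog i" "ev 1 P \<noteq> 0" "(qz 1 ^^ (N + T - 1 - 2 * i)) P \<in> trunc N T"
proof -
  show "P \<in> homog i" "ev 1 P \<noteq> 0"
    using assms by (simp_all add: P_def lowvec_homog ev_lowvec qhom_1_nonzero)
  obtain F G where "(qz 1 ^^ (N + T - 1 - 2 * i)) P = F + G"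
    "F \<in> free_on {(k, j). k + j = i + (N + T - 1 - 2 * i) \<and> i + (N - i) \<le> k}"
    "G \<in> free_on {(k, j). k + j = i + (N + T - 1 - 2 * i) \<and> i + (T - i) \<le> j}"
    unfolding P_def by (rule lowvec_split[of "1 :: 'k" "N - i" "T - i" "N + T - 1 - 2 * i" i]) (use assms in auto)
  then show "(qz 1 ^^ (N + T - 1 - 2 * i)) P \<in> trunc N T"
    using assms(2,3) unfolding trunc_def by (auto intro!: free_on_add intro: free_on_mono[rotated])
qed


lemma qz_1_eq_star: "qz 1 p = star 1 (basis_vec (1, 0)) p + star 1 (basis_vec (0, 1)) p"
proof -
  have "qz 1 = (\<lambda>p. star 1 (basis_vec (1, 0)) p + star 1 (basis_vec (0, 1)) p)"
    by (rule lin_eqI[OF lin_qz(1) lin_add[OF lin_star(2) lin_star(2)]])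
      (auto simp: qz_single star_basis)
  then show ?thesis by meson
qed

text \<open>Makes the lemmas on \<open>star s\<close> available for \<open>star 1\<close>, the
  action of k[u, v] on itself.\<close>

lemma primitive_root_unity_1: "primitive_root_unity 1 1"
  by (auto simp: primitive_root_unity_def)

section \<open>Generators of the strings\<close>

locale quantum_tensor =
  fixes q :: "'k::field_char_0" and s r r' l l' n t :: nat
  assumes root: "primitive_root_unity s q"
    and n: "n = r' * s + l'" and t: "t = r * s + l"
    and l: "l < s" and l': "l' < s"
begin

lemma s_pos: "s > 0" and q_pow: "q ^ s = 1" and q_nz: "q \<noteq> 0"
  using root by (auto simp: primitive_root_unity_def power_0_left)

definition string_gen :: "nat \<Rightarrow> nat \<Rightarrow> (nat \<times> nat \<Rightarrow>\<^sub>0 'k) \<Rightarrow> bool" where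
  "string_gen d p w \<longleftrightarrow> w \<in> homog d \<and> ev q w \<noteq> 0 \<and> (qz q ^^ p) w \<in> trunc n t"

text \<open>The generator is P X^ci Y^cj with P a lowest weight vector for (N, T). The power of z
  acts on P as a power of u + v and carries it into (u^N, v^T), and both u^N X^ci and v^T Y^cj lie
  in the ideal.\<close>

lemma string_gen_multiple:
  assumes "i \<le> N" "i \<le> T" "2 * i < N + T"
    and "n \<le> N * s + ci" "t \<le> T * s + cj"
  shows "\<exists>w. string_gen (i * s + (ci + cj)) ((N + T - 1 - 2 * i) * s) w"
proof -
  let ?P = "lowvec (1 :: 'k) (N - i) (T - i) i"
  let ?c = "basis_vec (ci, cj) :: nat \<times> nat \<Rightarrow>\<^sub>0 'k"
  note P = lowvec_1[OF assms(1-3), where ?'k = 'k]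
  have "star s ((qz 1 ^^ (N + T - 1 - 2 * i)) ?P) ?c \<in> trunc n t"
    unfolding trunc_def
  proof (rule star_closed[OF P(3)[unfolded trunc_def], of ?c "{(ci, cj)}"])
    fix a b x y assume "(a, b) \<in> {(i, j). N \<le> i \<or> T \<le> j}" "(x, y) \<in> {(ci, cj)}"
    then consider "N * s \<le> a * s" "x = ci" | "T * s \<le> b * s" "y = cj" by auto
    then have "n \<le> x + a * s \<or> t \<le> y + b * s"
      by cases (use assms(4,5) in linarith)+
    then show "(x + a * s, y + b * s) \<in> {(i, j). n \<le> i \<or> t \<le> j}" by simp
  qed simp
  moreover have "alt_wt q ci \<noteq> 0" using q_nz by (simp add: alt_wt_def)
  moreover have "?c \<in> homog (ci + cj)" by (simp add: homog_def)
  ultimately have "string_gen (i * s + (ci + cj)) ((N + T - 1 - 2 * i) * s) (star s ?P ?c)"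
    using P by (simp add: string_gen_def star_homog ev_star[OF root] qz_pow_mult_star[OF root])
  then show ?thesis by blast
qed

section \<open>The strings that come in pairs\<close>

context
  fixes j
  assumes j: "j < l" "j < l'" "l + l' \<le> s + j"
begin

text \<open>The length of the string of \<open>low\<close> in V_l' \<otimes> V_l. The assumption l +
  l' \<le> s + j keeps j + \<delta> below s, so the Gaussian binomials met below are
  nonzero.\<close>

definition "\<delta> = l + l' - 1 - 2 * j"
definition "low = lowvec q (l' - j) (l - j) j"

lemma \<delta>: "0 < \<delta>" "\<delta> < s" "l + l' - 1 - j = j + \<delta>"
  using j by (auto simp: \<delta>_def)

lemma low_split:
  obtains f g where "(qz q ^^ \<delta>) low = f + g"
    "f \<in> free_on {(x, y). x + y = j + \<delta> \<and> l' \<le> x}"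
    "g \<in> free_on {(x, y). x + y = j + \<delta> \<and> l \<le> y}" "ev q f \<noteq> 0"
proof -
  obtain f g where fg: "(qz q ^^ \<delta>) low = f + g"
    "f \<in> free_on {(x, y). x + y = j + \<delta> \<and> j + (l' - j) \<le> x}"
    "g \<in> free_on {(x, y). x + y = j + \<delta> \<and> j + (l - j) \<le> y}"
    "ev q f = rho q (l' - j) (l - j) j"
    unfolding low_def using j by (rule_tac lowvec_split[OF q_nz, of "l' - j" "l - j" \<delta> j]) (auto simp: \<delta>_def)
  obtain a b where ab: "l' - j = Suc a" "l - j = Suc b"
    using j by (metis Suc_diff_Suc)
  have "qhom q (Suc a) b \<noteq> 0"
    by (rule qhom_nonzero_of_root[OF root]) (use ab j in linarith)
  then have "ev q f \<noteq> 0"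
    unfolding fg(4) ab rho_eq[OF q_nz] using q_nz by simp
  then show ?thesis using fg j by (intro that[of f g]) auto
qed

lemma low: "low \<in> homog j" "ev q low \<noteq> 0"
proof -
  have "qhom q (Suc (l + l' - 2 * j - 1)) j \<noteq> 0"
    by (rule qhom_nonzero_of_root[OF root]) (use j l l' in linarith)
  moreover have "Suc (l + l' - 2 * j - 1) = l' - j + (l - j)" using j by linarith
  ultimately show "ev q low \<noteq> 0"
    using q_nz unfolding low_def ev_lowvec[OF q_nz] by simp
qed (simp add: low_def lowvec_homog)

text \<open>v^(r+1) lies in the ideal by itself because (r+1) s > t; u^N reaches it together with
  the factor X^x0 of f.\<close>

lemma star_trunc_X:
  assumes "P \<in> trunc N (Suc r)" "f \<in> free_on {(x, y). x + y = d \<and> x0 \<le> x}" "n \<le> N * s + x0"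
  shows "star s P f \<in> trunc n t"
  unfolding trunc_def
proof (rule star_closed[OF assms(1)[unfolded trunc_def] assms(2)])
  fix a b x y assume "(a, b) \<in> {(i, j). N \<le> i \<or> Suc r \<le> j}" "(x, y) \<in> {(x, y). x + y = d \<and> x0 \<le> x}"
  then consider "N * s \<le> a * s" "x0 \<le> x" | "Suc r * s \<le> b * s" by (auto simp del: mult_Suc)
  then have "n \<le> x + a * s \<or> t \<le> y + b * s"
  proof cases
    case 2
    then show ?thesis using t l unfolding mult_Suc by (intro disjI2) linarith
  qed (use assms(3) in linarith)
  then show "(x + a * s, y + b * s) \<in> {(i, j). n \<le> i \<or> t \<le> j}" by simp
qed

lemma star_trunc_Y:
  assumes "P \<in> trunc (Suc r') T" "f \<in> free_on {(x, y). x + y = d \<and> y0 \<le> y}" "t \<le> T * s + y0"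
  shows "star s P f \<in> trunc n t"
  unfolding trunc_def
proof (rule star_closed[OF assms(1)[unfolded trunc_def] assms(2)])
  fix a b x y assume "(a, b) \<in> {(i, j). Suc r' \<le> i \<or> T \<le> j}" "(x, y) \<in> {(x, y). x + y = d \<and> y0 \<le> y}"
  then consider "Suc r' * s \<le> a * s" | "T * s \<le> b * s" "y0 \<le> y" by (auto simp del: mult_Suc)
  then have "n \<le> x + a * s \<or> t \<le> y + b * s"
  proof cases
    case 1
    then show ?thesis using n l' unfolding mult_Suc by (intro disjI1) linarith
  qed (use assms(3) in linarith)
  then show "(x + a * s, y + b * s) \<in> {(i, j). n \<le> i \<or> t \<le> j}" by simp
qed

text \<open>For w = P low + Q z^(s-\<delta>) f one has z^\<delta> w = P (f + g) + (u + v) Q f. With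
  (u + v) Q = P2 - P this becomes P g + P2 f. After (u + v)^K, P dies modulo (u^(r'+1), v^r), as g
  requires, and P2 modulo (u^r', v^(r+1)), as f requires.\<close>

lemma string_gen_lower:
  assumes "i \<le> r" "i \<le> r'"
  shows "\<exists>w. string_gen (i * s + j) ((r + r' - 2 * i) * s + \<delta>) w"
proof -
  define K where "K = r + r' - 2 * i"
  obtain f g where fg: "(qz q ^^ \<delta>) low = f + g"
    "f \<in> free_on {(x, y). x + y = j + \<delta> \<and> l' \<le> x}"
    "g \<in> free_on {(x, y). x + y = j + \<delta> \<and> l \<le> y}" by (rule low_split)
  define P where "P = lowvec (1 :: 'k) (Suc r' - i) (r - i) i"
  define P1 where "P1 = lowvec (1 :: 'k) (r' - i) (Suc r - i) i"
  have P: "P \<in> homog i" "ev 1 P \<noteq> 0" "(qz 1 ^^ K) P \<in> trunc (Suc r') r"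
    and P1: "P1 \<in> homog i" "ev 1 P1 \<noteq> 0" "(qz 1 ^^ K) P1 \<in> trunc r' (Suc r)"
    using lowvec_1[of i "Suc r'" r, where ?'k = 'k] lowvec_1[of i r' "Suc r", where ?'k = 'k] assms
    by (auto simp: P_def P1_def K_def add_ac)
  \<comment> \<open>Scaled to the value of \<open>P\<close> under \<open>ev\<close>, so that the
    difference is divisible by u + v.\<close>
  define P2 where "P2 = scale (ev 1 P / ev 1 P1) P1"
  have "P2 - P \<in> homog i" "ev 1 (P2 - P) = 0"
    using P P1 by (auto simp: P2_def homog_def ev_diff ev_scale)
  then obtain Q where Q: "Q \<in> free_on {(x, y). Suc (x + y) = i}" "P2 - P = qz 1 Q"
    by (rule homog_ev_0_in_range)
  define fh where "fh = (qz q ^^ (s - \<delta>)) f"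
  define w where "w = star s P low + star s Q fh"
  have "fh \<in> free_on {(x, y). x + y = j + \<delta> + (s - \<delta>) \<and> l' \<le> x}"
    unfolding fh_def by (rule qz_pow_closed_homog[OF fg(2)]) auto
  then have fh: "fh \<in> homog (j + s)"
    unfolding homog_def by (rule free_on_mono[rotated]) (use \<delta> in auto)
  have "star s Q fh \<in> homog (i * s + j)"
    unfolding homog_def
    by (rule star_closed[OF Q(1) fh[unfolded homog_def]]) (auto simp: algebra_simps)
  then have 1: "w \<in> homog (i * s + j)"
    using star_homog[OF P(1) low(1), of s] by (simp add: w_def homog_def)
  \<comment> \<open>Since \<delta> < s, the correction term lies in the range of z and leaves the
    value of w unchanged.\<close>
  have "ev q fh = 0" unfolding fh_def by (rule ev_qz_pow) (use \<delta> in auto)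
  then have 2: "ev q w \<noteq> 0"
    using P low by (simp add: w_def ev_add ev_star[OF root])
  have "(qz q ^^ \<delta>) w = star s P (f + g) + star s Q ((qz q ^^ s) f)"
    using funpow_add[of \<delta> "s - \<delta>" "qz q"] \<delta>
    by (simp add: w_def qz_add qz_pow_star[OF q_pow] fg(1) fh_def)
  also have "\<dots> = star s P (f + g) + star s (qz 1 Q) f"
    by (simp add: qz_pow_star[OF q_pow, symmetric] qz_pow_s_star[OF root])
  also have "\<dots> = star s P g + star s P2 f"
    unfolding Q(2)[symmetric] by (simp add: star_add star_diff)
  finally have "(qz q ^^ (K * s + \<delta>)) w =
      star s ((qz 1 ^^ K) P) g + star s ((qz 1 ^^ K) P2) f"
    by (simp add: funpow_add qz_add qz_pow_mult_star[OF root])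
  moreover have "star s ((qz 1 ^^ K) P) g \<in> trunc n t"
    by (rule star_trunc_Y[OF P(3) fg(3)]) (simp add: t)
  moreover have "star s ((qz 1 ^^ K) P2) f \<in> trunc n t"
    by (rule star_trunc_X[OF _ fg(2), of _ r']) (use P1(3) in \<open>auto simp: n P2_def qz_scale trunc_def\<close>)
  ultimately have "(qz q ^^ (K * s + \<delta>)) w \<in> trunc n t" by (simp add: trunc_def)
  with 1 2 show ?thesis by (auto simp: string_gen_def K_def)
qed

text \<open>Here w = R f + Q z^\<delta> low, with R a lowest weight vector for (r', r). After
  z^(s-\<delta>) the correction is (u + v) Q low with (u + v) Q = S1 - u R. This choice makes
  everything that remains outside the ideal collect into a multiple of low with coefficient in
  (u^(r'+1), v^(r+1)).\<close>

lemma string_gen_upper: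
  assumes "i < r" "i < r'"
  shows "\<exists>w. string_gen (i * s + (j + \<delta>)) ((r + r' - 1 - 2 * i) * s + (s - \<delta>)) w"
proof -
  define K where "K = r + r' - 1 - 2 * i"
  obtain f g where fg: "(qz q ^^ \<delta>) low = f + g"
    "f \<in> free_on {(x, y). x + y = j + \<delta> \<and> l' \<le> x}"
    "g \<in> free_on {(x, y). x + y = j + \<delta> \<and> l \<le> y}" "ev q f \<noteq> 0" by (rule low_split)
  define R where "R = lowvec (1 :: 'k) (r' - i) (r - i) i"
  define S where "S = lowvec (1 :: 'k) (r' - i) (r - i) (Suc i)"
  let ?u = "star 1 (basis_vec (1, 0)) :: (nat \<times> nat \<Rightarrow>\<^sub>0 'k) \<Rightarrow> (nat \<times> nat \<Rightarrow>\<^sub>0 'k)"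
  let ?v = "star 1 (basis_vec (0, 1)) :: (nat \<times> nat \<Rightarrow>\<^sub>0 'k) \<Rightarrow> (nat \<times> nat \<Rightarrow>\<^sub>0 'k)"
  have R: "R \<in> homog i" "ev 1 R \<noteq> 0" "(qz 1 ^^ K) R \<in> trunc r' r"
    and S: "S \<in> homog (Suc i)" "ev 1 S \<noteq> 0" "(qz 1 ^^ K) S \<in> trunc (Suc r') (Suc r)"
    using lowvec_1[of i r' r, where ?'k = 'k] lowvec_1[of "Suc i" "Suc r'" "Suc r", where ?'k = 'k] assms
    by (auto simp: R_def S_def K_def add_ac)
  \<comment> \<open>Scaled to the value of u R under \<open>ev\<close>; the sign is the value -1 of
    u.\<close>
  define S1 where "S1 = scale (- ev 1 R / ev 1 S) S"
  have uR: "?u R \<in> homog (Suc i)"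
    using star_homog[of "basis_vec (1, 0)" 1 R i 1] R(1) by (simp add: homog_def)
  have "ev 1 (?u R) = - ev 1 R"
    using ev_star[OF primitive_root_unity_1, of "basis_vec (1, 0)" R] by simp
  moreover have "ev 1 S1 = - ev 1 R" using S(2) by (simp only: S1_def ev_scale) simp
  ultimately have "S1 - ?u R \<in> homog (Suc i)" "ev 1 (S1 - ?u R) = 0"
    using S uR by (auto simp: S1_def homog_def ev_diff intro!: free_on_diff free_on_scale)
  then obtain Q where "Q \<in> free_on {(x, y). Suc (x + y) = Suc i}" and Q: "S1 - ?u R = qz 1 Q"
    by (rule homog_ev_0_in_range)
  then have Qh: "Q \<in> homog i" by (simp add: homog_def)
  define fh where "fh = (qz q ^^ (s - \<delta>)) f"
  define gh where "gh = (qz q ^^ (s - \<delta>)) g"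
  have gh: "gh \<in> free_on {(x, y). x + y = j + \<delta> + (s - \<delta>) \<and> l \<le> y}"
    unfolding gh_def by (rule qz_pow_closed_homog[OF fg(3)]) auto
  have fh: "fh \<in> free_on {(x, y). x + y = j + \<delta> + (s - \<delta>) \<and> l' \<le> x}"
    unfolding fh_def by (rule qz_pow_closed_homog[OF fg(2)]) auto
  have fgh: "fh + gh = (qz q ^^ s) low"
    unfolding fh_def gh_def qz_add(2)[symmetric] fg(1)[symmetric]
    using \<delta> funpow_add[of "s - \<delta>" \<delta> "qz q"] by simp
  define w where "w = star s R f + star s Q ((qz q ^^ \<delta>) low)"
  have "f \<in> homog (j + \<delta>)" using fg(2) unfolding homog_def by (rule free_on_mono[rotated]) auto
  then have 1: "w \<in> homog (i * s + (j + \<delta>))"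
    using star_homog[OF R(1), of f "j + \<delta>" s] star_homog[OF Qh qz_pow_homog[OF low(1), of \<delta> q], of s]
    by (simp add: w_def homog_def)
  have 2: "ev q w \<noteq> 0"
    using R fg(4) \<delta> by (simp add: w_def ev_add ev_star[OF root] ev_qz_pow)
  have "(qz q ^^ (s - \<delta>)) w = star s R fh + star s Q ((qz q ^^ s) low)"
    using funpow_add[of "s - \<delta>" \<delta> "qz q"] \<delta>
    by (simp add: w_def qz_add qz_pow_star[OF q_pow] fh_def)
  also have "\<dots> = star s R fh + star s (qz 1 Q) low"
    by (simp add: qz_pow_star[OF q_pow, symmetric] qz_pow_s_star[OF root])
  finally have z: "(qz q ^^ (K * s + (s - \<delta>))) w =
      star s ((qz 1 ^^ K) R) fh + star s ((qz 1 ^^ K) (qz 1 Q)) low"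
    by (simp add: funpow_add qz_add qz_pow_mult_star[OF root])
  have "{(x, y). r' \<le> x \<or> r \<le> y} = {(x, y). r' \<le> x} \<union> {(x, y). r \<le> y}" by auto
  then obtain B1 B2 where B: "(qz 1 ^^ K) R = B1 + B2" "B1 \<in> free_on {(x, y). r' \<le> x}"
      "B2 \<in> free_on {(x, y). r \<le> y}"
    using R(3) unfolding trunc_def by (metis (no_types, lifting) free_on_Un_split)
  \<comment> \<open>B1 fh lies in the ideal, B2 fh need not. Writing fh = z^s low - gh trades B2 fh
    for - B2 gh, which does, plus (u + v) B2 low. Added to - u (B1 + B2) low from the correction,
    this leaves - u B1 + v B2 as coefficient of low.\<close>
  define C where "C = (qz 1 ^^ K) S1 - ?u B1 + ?v B2"
  have "star s B2 fh = star s B2 ((qz q ^^ s) low) - star s B2 gh"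
    unfolding fgh[symmetric] by (simp add: star_add)
  also have "\<dots> = star s (qz 1 B2) low - star s B2 gh"
    by (simp add: qz_pow_star[OF q_pow, symmetric] qz_pow_s_star[OF root])
  finally have "star s ((qz 1 ^^ K) R) fh =
      star s B1 fh + star s (?u B2 + ?v B2) low - star s B2 gh"
    unfolding B(1) star_add(1) by (simp add: qz_1_eq_star star_add)
  moreover have "(qz 1 ^^ K) (qz 1 Q) = (qz 1 ^^ K) S1 - ?u B1 - ?u B2"
    unfolding Q[symmetric] qz_diff by (simp add: qz_pow_star B(1) star_add)
  ultimately have z2: "(qz q ^^ (K * s + (s - \<delta>))) w = star s B1 fh - star s B2 gh + star s C low"
    unfolding z C_def by (simp add: star_add star_diff)
  have "?u B1 \<in> free_on {(x, y). Suc r' \<le> x}"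
    by (rule star_closed[OF _ B(2), of _ "{(1, 0)}"]) auto
  moreover have "?v B2 \<in> free_on {(x, y). Suc r \<le> y}"
    by (rule star_closed[OF _ B(3), of _ "{(0, 1)}"]) auto
  moreover have "(qz 1 ^^ K) S1 \<in> trunc (Suc r') (Suc r)"
    unfolding S1_def qz_scale trunc_def by (rule free_on_scale[OF S(3)[unfolded trunc_def]])
  ultimately have "C \<in> trunc (Suc r') (Suc r)"
    unfolding C_def trunc_def
    by (intro free_on_add free_on_diff) (auto intro: free_on_mono[rotated])
  then have "star s C low \<in> trunc n t"
    by (rule star_trunc_X[where d = j and ?x0.0 = 0]) (use low(1) l' in \<open>auto simp: homog_def n\<close>)
  moreover have "star s B1 fh \<in> trunc n t"
    by (rule star_trunc_X[OF free_on_mono[OF _ B(2), of "{(i, j). r' \<le> i \<or> Suc r \<le> j}", folded trunc_def] fh])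
      (auto simp: n)
  moreover have "star s B2 gh \<in> trunc n t"
    by (rule star_trunc_Y[OF free_on_mono[OF _ B(3), of "{(i, j). Suc r' \<le> i \<or> r \<le> j}", folded trunc_def] gh])
      (auto simp: t)
  ultimately have "(qz q ^^ (K * s + (s - \<delta>))) w \<in> trunc n t"
    unfolding z2 trunc_def by auto
  with 1 2 show ?thesis by (auto simp: string_gen_def K_def)
qed

end


text \<open>The string starting in degree \<open>i s + j\<close> ends in degree \<open>n + t - 2 - (i s + om j)\<close>. Since \<open>om\<close> is
  an involution, the lengths \<open>plen i j\<close> add up to \<open>n t\<close>.\<close>

definition om :: "nat \<Rightarrow> nat" where
  "om j = (if j + s < l + l' then l + l' - s - 1 - j
           else if j < min l l' then j
           else if j < max l l' then l + l' - 1 - j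
           else if j < l + l' then j else s + l + l' - 1 - j)"

definition plen :: "nat \<Rightarrow> nat \<Rightarrow> nat" where
  "plen i j = n + t - 1 - 2 * i * s - j - om j"

definition starts :: "(nat \<times> nat) set" where
  "starts = {(i, j). j < s \<and> i * s + j < t}"

text \<open>Together these make (i, j) \<mapsto> (i, om j) an involution of \<open>starts\<close>;
  the comparison with l concerns the incomplete row i = r.\<close>

lemma om_less: "j < s \<Longrightarrow> om j < s" and om_less_l: "j < s \<Longrightarrow> om j < l \<longleftrightarrow> j < l" and om_om: "j < s \<Longrightarrow> om (om j) = j"
  using l l' by (auto simp: om_def)

lemma in_starts_iff: "(i, j) \<in> starts \<longleftrightarrow> j < s \<and> (i < r \<or> i = r \<and> j < l)"
proof -
  have eq: "(i, j) \<in> starts \<longleftrightarrow> j < s \<and> i * s + j < t" by (simp add: starts_def)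
  consider "i < r" | "i = r" | "i > r" by linarith
  then show ?thesis
  proof cases
    case 1
    then have "Suc i * s \<le> r * s" by (intro mult_le_mono1) simp
    then show ?thesis using 1 unfolding eq unfolding t by auto
  next
    case 3
    then have "Suc r * s \<le> i * s" by (intro mult_le_mono1) simp
    then show ?thesis using 3 l unfolding eq unfolding t by auto
  qed (unfold eq, simp add: t)
qed

lemma finite_starts: "finite starts"
  by (rule finite_subset[of _ "{..r} \<times> {..<s}"]) (auto simp: in_starts_iff)

text \<open>Where \<open>om\<close> is a reflection, j + om j + 1 differs from l + l' by a multiple
  of s, and the length is a multiple of s. That multiple is e' - e, kept as two naturals to avoid
  negative numbers.\<close>

lemma plen_mult:
  assumes "i \<le> r" "i \<le> r'" "l + l' + e * s = Suc (j + om j) + e' * s"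
    "2 * i + e \<le> r + r' + e'"
  shows "plen i j = (r + r' + e' - e - 2 * i) * s"
proof -
  obtain m where m: "r + r' + e' = 2 * i + e + m" using assms(4) le_Suc_ex by blast
  have "(r + r' + e') * s + l + l' = (2 * i + m) * s + (l + l' + e * s)"
    unfolding m by (simp add: algebra_simps)
  then have "n + t = 2 * i * s + m * s + Suc (j + om j)"
    unfolding assms(3) n t by (simp add: algebra_simps)
  then have "plen i j = m * s" by (simp add: plen_def)
  moreover have "r + r' + e' - e - 2 * i = m" using m by simp
  ultimately show ?thesis by simp
qed

lemma plen_fixed: "om j = j \<Longrightarrow> plen i j = n + t - 1 - 2 * i * s - 2 * j"
  by (simp add: plen_def)

context
  assumes t_le_n: "t \<le> n"
begin

lemma r_le: "r \<le> r'" and r_less: "l' < l \<Longrightarrow> r < r'"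
proof -
  have "\<not> Suc r' * s \<le> r * s" using t_le_n n t l' by simp
  then show "r \<le> r'" by (meson mult_le_mono1 not_less_eq_eq)
  assume "l' < l"
  then have "r \<noteq> r'" using t_le_n n t by auto
  then show "r < r'" using \<open>r \<le> r'\<close> by simp
qed

lemma plen_gt: "(i, j) \<in> starts \<Longrightarrow> j + s < l + l' \<Longrightarrow> plen i j = (r + r' + 1 - 2 * i) * s"
  using r_le by (subst plen_mult[where e = 0 and e' = 1]) (auto simp: in_starts_iff om_def)

lemma plen_mid:
  assumes "(i, j) \<in> starts" "min l l' \<le> j" "j < max l l'"
  shows "plen i j = (r + r' - 2 * i) * s"
  using r_le assms l l' by (subst plen_mult[where e = 0 and e' = 0]) (auto simp: in_starts_iff om_def)

lemma plen_ge: "(i, j) \<in> starts \<Longrightarrow> l + l' \<le> j \<Longrightarrow> plen i j = (r + r' - 1 - 2 * i) * s"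
  using r_le by (subst plen_mult[where e = 1 and e' = 0]) (auto simp: in_starts_iff om_def)

lemma string_gen_exists:
  assumes ij: "(i, j) \<in> starts"
  shows "\<exists>w. string_gen (i * s + j) (plen i j) w"
proof -
  have j: "j < s" "i < r \<or> i = r \<and> j < l" "i \<le> r" "i \<le> r'"
    using ij r_le by (auto simp: in_starts_iff)
  obtain e e' where e: "r = i + e" "r' = i + e'" using j le_Suc_ex by meson
  have nt: "n + t = 2 * i * s + (e + e') * s + l + l'" by (simp add: n t e algebra_simps)
  have re: "r + r' - 2 * i = e + e'" using e by simp
  have bounds: "n \<le> r' * s + l'" "t \<le> r * s + l" "n \<le> Suc r' * s" "t \<le> Suc r * s"
    using l l' by (simp_all add: n t)
  have mult: ?thesis if "i \<le> N" "i \<le> T" "2 * i < N + T" "n \<le> N * s + ci" "t \<le> T * s + cj"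
    "ci + cj = j" "plen i j = (N + T - 1 - 2 * i) * s" for N T ci cj
    using string_gen_multiple[OF that(1-5)] that(6,7) by simp
  consider "j + s < l + l'" | "l + l' \<le> j + s" "j < min l l'" | "l \<le> j" "j < l'" | "l' \<le> j" "j < l"
    | "max l l' \<le> j" "j < l + l'" | "l + l' \<le> j"
    by linarith
  then show ?thesis
  proof cases
    case 1
    \<comment> \<open>The exponents of u^(r'+1) and v^(r+1) already exceed n and t, so X^j can be
      any monomial of degree j.\<close>
    show ?thesis
      by (rule mult[of "Suc r'" "Suc r" j 0]) (use j bounds plen_gt[OF ij 1] in \<open>auto simp: add_ac\<close>)
  next
    case 2
    then have om: "om j = j" by (auto simp: om_def)
    have "plen i j = (r + r' - 2 * i) * s + \<delta> j"
      unfolding plen_fixed[OF om] nt re using 2 by (simp add: \<delta>_def)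
    then show ?thesis using string_gen_lower[of j i] 2 j by (simp add: add_ac)
  next
    case 3
    then have "plen i j = (r + r' - 2 * i) * s" by (intro plen_mid[OF ij]) auto
    \<comment> \<open>Since j \<ge> l, the monomial Y^j completes v^r to exponent t, so T = r
      suffices. In the next case X^j does the same for u^r'.\<close>
    then show ?thesis
      by (intro mult[of "Suc r'" r 0 j]) (use j bounds 3 in \<open>auto simp: add_ac\<close>)
  next
    case 4
    then have "plen i j = (r + r' - 2 * i) * s" by (intro plen_mid[OF ij]) auto
    moreover have "r < r'" using 4 r_less by simp
    ultimately show ?thesis
      by (intro mult[of r' "Suc r" j 0]) (use j bounds 4 in \<open>auto simp: add_ac\<close>)
  next
    case 5
    then have om: "om j = j" using j(1) by (auto simp: om_def)
    \<comment> \<open>The partner of j in its pair: f for \<open>j0\<close> has degree j0 + \<delta>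
      = j.\<close>
    define j0 where "j0 = l + l' - 1 - j"
    have j0: "j0 < l" "j0 < l'" "l + l' \<le> s + j0" using 5 j(1) by (auto simp: j0_def)
    have d: "j0 + \<delta> j0 = j" "\<delta> j0 \<le> s" using j0 5 \<delta>[OF j0] by (auto simp: \<delta>_def j0_def)
    have dj: "\<delta> j0 = l + l' - 1 - 2 * j0" using j0 by (simp add: \<delta>_def)
    have i: "i < r" "i < r'" using 5 j r_le by auto
    have ee: "(e + e') * s = (r + r' - 1 - 2 * i) * s + s"
      using i e by (cases e) auto
    have "plen i j = (r + r' - 1 - 2 * i) * s + (s - \<delta> j0)"
      unfolding plen_fixed[OF om] nt ee dj using 5 j(1) by (auto simp: j0_def)
    then show ?thesis using string_gen_upper[OF j0 i] d by simp
  next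
    case 6
    then have "i < r" "i < r'" using j r_le by auto
    \<comment> \<open>Now j is large enough for X^l' Y^(j-l') to complete both u^r' and v^r.\<close>
    then show ?thesis
      by (intro mult[of r' r l' "j - l'"]) (use bounds 6 plen_ge[OF ij 6] in \<open>auto simp: add_ac\<close>)
  qed
qed

text \<open>Each length is n + t - 1 minus two starting degrees, exchanged by \<open>om\<close>. The
  starting degrees are 0, ..., t - 1, so the total is t (n + t - 1) - t (t - 1).\<close>

lemma sum_plen: "(\<Sum>(i, j)\<in>starts. plen i j) = n * t"
proof -
  \<comment> \<open>Both degrees are below t \<le> n, so the truncated subtraction in
    \<open>plen\<close> is exact.\<close>
  have eq: "int (plen i j) = int n + int t - 1 - int (i * s + j) - int (i * s + om j)"
    if "(i, j) \<in> starts" for i j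
  proof -
    have "(i, om j) \<in> starts" using that om_less om_less_l by (auto simp: in_starts_iff)
    then have "i * s + om j < t" "i * s + j < t" using that by (auto simp: starts_def)
    then show ?thesis using t_le_n by (simp add: plen_def of_nat_diff)
  qed
  have s1: "(\<Sum>(i, j)\<in>starts. int (i * s + om j)) = (\<Sum>(i, j)\<in>starts. int (i * s + j))"
    by (rule sum.reindex_bij_witness[of _ "\<lambda>(i, j). (i, om j)" "\<lambda>(i, j). (i, om j)"])
      (auto simp: in_starts_iff om_less om_less_l om_om)
  have s2: "(\<Sum>(i, j)\<in>starts. int (i * s + j)) = (\<Sum>d<t. int d)"
    by (rule sum.reindex_bij_witness[of _ "\<lambda>d. (d div s, d mod s)" "\<lambda>(i, j). i * s + j"])
      (auto simp: starts_def s_pos)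
  have s3: "2 * (\<Sum>d<m. int d) = int m * (int m - 1)" for m
    by (induction m) (auto simp: algebra_simps)
  have "card starts = card {..<t}"
    by (rule bij_betw_same_card[of "\<lambda>(i, j). i * s + j"], rule bij_betw_byWitness[where f' = "\<lambda>d. (d div s, d mod s)"])
      (auto simp: starts_def s_pos)
  then have c: "card starts = t" by simp
  have "int (\<Sum>(i, j)\<in>starts. plen i j) =
      (\<Sum>(i, j)\<in>starts. (int n + int t - 1) - int (i * s + j) - int (i * s + om j))"
    unfolding of_nat_sum by (intro sum.cong) (use eq in auto)
  also have "\<dots> = (\<Sum>x\<in>starts. int n + int t - 1) - (\<Sum>(i, j)\<in>starts. int (i * s + j)) -
      (\<Sum>(i, j)\<in>starts. int (i * s + om j))"
    by (simp only: case_prod_unfold sum_subtractf)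
  also have "\<dots> = int t * (int n + int t - 1) - 2 * (\<Sum>(i, j)\<in>starts. int (i * s + j))"
    unfolding s1 by (simp add: c)
  also have "\<dots> = int (n * t)"
    unfolding s2 s3 by (simp add: algebra_simps)
  finally show ?thesis by (simp only: of_nat_eq_iff)
qed

end

end

section \<open>Isomorphisms of left modules and direct sums\<close>

text \<open>Only N is known to be a module. M merely carries compatible operations, and its module
  laws are part of the conclusion.\<close>

lemma left_module_transport:
  fixes N :: "('h, 'n) module" and M :: "('h, 'm) module"
  assumes N: "left_module R N" and bij: "bij_betw f (carrier N) (carrier M)"
    and add: "\<And>x y. x \<in> carrier N \<Longrightarrow> y \<in> carrier N \<Longrightarrow> f (x \<oplus>\<^bsub>N\<^esub> y) = f x \<oplus>\<^bsub>M\<^esub> f y"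
    and smult: "\<And>h x. h \<in> carrier R \<Longrightarrow> x \<in> carrier N \<Longrightarrow> f (h \<odot>\<^bsub>N\<^esub> x) = h \<odot>\<^bsub>M\<^esub> f x"
    and zero: "f \<zero>\<^bsub>N\<^esub> = \<zero>\<^bsub>M\<^esub>"
  shows "left_module_iso R N M"
proof -
  interpret N: left_module R N by fact
  have im: "carrier M = f ` carrier N" using bij by (simp add: bij_betw_def)
  have ab: "abelian_group M"
  proof (rule abelian_groupI)
    fix x assume "x \<in> carrier M"
    then obtain u where u: "u \<in> carrier N" "x = f u" by (auto simp: im)
    then show "\<exists>y\<in>carrier M. y \<oplus>\<^bsub>M\<^esub> x = \<zero>\<^bsub>M\<^esub>"
      by (intro bexI[of _ "f (\<ominus>\<^bsub>N\<^esub> u)"])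
        (auto simp: im N.l_neg simp flip: add zero)
  qed (auto simp: im N.a_ac simp flip: add zero)
  have "left_module R M"
  proof (intro left_module.intro left_module_axioms.intro ab)
    show "ring R" by (rule N.ring_axioms)
  qed (auto simp: im N.smult_l_distr N.smult_r_distr N.smult_assoc1 N.smult_one N.smult_closed
      N.R.ring_simprules simp flip: add smult)
  with N bij add smult show ?thesis unfolding left_module_iso_def by blast
qed

lemma left_module_iso_sym:
  assumes "left_module_iso R M N"
  shows "left_module_iso R N M"
proof -
  obtain f where bij: "bij_betw f (carrier M) (carrier N)"
    and add: "\<forall>x\<in>carrier M. \<forall>y\<in>carrier M. f (x \<oplus>\<^bsub>M\<^esub> y) = f x \<oplus>\<^bsub>N\<^esub> f y"
    and smult: "\<forall>h\<in>carrier R. \<forall>x\<in>carrier M. f (h \<odot>\<^bsub>M\<^esub> x) = h \<odot>\<^bsub>N\<^esub> f x"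
    and M: "left_module R M" and N: "left_module R N"
    using assms unfolding left_module_iso_def by blast
  interpret M: left_module R M by fact
  let ?g = "inv_into (carrier M) f"
  have im: "carrier N = f ` carrier M" and inj: "inj_on f (carrier M)"
    using bij by (auto simp: bij_betw_def)
  have "?g (x \<oplus>\<^bsub>N\<^esub> y) = ?g x \<oplus>\<^bsub>M\<^esub> ?g y" if "x \<in> carrier N" "y \<in> carrier N" for x y
    using that inj add by (auto simp: im simp flip: add)
  moreover have "?g (h \<odot>\<^bsub>N\<^esub> x) = h \<odot>\<^bsub>M\<^esub> ?g x" if "h \<in> carrier R" "x \<in> carrier N" for h x
    using that inj smult by (auto simp: im M.smult_closed simp flip: smult)
  ultimately show ?thesis
    using M N bij_betw_inv_into[OF bij] unfolding left_module_iso_def by blast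
qed

lemma left_module_iso_trans:
  assumes "left_module_iso R M N" "left_module_iso R N P"
  shows "left_module_iso R M P"
proof -
  obtain f where f: "bij_betw f (carrier M) (carrier N)"
    "\<forall>x\<in>carrier M. \<forall>y\<in>carrier M. f (x \<oplus>\<^bsub>M\<^esub> y) = f x \<oplus>\<^bsub>N\<^esub> f y"
    "\<forall>h\<in>carrier R. \<forall>x\<in>carrier M. f (h \<odot>\<^bsub>M\<^esub> x) = h \<odot>\<^bsub>N\<^esub> f x"
    and M: "left_module R M"
    using assms(1) unfolding left_module_iso_def by blast
  obtain g where g: "bij_betw g (carrier N) (carrier P)"
    "\<forall>x\<in>carrier N. \<forall>y\<in>carrier N. g (x \<oplus>\<^bsub>N\<^esub> y) = g x \<oplus>\<^bsub>P\<^esub> g y"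
    "\<forall>h\<in>carrier R. \<forall>x\<in>carrier N. g (h \<odot>\<^bsub>N\<^esub> x) = h \<odot>\<^bsub>P\<^esub> g x"
    and P: "left_module R P"
    using assms(2) unfolding left_module_iso_def by blast
  have "f x \<in> carrier N" if "x \<in> carrier M" for x using f(1) that by (auto simp: bij_betw_def)
  then show ?thesis
    unfolding left_module_iso_def using M P bij_betw_trans[OF f(1) g(1)] f(2,3) g(2,3)
    by (intro conjI exI[of _ "g \<circ> f"]) auto
qed

lemma direct_sum_simps:
  "finite I \<Longrightarrow> carrier (direct_sum I M) = (\<Pi>\<^sub>E i\<in>I. carrier (M i))"
  "\<zero>\<^bsub>direct_sum I M\<^esub> = (\<lambda>i\<in>I. \<zero>\<^bsub>M i\<^esub>)"
  "x \<oplus>\<^bsub>direct_sum I M\<^esub> y = (\<lambda>i\<in>I. x i \<oplus>\<^bsub>M i\<^esub> y i)"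
  "h \<odot>\<^bsub>direct_sum I M\<^esub> x = (\<lambda>i\<in>I. h \<odot>\<^bsub>M i\<^esub> x i)"
  by (auto simp: direct_sum_def)

lemma direct_sum_cong: "(\<And>i. i \<in> I \<Longrightarrow> M i = M' i) \<Longrightarrow> direct_sum I M = direct_sum I M'"
  unfolding direct_sum_def
  by (auto intro!: ext Collect_cong simp: PiE_def Pi_def restrict_def cong: conj_cong)

lemma left_module_direct_sum:
  assumes R: "ring R" and I: "finite I" and M: "\<And>i. i \<in> I \<Longrightarrow> left_module R (M i)"
  shows "left_module R (direct_sum I M)"
proof -
  have A: "abelian_group (M i)" if "i \<in> I" for i
    using M[OF that] by (simp add: left_module_def)
  note ag = abelian_groupE[OF A]
  note [simp] = direct_sum_simps(1)[OF I] direct_sum_simps(2-)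
  have "abelian_group (direct_sum I M)"
  proof (rule abelian_groupI)
    fix x assume x: "x \<in> carrier (direct_sum I M)"
    then show "\<exists>y\<in>carrier (direct_sum I M). y \<oplus>\<^bsub>direct_sum I M\<^esub> x = \<zero>\<^bsub>direct_sum I M\<^esub>"
      by (intro bexI[of _ "\<lambda>i\<in>I. \<ominus>\<^bsub>M i\<^esub> x i"])
        (auto simp: PiE_iff abelian_group.a_inv_closed[OF A] abelian_group.l_neg[OF A] intro!: restrict_ext)
    show "\<zero>\<^bsub>direct_sum I M\<^esub> \<oplus>\<^bsub>direct_sum I M\<^esub> x = x"
      using x by (auto simp: fun_eq_iff restrict_def PiE_iff extensional_def ag(5))
  qed (auto simp: PiE_iff ag(1,2) abelian_monoid.a_ac[OF abelian_group.axioms(1)[OF A]]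
      intro!: restrict_ext)
  moreover note mod = left_module.smult_closed[OF M] left_module.smult_l_distr[OF M] left_module.smult_r_distr[OF M]
    left_module.smult_assoc1[OF M] left_module.smult_one[OF M]
  ultimately show ?thesis
    by (intro left_module.intro R left_module_axioms.intro)
      (auto simp: mod fun_eq_iff restrict_def PiE_iff extensional_def)
qed

lemma left_module_binary_sum:
  assumes M: "left_module R M" and N: "left_module R N"
  shows "left_module R (M \<boxplus> N)"
proof -
  interpret M: left_module R M by fact
  interpret N: left_module R N by fact
  have "abelian_group (M \<boxplus> N)"
  proof (rule abelian_groupI)
    fix x assume "x \<in> carrier (M \<boxplus> N)"
    then show "\<exists>y\<in>carrier (M \<boxplus> N). y \<oplus>\<^bsub>M \<boxplus> N\<^esub> x = \<zero>\<^bsub>M \<boxplus> N\<^esub>"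
      by (intro bexI[of _ "(\<ominus>\<^bsub>M\<^esub> fst x, \<ominus>\<^bsub>N\<^esub> snd x)"])
        (auto simp: binary_sum_def M.l_neg N.l_neg)
  qed (auto simp: binary_sum_def M.a_ac N.a_ac)
  then show ?thesis
    by (intro left_module.intro M.ring_axioms left_module_axioms.intro)
      (auto simp: binary_sum_def M.smult_closed N.smult_closed M.smult_l_distr N.smult_l_distr
        M.smult_r_distr N.smult_r_distr M.smult_assoc1 N.smult_assoc1 M.smult_one N.smult_one)
qed

lemma left_module_iso_nested_sum:
  assumes R: "ring R" and I: "finite I" "\<And>i. i \<in> I \<Longrightarrow> finite (J i)"
    and M: "\<And>i j. i \<in> I \<Longrightarrow> j \<in> J i \<Longrightarrow> left_module R (M i j)"
  shows "left_module_iso R (direct_sum I (\<lambda>i. direct_sum (J i) (\<lambda>j. M i j)))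
    (direct_sum (Sigma I J) (\<lambda>(i, j). M i j))"
proof -
  let ?A = "direct_sum I (\<lambda>i. direct_sum (J i) (\<lambda>j. M i j))"
  let ?B = "direct_sum (Sigma I J) (\<lambda>(i, j). M i j)"
  let ?f = "\<lambda>x. \<lambda>(i, j)\<in>Sigma I J. x i j"
  let ?g = "\<lambda>y. \<lambda>i\<in>I. \<lambda>j\<in>J i. y (i, j)"
  have fin: "finite (Sigma I J)" using I by auto
  have cA: "carrier ?A = (\<Pi>\<^sub>E i\<in>I. \<Pi>\<^sub>E j\<in>J i. carrier (M i j))"
    unfolding direct_sum_simps(1)[OF I(1)] using I(2) by (intro PiE_cong) (simp add: direct_sum_simps)
  have cB: "carrier ?B = (\<Pi>\<^sub>E (i, j)\<in>Sigma I J. carrier (M i j))"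
    unfolding direct_sum_simps(1)[OF fin] by (intro PiE_cong) auto
  have "bij_betw ?f (carrier ?A) (carrier ?B)"
  proof (rule bij_betw_byWitness[where f' = ?g])
    show "\<forall>x\<in>carrier ?A. ?g (?f x) = x"
      unfolding cA by (auto simp: fun_eq_iff PiE_iff extensional_def restrict_def)
    show "\<forall>y\<in>carrier ?B. ?f (?g y) = y"
      unfolding cB by (auto simp: fun_eq_iff PiE_iff extensional_def restrict_def)
    show "?f ` carrier ?A \<subseteq> carrier ?B"
      unfolding cA cB by (auto simp: PiE_iff extensional_def split: if_splits)
    show "?g ` carrier ?B \<subseteq> carrier ?A"
      unfolding cA cB by (auto simp: PiE_iff)
  qed
  moreover have "\<forall>x\<in>carrier ?A. \<forall>y\<in>carrier ?A. ?f (x \<oplus>\<^bsub>?A\<^esub> y) = ?f x \<oplus>\<^bsub>?B\<^esub> ?f y"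
    by (auto simp: direct_sum_simps(3) fun_eq_iff)
  moreover have "\<forall>h\<in>carrier R. \<forall>x\<in>carrier ?A. ?f (h \<odot>\<^bsub>?A\<^esub> x) = h \<odot>\<^bsub>?B\<^esub> ?f x"
    by (auto simp: direct_sum_simps(4) fun_eq_iff)
  moreover have "left_module R ?A" "left_module R ?B"
    using I M fin by (auto intro!: left_module_direct_sum R)
  ultimately show ?thesis unfolding left_module_iso_def by blast
qed

lemma left_module_iso_union_sum:
  assumes R: "ring R" and IJ: "finite I" "finite J" "I \<inter> J = {}"
    and M: "\<And>i. i \<in> I \<union> J \<Longrightarrow> left_module R (M i)"
  shows "left_module_iso R (direct_sum I M \<boxplus> direct_sum J M) (direct_sum (I \<union> J) M)"
proof -
  let ?A = "direct_sum I M \<boxplus> direct_sum J M" and ?B = "direct_sum (I \<union> J) M"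
  let ?f = "\<lambda>(x, y). \<lambda>i\<in>I \<union> J. if i \<in> I then x i else y i"
  let ?g = "\<lambda>z. (\<lambda>i\<in>I. z i, \<lambda>i\<in>J. z i)"
  have fin: "finite (I \<union> J)" using IJ by auto
  have cA: "carrier ?A = (\<Pi>\<^sub>E i\<in>I. carrier (M i)) \<times> (\<Pi>\<^sub>E i\<in>J. carrier (M i))"
    using IJ by (simp add: binary_sum_def direct_sum_simps)
  have cB: "carrier ?B = (\<Pi>\<^sub>E i\<in>I \<union> J. carrier (M i))"
    by (rule direct_sum_simps(1)[OF fin])
  have "bij_betw ?f (carrier ?A) (carrier ?B)"
  proof (rule bij_betw_byWitness[where f' = ?g])
    show "\<forall>x\<in>carrier ?A. ?g (?f x) = x"
      unfolding cA using IJ(3) by (auto simp: fun_eq_iff PiE_iff extensional_def restrict_def)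
    show "\<forall>y\<in>carrier ?B. ?f (?g y) = y"
      unfolding cB by (auto simp: fun_eq_iff PiE_iff extensional_def restrict_def)
    show "?f ` carrier ?A \<subseteq> carrier ?B"
      unfolding cA cB by (auto simp: PiE_iff)
    show "?g ` carrier ?B \<subseteq> carrier ?A"
      unfolding cA cB by (auto simp: PiE_iff)
  qed
  moreover have "\<forall>x\<in>carrier ?A. \<forall>y\<in>carrier ?A. ?f (x \<oplus>\<^bsub>?A\<^esub> y) = ?f x \<oplus>\<^bsub>?B\<^esub> ?f y"
    by (auto simp: binary_sum_def direct_sum_simps(3) fun_eq_iff)
  moreover have "\<forall>h\<in>carrier R. \<forall>x\<in>carrier ?A. ?f (h \<odot>\<^bsub>?A\<^esub> x) = h \<odot>\<^bsub>?B\<^esub> ?f x"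
    by (auto simp: binary_sum_def direct_sum_simps(4) fun_eq_iff)
  moreover have "left_module R ?A" "left_module R ?B"
    using IJ M fin by (auto intro!: left_module_binary_sum left_module_direct_sum R)
  ultimately show ?thesis unfolding left_module_iso_def by blast
qed

lemma left_module_iso_binary_sum:
  assumes "left_module_iso R M M'" "left_module_iso R N N'"
  shows "left_module_iso R (M \<boxplus> N) (M' \<boxplus> N')"
proof -
  obtain f where f: "bij_betw f (carrier M) (carrier M')"
    "\<forall>x\<in>carrier M. \<forall>y\<in>carrier M. f (x \<oplus>\<^bsub>M\<^esub> y) = f x \<oplus>\<^bsub>M'\<^esub> f y"
    "\<forall>h\<in>carrier R. \<forall>x\<in>carrier M. f (h \<odot>\<^bsub>M\<^esub> x) = h \<odot>\<^bsub>M'\<^esub> f x"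
    and M: "left_module R M" "left_module R M'"
    using assms(1) unfolding left_module_iso_def by blast
  obtain g where g: "bij_betw g (carrier N) (carrier N')"
    "\<forall>x\<in>carrier N. \<forall>y\<in>carrier N. g (x \<oplus>\<^bsub>N\<^esub> y) = g x \<oplus>\<^bsub>N'\<^esub> g y"
    "\<forall>h\<in>carrier R. \<forall>x\<in>carrier N. g (h \<odot>\<^bsub>N\<^esub> x) = h \<odot>\<^bsub>N'\<^esub> g x"
    and N: "left_module R N" "left_module R N'"
    using assms(2) unfolding left_module_iso_def by blast
  have "bij_betw (map_prod f g) (carrier (M \<boxplus> N)) (carrier (M' \<boxplus> N'))"
    using bij_betw_map_prod[OF f(1) g(1)] by (simp add: binary_sum_def)
  then show ?thesis
    unfolding left_module_iso_def using f(2,3) g(2,3) M N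
    by (intro conjI left_module_binary_sum exI[of _ "map_prod f g"]) (auto simp: binary_sum_def)
qed

section \<open>Decomposition into strings\<close>

lemma inj_basis_vec: "inj (basis_vec :: 'b \<Rightarrow> 'b \<Rightarrow>\<^sub>0 'k::field)"
  by (intro injI) (metis lookup_single_eq lookup_single_not_eq zero_neq_one)

lemma independent_basis_vec:
  assumes "finite B"
  shows "free.independent (basis_vec ` B :: ('b \<Rightarrow>\<^sub>0 'k::field) set)"
proof (rule free.independent_if_scalars_zero)
  fix f :: "('b \<Rightarrow>\<^sub>0 'k) \<Rightarrow> 'k" and x :: "'b \<Rightarrow>\<^sub>0 'k"
  assume s: "(\<Sum>x\<in>basis_vec ` B. scale (f x) x) = 0" and "x \<in> basis_vec ` B"
  then obtain b where b: "b \<in> B" "x = basis_vec b" by blast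
  have "inj_on (basis_vec :: 'b \<Rightarrow> 'b \<Rightarrow>\<^sub>0 'k) B"
    using inj_basis_vec by (rule inj_on_subset) simp
  then have "(\<Sum>b\<in>B. scale (f (basis_vec b)) (basis_vec b)) = 0"
    using s by (simp add: sum.reindex)
  then have "Poly_Mapping.lookup (\<Sum>b\<in>B. scale (f (basis_vec b)) (basis_vec b)) b = 0"
    by simp
  also have "Poly_Mapping.lookup (\<Sum>b\<in>B. scale (f (basis_vec b)) (basis_vec b)) b =
      (\<Sum>b'\<in>B. if b' = b then f (basis_vec b) else 0)"
    unfolding lookup_sum by (intro sum.cong) (auto simp: lookup_scale lookup_single when_def)
  finally show "f x = 0" using b assms by simp
qed (use assms in simp)

text \<open>Exchange argument: a nontrivial relation makes one vector redundant, and then fewer than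
  \<open>card B\<close> vectors would span an independent set of that size.\<close>

lemma spanning_family_independent:
  fixes v :: "'i \<Rightarrow> ('b \<Rightarrow>\<^sub>0 'k::field)"
  assumes fin: "finite K" "finite B" and card: "card K \<le> card B"
    and span: "basis_vec ` B \<subseteq> free.span (v ` K)"
    and sum: "(\<Sum>\<kappa>\<in>K. scale (c \<kappa>) (v \<kappa>)) = 0" and \<kappa>: "\<kappa> \<in> K"
  shows "c \<kappa> = 0"
proof (rule ccontr)
  assume c: "c \<kappa> \<noteq> 0"
  let ?K = "K - {\<kappa>}"
  let ?y = "\<Sum>x\<in>?K. scale (c x) (v x)"
  have "scale (c \<kappa>) (v \<kappa>) + ?y = 0"
    using sum sum.remove[OF fin(1) \<kappa>, of "\<lambda>x. scale (c x) (v x)"] by simp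
  then have "scale (c \<kappa>) (v \<kappa>) = - ?y" by (simp add: eq_neg_iff_add_eq_0)
  then have "scale (inverse (c \<kappa>)) (scale (c \<kappa>) (v \<kappa>)) = scale (inverse (c \<kappa>)) (- ?y)" by (rule arg_cong)
  then have "v \<kappa> = scale (inverse (c \<kappa>)) (- ?y)"
    using c by (simp only: free.scale_scale left_inverse[OF c] free.scale_one)
  moreover have "?y \<in> free.span (v ` ?K)"
    by (intro free.span_sum free.span_scale free.span_base) auto
  ultimately have "v \<kappa> \<in> free.span (v ` ?K)"
    by (simp only: free.span_neg free.span_scale)
  then have "free.span (insert (v \<kappa>) (v ` ?K)) = free.span (v ` ?K)"
    by (rule free.span_redundant)
  moreover have "insert (v \<kappa>) (v ` ?K) = v ` K" using \<kappa> by auto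
  ultimately have sub: "basis_vec ` B \<subseteq> free.span (v ` ?K)" using span by simp
  have "card (basis_vec ` B :: ('b \<Rightarrow>\<^sub>0 'k) set) \<le> card (v ` ?K)"
    using free.independent_span_bound[OF _ independent_basis_vec[OF fin(2)] sub] fin(1) by simp
  also have "\<dots> \<le> card ?K" using fin by (intro card_image_le) auto
  also have "\<dots> < card K" using \<kappa> fin by (intro psubset_card_mono) auto
  also have "\<dots> \<le> card B" by fact
  also have "card B = card (basis_vec ` B :: ('b \<Rightarrow>\<^sub>0 'k) set)"
    by (intro card_image[symmetric] inj_on_subset[OF inj_basis_vec]) simp
  finally show False by simp
qed

section \<open>String decomposition of a graded quotient of the quantum plane\<close>

text \<open>The element g x^m acts by the given operators, and nothing in the definition makes this
  a module. The laws come with the isomorphism from the sum of strings.\<close>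

definition emod :: "'b set \<Rightarrow> (('b \<Rightarrow>\<^sub>0 'k::field) \<Rightarrow> ('b \<Rightarrow>\<^sub>0 'k)) \<Rightarrow> ('g \<Rightarrow> ('b \<Rightarrow>\<^sub>0 'k) \<Rightarrow> ('b \<Rightarrow>\<^sub>0 'k))
    \<Rightarrow> (('g, 'k) hopf, 'b \<Rightarrow>\<^sub>0 'k) module" where
  "emod B zE gE =
     \<lparr>carrier = free_on B, monoid.mult = undefined, one = undefined, zero = 0, add = (+),
      smult = bilin_ext (\<lambda>(g, m) b. gE g ((zE ^^ m) (basis_vec b)))\<rparr>"

lemma emod_smult_basis:
  assumes "lin zE" "\<And>g. lin (gE g)"
  shows "basis_vec (g, m) \<odot>\<^bsub>emod B zE gE\<^esub> e = gE g ((zE ^^ m) e)"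
proof -
  have "lin_ext (\<lambda>b. gE g ((zE ^^ m) (basis_vec b))) = (\<lambda>e. gE g ((zE ^^ m) e))"
    by (rule lin_eqI[OF lin_lin_ext lin_compose[OF assms(2) lin_funpow[OF assms(1)]]]) simp
  then show ?thesis by (simp add: emod_def)
qed

lemma V_simps:
  "carrier (V \<chi> p \<psi>) = free_on {..<p}" "add (V \<chi> p \<psi>) = (+)" "\<zero>\<^bsub>V \<chi> p \<psi>\<^esub> = 0"
  by (simp_all add: V_def)

lemma lin_V_smult: "lin (\<lambda>h. h \<odot>\<^bsub>V \<chi> p \<psi>\<^esub> x)" "lin (\<lambda>x. h \<odot>\<^bsub>V \<chi> p \<psi>\<^esub> x)"
  by (simp_all add: V_def lin_bilin_ext_left lin_bilin_ext_right)

lemma V_smult_basis: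
  assumes "k < p"
  shows "basis_vec (g, m) \<odot>\<^bsub>V \<chi> p \<psi>\<^esub> basis_vec k =
    (if k + m < p then Poly_Mapping.single (k + m) (\<chi> g ^ (k + m) * \<psi> g) else 0)"
  using assms by (auto simp: V_def V_x_pow V_grp_def scale_single add.commute)

text \<open>The common pattern of both orders of the tensor factors. That the kernel of \<pi> is no
  larger than the ideal is encoded by the count \<open>card B = n * t\<close>.\<close>

locale graded_quotient = quantum_tensor +
  fixes G :: "('g, 'z) monoid_scheme" and \<chi> \<eta> \<nu> :: "'g \<Rightarrow> 'a" and \<psi> :: "nat \<Rightarrow> 'g \<Rightarrow> 'a"
    and \<pi> :: "(nat \<times> nat \<Rightarrow>\<^sub>0 'a) \<Rightarrow> ('b \<Rightarrow>\<^sub>0 'a)" and zE :: "('b \<Rightarrow>\<^sub>0 'a) \<Rightarrow> ('b \<Rightarrow>\<^sub>0 'a)"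
    and gE :: "'g \<Rightarrow> ('b \<Rightarrow>\<^sub>0 'a) \<Rightarrow> ('b \<Rightarrow>\<^sub>0 'a)" and B :: "'b set"
  assumes group: "group G" and \<chi>: "\<chi> \<in> carrier (char_group G)"
    and \<eta>: "\<eta> \<in> carrier (char_group G)" and \<eta>\<chi>: "g \<in> carrier G \<Longrightarrow> \<eta> g * \<chi> g = 1"
    and \<psi>: "\<psi> j \<in> carrier (char_group G)" and \<psi>_eq: "g \<in> carrier G \<Longrightarrow> \<psi> j g = \<chi> g ^ j * \<nu> g"
    and \<chi>_pow: "g \<in> carrier G \<Longrightarrow> \<chi> g ^ s = 1"
    and lin_maps: "lin \<pi>" "lin zE" "lin (gE g)"
    and \<pi>_qz: "\<pi> (qz q p) = zE (\<pi> p)"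
    and \<pi>_trunc: "p \<in> trunc n t \<Longrightarrow> \<pi> p = 0"
    and \<pi>_homog: "g \<in> carrier G \<Longrightarrow> p \<in> homog d \<Longrightarrow> gE g (\<pi> p) = scale (\<chi> g ^ d * \<nu> g) (\<pi> p)"
    and \<pi>_range: "basis_vec ` B \<subseteq> range \<pi>" "\<pi> p \<in> free_on B"
    and B: "finite B" "card B = n * t" and t_le: "t \<le> n"
begin

lemma \<pi>_qz_pow: "\<pi> ((qz q ^^ m) p) = (zE ^^ m) (\<pi> p)"
  by (induction m) (simp_all add: \<pi>_qz)

definition gen :: "nat \<times> nat \<Rightarrow> (nat \<times> nat \<Rightarrow>\<^sub>0 'a)" where
  "gen = (\<lambda>(i, j). SOME w. string_gen (i * s + j) (plen i j) w)"

definition vec :: "nat \<times> nat \<Rightarrow> nat \<Rightarrow> ('b \<Rightarrow>\<^sub>0 'a)" where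
  "vec d k = (zE ^^ k) (\<pi> (gen d))"

lemma gen:
  assumes "(i, j) \<in> starts"
  shows "gen (i, j) \<in> homog (i * s + j)" "ev q (gen (i, j)) \<noteq> 0" "(qz q ^^ plen i j) (gen (i, j)) \<in> trunc n t"
  using someI_ex[OF string_gen_exists[OF t_le assms]] by (simp_all add: gen_def string_gen_def)

lemma vec_eq: "vec d k = \<pi> ((qz q ^^ k) (gen d))"
  by (simp add: vec_def \<pi>_qz_pow)

lemma zE_vec: "(zE ^^ m) (vec d k) = vec d (k + m)"
  by (simp add: vec_def funpow_add add.commute[of k])

lemma vec_zero:
  assumes "(i, j) \<in> starts" "plen i j \<le> k"
  shows "vec (i, j) k = 0"
proof -
  obtain m where k: "k = m + plen i j" using assms(2) by (metis le_Suc_ex add.commute)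
  show ?thesis unfolding vec_eq k
    using qz_pow_trunc[OF gen(3)[OF assms(1)]] by (intro \<pi>_trunc) (simp add: funpow_add)
qed

definition strings :: "((nat \<times> nat) \<times> nat) set" where
  "strings = Sigma starts (\<lambda>(i, j). {..<plen i j})"

lemma finite_strings: "finite strings"
  unfolding strings_def using finite_starts by auto

lemma card_strings: "card strings = card B"
  unfolding strings_def B(2) sum_plen[OF t_le, symmetric]
  by (subst card_SigmaI) (auto simp: finite_starts intro!: sum.cong)

definition string_span :: "('b \<Rightarrow>\<^sub>0 'a) set" where
  "string_span = free.span ((\<lambda>(d, k). vec d k) ` strings)"

lemma vec_in_span:
  assumes "(i, j) \<in> starts"
  shows "vec (i, j) k \<in> string_span"
proof (cases "k < plen i j")
  case True
  then have "((i, j), k) \<in> strings" using assms by (simp add: strings_def)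
  then show ?thesis unfolding string_span_def by (intro free.span_base) force
qed (use vec_zero[OF assms] in \<open>simp add: string_span_def free.span_zero\<close>)

lemma zE_span: "x \<in> string_span \<Longrightarrow> zE x \<in> string_span"
proof -
  assume "x \<in> string_span"
  then have "zE x \<in> zE ` free.span ((\<lambda>(d, k). vec d k) ` strings)" by (simp add: string_span_def)
  also have "\<dots> = free.span (zE ` (\<lambda>(d, k). vec d k) ` strings)"
    by (rule module_hom.span_image[OF lin_maps(2), symmetric])
  also have "\<dots> \<subseteq> string_span"
  proof (unfold string_span_def, rule free.span_minimal[OF _ free.subspace_span], fold string_span_def, clarify)
    fix i j k assume "((i, j), k) \<in> strings"
    then show "zE (vec (i, j) k) \<in> string_span"
      using zE_vec[of 1 "(i, j)" k] vec_in_span[of i j "Suc k"] by (simp add: strings_def)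
  qed
  finally show ?thesis .
qed

lemma \<pi>_single_in_span:
  assumes "\<pi> (Poly_Mapping.single (0, D) c) \<in> string_span" "c \<noteq> 0"
  shows "\<pi> (Poly_Mapping.single (0, D) c') \<in> string_span"
proof -
  have "Poly_Mapping.single (0 :: nat, D) c' = scale (c' / c) (Poly_Mapping.single (0, D) c)"
    using assms(2) by (simp add: scale_single)
  then have "\<pi> (Poly_Mapping.single (0, D) c') = scale (c' / c) (\<pi> (Poly_Mapping.single (0, D) c))"
    by (simp only: module_hom.scale[OF lin_maps(1)])
  then show ?thesis using assms(1) unfolding string_span_def by (simp add: free.span_scale)
qed

text \<open>Induction on the degree; by \<open>ev_reduce\<close> only Y^D has to be reached. It
  vanishes for D \<ge> t. For D < t a string starts in degree D = i s + j, and modulo the range of z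
  its generator is a nonzero multiple of Y^D.\<close>

lemma \<pi>_homog_in_span: "p \<in> homog D \<Longrightarrow> \<pi> p \<in> string_span"
proof (induction D arbitrary: p)
  \<comment> \<open>Stated once for both cases of the induction: for D = 0 the hypothesis concerns
    only p' = 0.\<close>
  have step: "\<pi> p \<in> string_span"
    if p: "p \<in> homog D" and IH: "\<And>p'. p' \<in> free_on {(i, j). Suc (i + j) = D} \<Longrightarrow> \<pi> p' \<in> string_span" for p D
  proof -
    have red: "\<exists>p'. \<pi> p' \<in> string_span \<and> p = Poly_Mapping.single (0, D) (ev q p) + qz q p'"
      if "p \<in> homog D" for p
      using ev_reduce[OF that] IH by metis
    have "\<pi> (Poly_Mapping.single (0, D) c) \<in> string_span" for c
    proof (cases "D < t")
      case False
      then have "Poly_Mapping.single (0, D) c \<in> trunc n t" by (simp add: trunc_def)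
      then show ?thesis by (simp add: \<pi>_trunc string_span_def free.span_zero)
    next
      case True
      let ?d = "(D div s, D mod s)"
      have d: "?d \<in> starts" using True s_pos by (simp add: starts_def)
      note g = gen[OF d]
      obtain p' where p': "\<pi> p' \<in> string_span"
        "gen ?d = Poly_Mapping.single (0, D) (ev q (gen ?d)) + qz q p'"
        using red[of "gen ?d"] g(1) by auto
      have "\<pi> (Poly_Mapping.single (0, D) (ev q (gen ?d))) = \<pi> (gen ?d) - zE (\<pi> p')"
        by (subst p'(2)) (simp add: module_hom.add[OF lin_maps(1)] \<pi>_qz)
      moreover have "\<pi> (gen ?d) \<in> string_span" using vec_in_span[OF d, of 0] by (simp add: vec_def)
      ultimately have "\<pi> (Poly_Mapping.single (0, D) (ev q (gen ?d))) \<in> string_span"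
        using zE_span[OF p'(1)] unfolding string_span_def by (simp add: free.span_diff)
      then show ?thesis using g(2) by (rule \<pi>_single_in_span)
    qed
    moreover obtain p' where p': "\<pi> p' \<in> string_span" "p = Poly_Mapping.single (0, D) (ev q p) + qz q p'"
      using red[OF p] by blast
    moreover have "\<pi> p = \<pi> (Poly_Mapping.single (0, D) (ev q p)) + zE (\<pi> p')"
      by (subst p'(2)) (simp add: module_hom.add[OF lin_maps(1)] \<pi>_qz)
    ultimately show ?thesis using zE_span[OF p'(1)] unfolding string_span_def
      by (metis free.span_add)
  qed
  {
    case (0 p)
    show ?case
      by (rule step[OF 0]) (simp add: free_on_def module_hom.zero[OF lin_maps(1)] string_span_def free.span_zero)
  next
    case (Suc D)
    show ?case
      by (rule step[OF Suc.prems]) (auto simp: homog_def intro!: Suc.IH)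
  }
qed

lemma basis_in_span: "basis_vec ` B \<subseteq> string_span"
proof -
  have *: "\<pi> p \<in> string_span" for p
    using free_on_UNIV[of p]
  proof (induction rule: free_on_induct)
    case (single b c)
    have "Poly_Mapping.single b c \<in> homog (fst b + snd b)" by (cases b) (simp add: homog_def)
    then show ?case by (rule \<pi>_homog_in_span)
  qed (simp_all add: module_hom.zero[OF lin_maps(1)] module_hom.add[OF lin_maps(1)]
      string_span_def free.span_zero free.span_add)
  show ?thesis by (rule subset_trans[OF \<pi>_range(1)]) (use * in auto)
qed

text \<open>The family spans and has \<open>card B\<close> members; the total length n t of the
  strings enters through \<open>card_strings\<close>.\<close>

lemma vec_independent:
  assumes "(\<Sum>(d, k)\<in>strings. scale (c d k) (vec d k)) = 0" "(d, k) \<in> strings"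
  shows "c d k = 0"
proof -
  have "(\<Sum>\<kappa>\<in>strings. scale ((\<lambda>(d, k). c d k) \<kappa>) ((\<lambda>(d, k). vec d k) \<kappa>)) = 0"
    using assms(1) by (simp add: case_prod_unfold)
  from spanning_family_independent[OF finite_strings B(1) _ basis_in_span[unfolded string_span_def] this assms(2)]
  show ?thesis by (simp add: card_strings)
qed

definition assemble :: "(nat \<times> nat \<Rightarrow> (nat \<Rightarrow>\<^sub>0 'a)) \<Rightarrow> ('b \<Rightarrow>\<^sub>0 'a)" where
  "assemble x = (\<Sum>d\<in>starts. lin_ext (vec d) (x d))"

abbreviation "strmod \<equiv> direct_sum starts (\<lambda>(i, j). V \<chi> (plen i j) (\<psi> j))"

lemma carrier_strmod: "carrier strmod = (\<Pi>\<^sub>E (i, j)\<in>starts. free_on {..<plen i j})"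
  unfolding direct_sum_simps(1)[OF finite_starts] by (intro PiE_cong) (auto simp: V_simps)

lemma assemble_eq:
  assumes "x \<in> carrier strmod"
  shows "assemble x = (\<Sum>(d, k)\<in>strings. scale (Poly_Mapping.lookup (x d) k) (vec d k))"
proof -
  have "lin_ext (vec d) (x d) = (\<Sum>k\<in>(case d of (i, j) \<Rightarrow> {..<plen i j}). scale (Poly_Mapping.lookup (x d) k) (vec d k))"
    if "d \<in> starts" for d
    using assms that unfolding carrier_strmod
    by (cases d) (auto intro!: lin_ext_superset simp: PiE_iff free_on_def)
  then have "assemble x = (\<Sum>d\<in>starts. \<Sum>k\<in>(case d of (i, j) \<Rightarrow> {..<plen i j}). scale (Poly_Mapping.lookup (x d) k) (vec d k))"
    by (simp add: assemble_def)
  then show ?thesis unfolding strings_def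
    by (subst (asm) sum.Sigma) (auto simp: finite_starts)
qed

lemma inj_assemble: "inj_on assemble (carrier strmod)"
proof (rule inj_onI)
  fix x y assume x: "x \<in> carrier strmod" and y: "y \<in> carrier strmod" and eq: "assemble x = assemble y"
  have "(\<Sum>(d, k)\<in>strings. scale (Poly_Mapping.lookup (x d) k - Poly_Mapping.lookup (y d) k) (vec d k)) = assemble x - assemble y"
    unfolding assemble_eq[OF x] assemble_eq[OF y] sum_subtractf[symmetric]
    by (intro sum.cong) (auto simp: free.scale_left_diff_distrib)
  then have *: "(\<Sum>(d, k)\<in>strings. scale (Poly_Mapping.lookup (x d) k - Poly_Mapping.lookup (y d) k) (vec d k)) = 0"
    using eq by simp
  have same: "x (i, j) = y (i, j)" if "(i, j) \<in> starts" for i j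
  proof (rule poly_mapping_eqI)
    fix k
    show "Poly_Mapping.lookup (x (i, j)) k = Poly_Mapping.lookup (y (i, j)) k"
    proof (cases "k < plen i j")
      case True
      then show ?thesis using vec_independent[OF *, of "(i, j)" k] that by (simp add: strings_def)
    next
      case False
      have "x (i, j) \<in> free_on {..<plen i j}" "y (i, j) \<in> free_on {..<plen i j}"
        using x y that unfolding carrier_strmod by (auto simp: PiE_iff)
      then have "Poly_Mapping.lookup (x (i, j)) k = 0" "Poly_Mapping.lookup (y (i, j)) k = 0"
        using False unfolding free_on_iff by blast+
      then show ?thesis by simp
    qed
  qed
  show "x = y"
    using x y same unfolding carrier_strmod by (intro PiE_ext[of x starts _ y]) auto
qed

lemma assemble_image: "assemble ` carrier strmod = free_on B"
proof
  have "vec d k \<in> free_on B" for d k by (simp add: vec_eq \<pi>_range)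
  then have "lin_ext (vec d) p \<in> free_on B" for d p
    using lin_ext_closed[OF free_on_UNIV[of p]] by blast
  then show "assemble ` carrier strmod \<subseteq> free_on B"
    unfolding assemble_def by (auto intro!: free.subspace_sum[OF free_on_subspace])
  have sub: "free.subspace (assemble ` carrier strmod)"
  proof (rule free.subspaceI)
    have "(\<lambda>d\<in>starts. 0) \<in> carrier strmod" "assemble (\<lambda>d\<in>starts. 0) = 0"
      by (auto simp: carrier_strmod assemble_def)
    then show "0 \<in> assemble ` carrier strmod" by force
  next
    fix u v assume "u \<in> assemble ` carrier strmod" "v \<in> assemble ` carrier strmod"
    then obtain x y where xy: "x \<in> carrier strmod" "y \<in> carrier strmod" "u = assemble x" "v = assemble y" by blast
    have "(\<lambda>d\<in>starts. x d + y d) \<in> carrier strmod" using xy(1,2) by (auto simp: carrier_strmod PiE_iff)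
    moreover have "assemble (\<lambda>d\<in>starts. x d + y d) = u + v"
      by (simp add: assemble_def xy lin_ext_add sum.distrib)
    ultimately show "u + v \<in> assemble ` carrier strmod" by force
  next
    fix c u assume "u \<in> assemble ` carrier strmod"
    then obtain x where x: "x \<in> carrier strmod" "u = assemble x" by blast
    have "(\<lambda>d\<in>starts. scale c (x d)) \<in> carrier strmod" using x(1) by (auto simp: carrier_strmod PiE_iff)
    moreover have "assemble (\<lambda>d\<in>starts. scale c (x d)) = scale c u"
      by (simp add: assemble_def x lin_ext_scale free.scale_sum_right)
    ultimately show "scale c u \<in> assemble ` carrier strmod" by force
  qed
  have "vec d k \<in> assemble ` carrier strmod" if "(d, k) \<in> strings" for d k
  proof -
    let ?x = "\<lambda>d'\<in>starts. if d' = d then basis_vec k else 0"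
    have "?x \<in> carrier strmod" using that by (auto simp: carrier_strmod strings_def)
    moreover have "assemble ?x = vec d k"
    proof -
      have "assemble ?x = (\<Sum>d'\<in>starts. if d' = d then vec d k else 0)"
        unfolding assemble_def by (intro sum.cong) auto
      then show ?thesis using that by (auto simp: strings_def finite_starts)
    qed
    ultimately show ?thesis by force
  qed
  then have "string_span \<subseteq> assemble ` carrier strmod"
    unfolding string_span_def by (intro free.span_minimal sub) auto
  then have sp: "basis_vec ` B \<subseteq> assemble ` carrier strmod" using basis_in_span by blast
  show "free_on B \<subseteq> assemble ` carrier strmod"
  proof
    fix p :: "'b \<Rightarrow>\<^sub>0 'a" assume "p \<in> free_on B"
    then show "p \<in> assemble ` carrier strmod"
    proof (induction rule: free_on_induct)
      case (single b c)
      have "scale c (basis_vec b) \<in> assemble ` carrier strmod"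
        using single sp by (intro free.subspace_scale[OF sub]) auto
      then show ?case by (simp add: scale_single)
    qed (simp_all add: free.subspace_0[OF sub] free.subspace_add[OF sub])
  qed
qed

text \<open>x moves along the string and stops because \<open>vec\<close> vanishes from
  \<open>plen i j\<close> on. The character of g at position k is \<chi>^(i s + j + k) \<nu>; as
  \<chi>^s = 1, the row i drops out and only \<psi> j is left.\<close>

lemma lin_ext_vec_smult:
  assumes ij: "(i, j) \<in> starts" and h: "h \<in> free_on (carrier G \<times> UNIV)" and x: "x \<in> free_on {..<plen i j}"
  shows "lin_ext (vec (i, j)) (h \<odot>\<^bsub>V \<chi> (plen i j) (\<psi> j)\<^esub> x) = h \<odot>\<^bsub>emod B zE gE\<^esub> lin_ext (vec (i, j)) x"
proof (rule lin_eq_on_free[OF _ _ _ h])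
  show "lin (\<lambda>h. lin_ext (vec (i, j)) (h \<odot>\<^bsub>V \<chi> (plen i j) (\<psi> j)\<^esub> x))"
    by (rule lin_compose[OF lin_lin_ext lin_V_smult(1)])
  show "lin (\<lambda>h. h \<odot>\<^bsub>emod B zE gE\<^esub> lin_ext (vec (i, j)) x)"
    by (simp add: emod_def lin_bilin_ext_left)
  fix b :: "'g \<times> nat" assume "b \<in> carrier G \<times> UNIV"
  then obtain g m where b: "b = (g, m)" "g \<in> carrier G" by auto
  show "lin_ext (vec (i, j)) (basis_vec b \<odot>\<^bsub>V \<chi> (plen i j) (\<psi> j)\<^esub> x) =
      basis_vec b \<odot>\<^bsub>emod B zE gE\<^esub> lin_ext (vec (i, j)) x"
  proof (rule lin_eq_on_free[OF _ _ _ x])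
    show "lin (\<lambda>x. lin_ext (vec (i, j)) (basis_vec b \<odot>\<^bsub>V \<chi> (plen i j) (\<psi> j)\<^esub> x))"
      by (rule lin_compose[OF lin_lin_ext lin_V_smult(2)])
    show "lin (\<lambda>x. basis_vec b \<odot>\<^bsub>emod B zE gE\<^esub> lin_ext (vec (i, j)) x)"
      by (rule lin_compose[OF _ lin_lin_ext]) (simp add: emod_def lin_bilin_ext_right del: bilin_ext_single_left)
    fix k assume "k \<in> {..<plen i j}"
    then have k: "k < plen i j" by simp
    have "gE g (vec (i, j) (k + m)) = scale (\<chi> g ^ (i * s + j + (k + m)) * \<nu> g) (vec (i, j) (k + m))"
      unfolding vec_eq by (rule \<pi>_homog[OF b(2) qz_pow_homog[OF gen(1)[OF ij]]])
    also have "\<chi> g ^ (i * s + j + (k + m)) * \<nu> g = \<chi> g ^ (k + m) * \<psi> j g"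
      using \<chi>_pow[OF b(2)] by (simp add: power_add power_mult mult.commute[of i] \<psi>_eq[OF b(2)])
    finally have g: "gE g (vec (i, j) (k + m)) = scale (\<chi> g ^ (k + m) * \<psi> j g) (vec (i, j) (k + m))" .
    show "lin_ext (vec (i, j)) (basis_vec b \<odot>\<^bsub>V \<chi> (plen i j) (\<psi> j)\<^esub> basis_vec k) =
        basis_vec b \<odot>\<^bsub>emod B zE gE\<^esub> lin_ext (vec (i, j)) (basis_vec k)"
      using vec_zero[OF ij, of "k + m"]
      unfolding b(1) V_smult_basis[OF k] emod_smult_basis[OF lin_maps(2,3)] by (simp add: zE_vec g)
  qed
qed

theorem strmod_iso: "left_module_iso (hopf_ring G \<eta>) strmod (emod B zE gE)"
proof (rule left_module_transport[where f = assemble])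
  show "left_module (hopf_ring G \<eta>) strmod"
    using left_module_V[OF group \<chi> \<psi> \<eta> \<eta>\<chi>]
    by (intro left_module_direct_sum ring_hopf_ring group \<eta> finite_starts) auto
  show "bij_betw assemble (carrier strmod) (carrier (emod B zE gE))"
    using inj_assemble assemble_image by (simp add: bij_betw_def emod_def)
  show "assemble \<zero>\<^bsub>strmod\<^esub> = \<zero>\<^bsub>emod B zE gE\<^esub>"
    by (auto simp: assemble_def direct_sum_simps V_simps emod_def case_prod_unfold)
next
  fix x y
  have "(x \<oplus>\<^bsub>strmod\<^esub> y) d = x d + y d" if "d \<in> starts" for d
    using that by (cases d) (simp add: direct_sum_simps V_simps)
  then show "assemble (x \<oplus>\<^bsub>strmod\<^esub> y) = assemble x \<oplus>\<^bsub>emod B zE gE\<^esub> assemble y"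
    by (simp add: assemble_def lin_ext_add sum.distrib emod_def)
next
  fix h x assume h: "h \<in> carrier (hopf_ring G \<eta>)" and x: "x \<in> carrier strmod"
  have "lin_ext (vec d) ((h \<odot>\<^bsub>strmod\<^esub> x) d) = h \<odot>\<^bsub>emod B zE gE\<^esub> lin_ext (vec d) (x d)" if d: "d \<in> starts" for d
  proof -
    obtain i j where ij: "d = (i, j)" by (cases d)
    have "x (i, j) \<in> free_on {..<plen i j}" using x d ij unfolding carrier_strmod by (auto simp: PiE_iff)
    then show ?thesis using lin_ext_vec_smult[of i j h "x d"] h d
      by (simp add: ij direct_sum_simps hopf_ring_def)
  qed
  moreover have "h \<odot>\<^bsub>emod B zE gE\<^esub> (\<Sum>d\<in>starts. f d) = (\<Sum>d\<in>starts. h \<odot>\<^bsub>emod B zE gE\<^esub> f d)" for f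
    unfolding emod_def module.simps by (rule module_hom.sum[OF lin_bilin_ext_right])
  ultimately show "assemble (h \<odot>\<^bsub>strmod\<^esub> x) = h \<odot>\<^bsub>emod B zE gE\<^esub> assemble x"
    by (simp add: assemble_def)
qed

end

section \<open>The tensor product in coordinates\<close>

locale tensor_V =
  fixes G :: "('g, 'z) monoid_scheme" and \<chi> \<eta> \<mu> \<sigma> :: "'g \<Rightarrow> 'k::field" and a :: 'g and n t :: nat
  assumes group: "group G" and \<chi>: "\<chi> \<in> carrier (char_group G)" and \<mu>: "\<mu> \<in> carrier (char_group G)"
    and \<sigma>: "\<sigma> \<in> carrier (char_group G)" and \<eta>: "\<eta> \<in> carrier (char_group G)"
    and \<eta>\<chi>: "g \<in> carrier G \<Longrightarrow> \<eta> g * \<chi> g = 1" and a: "a \<in> carrier G"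
begin

sublocale group G by (rule group)

abbreviation "M \<equiv> V \<chi> n \<mu>"
abbreviation "N \<equiv> V \<chi> t \<sigma>"
abbreviation "H2 \<equiv> hopf2_ring G \<eta>"
abbreviation "GN \<equiv> carrier G \<times> (UNIV :: nat set)"
abbreviation "pairs \<equiv> free_on {..<n} \<times> free_on {..<t} :: ((nat \<Rightarrow>\<^sub>0 'k) \<times> (nat \<Rightarrow>\<^sub>0 'k)) set"
abbreviation "rels \<equiv> tensor_rels G M N"

lemmas char_1 = char_one[OF group \<chi>] char_one[OF group \<mu>] char_one[OF group \<sigma>]

lemma left_module_M: "left_module (hopf_ring G \<eta>) M" and left_module_N: "left_module (hopf_ring G \<eta>) N"
  using left_module_V[OF group \<chi> _ \<eta> \<eta>\<chi>] \<mu> \<sigma> by blast+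

text \<open>The action of x \<otimes> a + 1 \<otimes> x, in which a scales m_j of the second factor
  by \<chi>(a)^j \<sigma>(a).\<close>

definition zT :: "(nat \<times> nat \<Rightarrow>\<^sub>0 'k) \<Rightarrow> (nat \<times> nat \<Rightarrow>\<^sub>0 'k)" where
  "zT = lin_ext (\<lambda>(i, j). (if Suc i < n then Poly_Mapping.single (Suc i, j) (\<chi> a ^ j * \<sigma> a) else 0) +
     (if Suc j < t then basis_vec (i, Suc j) else 0))"

definition gT :: "'g \<Rightarrow> (nat \<times> nat \<Rightarrow>\<^sub>0 'k) \<Rightarrow> (nat \<times> nat \<Rightarrow>\<^sub>0 'k)" where
  "gT g = lin_ext (\<lambda>(i, j). Poly_Mapping.single (i, j) (\<chi> g ^ (i + j) * (\<mu> g * \<sigma> g)))"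

definition tp :: "(nat \<Rightarrow>\<^sub>0 'k) \<Rightarrow> (nat \<Rightarrow>\<^sub>0 'k) \<Rightarrow> (nat \<times> nat \<Rightarrow>\<^sub>0 'k)" where
  "tp = bilin_ext (\<lambda>i j. basis_vec (i, j))"

definition evT :: "((nat \<Rightarrow>\<^sub>0 'k) \<times> (nat \<Rightarrow>\<^sub>0 'k) \<Rightarrow>\<^sub>0 'k) \<Rightarrow> (nat \<times> nat \<Rightarrow>\<^sub>0 'k)" where
  "evT = lin_ext (\<lambda>(u, v). tp u v)"

text \<open>A section of \<open>evT\<close>. The quotient is identified with coordinates by showing
  that \<open>sec\<close> after \<open>evT\<close> is the identity modulo the relations.\<close>

definition sec :: "(nat \<times> nat \<Rightarrow>\<^sub>0 'k) \<Rightarrow> ((nat \<Rightarrow>\<^sub>0 'k) \<times> (nat \<Rightarrow>\<^sub>0 'k) \<Rightarrow>\<^sub>0 'k)" where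
  "sec = lin_ext (\<lambda>(i, j). basis_vec (basis_vec i, basis_vec j))"

definition act2 :: "('g, 'k) hopf2 \<Rightarrow> (nat \<times> nat \<Rightarrow>\<^sub>0 'k) \<Rightarrow> (nat \<times> nat \<Rightarrow>\<^sub>0 'k)" where
  "act2 = bilin_ext (\<lambda>(b, c) (i, j). tp (basis_vec b \<odot>\<^bsub>M\<^esub> basis_vec i) (basis_vec c \<odot>\<^bsub>N\<^esub> basis_vec j))"

lemma lin_maps: "lin zT" "lin (gT g)" "lin evT" "lin sec" "lin (tp u)" "lin (\<lambda>u. tp u v)"
    "lin (act2 D)" "lin (\<lambda>D. act2 D e)"
  by (simp_all add: zT_def gT_def evT_def sec_def tp_def act2_def lin_lin_ext
      lin_bilin_ext_left lin_bilin_ext_right)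

lemma smult_scalar_M: "u \<in> free_on {..<n} \<Longrightarrow> Poly_Mapping.single (\<one>\<^bsub>G\<^esub>, 0) c \<odot>\<^bsub>M\<^esub> u = scale c u"
  and smult_scalar_N: "v \<in> free_on {..<t} \<Longrightarrow> Poly_Mapping.single (\<one>\<^bsub>G\<^esub>, 0) c \<odot>\<^bsub>N\<^esub> v = scale c v"
proof -
  have *: "Poly_Mapping.single (\<one>\<^bsub>G\<^esub>, 0) c = scale c (basis_vec (\<one>\<^bsub>G\<^esub>, 0 :: nat))"
    by (simp add: scale_single)
  show "u \<in> free_on {..<n} \<Longrightarrow> Poly_Mapping.single (\<one>\<^bsub>G\<^esub>, 0) c \<odot>\<^bsub>M\<^esub> u = scale c u"
    unfolding * module_hom.scale[OF lin_V_smult(1)]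
    using left_module.smult_one[OF left_module_M, of u] by (simp add: hopf_ring_def V_simps)
  show "v \<in> free_on {..<t} \<Longrightarrow> Poly_Mapping.single (\<one>\<^bsub>G\<^esub>, 0) c \<odot>\<^bsub>N\<^esub> v = scale c v"
    unfolding * module_hom.scale[OF lin_V_smult(1)]
    using left_module.smult_one[OF left_module_N, of v] by (simp add: hopf_ring_def V_simps)
qed

lemma tensor_rels_eq: "rels =
     {basis_vec (u + u', v) - basis_vec (u, v) - basis_vec (u', v) | u u' v.
        u \<in> free_on {..<n} \<and> u' \<in> free_on {..<n} \<and> v \<in> free_on {..<t}} \<union>
     {basis_vec (u, v + v') - basis_vec (u, v) - basis_vec (u, v') | u v v'.
        u \<in> free_on {..<n} \<and> v \<in> free_on {..<t} \<and> v' \<in> free_on {..<t}} \<union>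
     {basis_vec (scale c u, v) - scale c (basis_vec (u, v)) | c u v.
        u \<in> free_on {..<n} \<and> v \<in> free_on {..<t}} \<union>
     {basis_vec (u, scale c v) - scale c (basis_vec (u, v)) | c u v.
        u \<in> free_on {..<n} \<and> v \<in> free_on {..<t}}"
proof -
  have 1: "{basis_vec (Poly_Mapping.single (\<one>\<^bsub>G\<^esub>, 0) c \<odot>\<^bsub>M\<^esub> u, v) - scale c (basis_vec (u, v)) | c u v.
        u \<in> free_on {..<n} \<and> v \<in> free_on {..<t}} =
      {basis_vec (scale c u, v) - scale c (basis_vec (u, v)) | c u v.
        u \<in> free_on {..<n} \<and> v \<in> free_on {..<t}}"
    by (intro Collect_cong iff_exI rev_conj_cong refl) (auto simp: smult_scalar_M)
  have 2: "{basis_vec (u, Poly_Mapping.single (\<one>\<^bsub>G\<^esub>, 0) c \<odot>\<^bsub>N\<^esub> v) - scale c (basis_vec (u, v)) | c u v.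
        u \<in> free_on {..<n} \<and> v \<in> free_on {..<t}} =
      {basis_vec (u, scale c v) - scale c (basis_vec (u, v)) | c u v.
        u \<in> free_on {..<n} \<and> v \<in> free_on {..<t}}"
    by (intro Collect_cong iff_exI rev_conj_cong refl) (auto simp: smult_scalar_N)
  show ?thesis unfolding tensor_rels_def V_simps 1 2 ..
qed

lemma rels_closed: "free.span rels \<subseteq> free_on pairs"
  by (rule free.span_minimal[OF _ free_on_subspace])
    (auto simp: tensor_rels_eq scale_single free_on_scale intro!: free_on_diff)

lemma rels_span:
  assumes "u \<in> free_on {..<n}" "v \<in> free_on {..<t}"
  shows "u' \<in> free_on {..<n} \<Longrightarrow> basis_vec (u + u', v) - basis_vec (u, v) - basis_vec (u', v) \<in> free.span rels"
    and "v' \<in> free_on {..<t} \<Longrightarrow> basis_vec (u, v + v') - basis_vec (u, v) - basis_vec (u, v') \<in> free.span rels"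
    and "basis_vec (scale c u, v) - scale c (basis_vec (u, v)) \<in> free.span rels"
    and "basis_vec (u, scale c v) - scale c (basis_vec (u, v)) \<in> free.span rels"
  using assms by (intro free.span_base; unfold tensor_rels_eq; blast)+

lemma evT_basis: "evT (basis_vec (u, v)) = tp u v"
  by (simp add: evT_def)

lemma evT_rels: "z \<in> free.span rels \<Longrightarrow> evT z = 0"
proof -
  assume z: "z \<in> free.span rels"
  have "free.span rels \<subseteq> {z. evT z = 0}"
  proof (rule free.span_minimal)
    show "rels \<subseteq> {z. evT z = 0}"
      by (auto simp: tensor_rels_eq module_hom.diff[OF lin_maps(3)] module_hom.scale[OF lin_maps(3)] evT_basis
          module_hom.add[OF lin_maps(5)] module_hom.add[OF lin_maps(6)]
          module_hom.scale[OF lin_maps(5)] module_hom.scale[OF lin_maps(6)])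
    show "free.subspace {z. evT z = 0}"
      by (rule free.subspaceI)
        (simp_all add: module_hom.add[OF lin_maps(3)] module_hom.scale[OF lin_maps(3)] module_hom.zero[OF lin_maps(3)])
  qed
  then show ?thesis using z by blast
qed

lemma sec_basis: "sec (basis_vec (i, j)) = basis_vec (basis_vec i, basis_vec j)"
  by (simp add: sec_def)

lemma tp_basis: "tp (basis_vec i) (basis_vec j) = basis_vec (i, j)"
  by (simp add: tp_def)

lemma evT_sec: "evT (sec e) = e"
proof -
  have "(\<lambda>e. evT (sec e)) = (\<lambda>e. e)"
    by (rule lin_eqI[OF lin_compose[OF lin_maps(3,4)] lin_id(2)])
      (auto simp: sec_basis evT_basis tp_basis)
  then show ?thesis by meson
qed

lemma basis_pair_cong:
  assumes u: "u \<in> free_on {..<n}" and v: "v \<in> free_on {..<t}"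
  shows "basis_vec (u, v) - sec (tp u v) \<in> free.span rels"
  using u
proof (induction rule: free_on_induct)
  case (single i c)
  note i = single
  show ?case using v
  proof (induction rule: free_on_induct)
    case (single j d)
    have e: "Poly_Mapping.single i c = scale c (basis_vec i)" "Poly_Mapping.single j d = scale d (basis_vec j)"
      by (simp_all add: scale_single)
    have r1: "basis_vec (scale c (basis_vec i), scale d (basis_vec j)) - scale c (basis_vec (basis_vec i, scale d (basis_vec j)))
        \<in> free.span rels"
      by (rule rels_span) (use i single in \<open>auto simp: scale_single\<close>)
    have "basis_vec (basis_vec i, scale d (basis_vec j)) - scale d (basis_vec (basis_vec i, basis_vec j))
        \<in> free.span rels"
      by (rule rels_span) (use i single in \<open>auto simp: scale_single\<close>)
    then have "scale c (basis_vec (basis_vec i, scale d (basis_vec j)) - scale d (basis_vec (basis_vec i, basis_vec j)))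
        \<in> free.span rels"
      by (rule free.span_scale)
    from free.span_add[OF r1 this]
    have "basis_vec (scale c (basis_vec i), scale d (basis_vec j)) - scale (c * d) (basis_vec (basis_vec i, basis_vec j))
        \<in> free.span rels"
      by (simp add: free.scale_right_diff_distrib)
    moreover have "sec (tp (scale c (basis_vec i)) (scale d (basis_vec j))) =
        scale (c * d) (basis_vec (basis_vec i, basis_vec j))"
      by (simp only: module_hom.scale[OF lin_maps(5)] module_hom.scale[OF lin_maps(6)]
          module_hom.scale[OF lin_maps(4)] tp_basis sec_basis free.scale_scale mult.commute)
    ultimately show ?case unfolding e by simp
  next
    \<comment> \<open>The zero vector: the additivity relation for 0 + 0 is minus the pair
      itself.\<close>
    case add
    have "basis_vec (Poly_Mapping.single i c, 0 + 0) - basis_vec (Poly_Mapping.single i c, 0) -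
        basis_vec (Poly_Mapping.single i c, 0) \<in> free.span rels"
      by (rule rels_span) (use i in auto)
    from free.span_neg[OF this] show ?case
      by (simp add: module_hom.zero[OF lin_maps(5)] module_hom.zero[OF lin_maps(4)])
  next
    fix p q assume pq: "p \<in> free_on {..<t}" "q \<in> free_on {..<t}"
      and IH: "basis_vec (Poly_Mapping.single i c, p) - sec (tp (Poly_Mapping.single i c) p) \<in> free.span rels"
        "basis_vec (Poly_Mapping.single i c, q) - sec (tp (Poly_Mapping.single i c) q) \<in> free.span rels"
    have "basis_vec (Poly_Mapping.single i c, p + q) - basis_vec (Poly_Mapping.single i c, p) -
        basis_vec (Poly_Mapping.single i c, q) \<in> free.span rels"
      by (rule rels_span) (use i pq in auto)
    from free.span_add[OF this free.span_add[OF IH]]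
    show "basis_vec (Poly_Mapping.single i c, p + q) - sec (tp (Poly_Mapping.single i c) (p + q)) \<in> free.span rels"
      by (simp add: module_hom.add[OF lin_maps(5)] module_hom.add[OF lin_maps(4)] algebra_simps)
  qed
next
  case add
  have "basis_vec (0 + 0, v) - basis_vec (0, v) - basis_vec (0, v) \<in> free.span rels"
    by (rule rels_span) (use v in auto)
  from free.span_neg[OF this] show ?case
    by (simp add: module_hom.zero[OF lin_maps(6)] module_hom.zero[OF lin_maps(4)])
next
  fix p q assume pq: "p \<in> free_on {..<n}" "q \<in> free_on {..<n}"
    and IH: "basis_vec (p, v) - sec (tp p v) \<in> free.span rels" "basis_vec (q, v) - sec (tp q v) \<in> free.span rels"
  have "basis_vec (p + q, v) - basis_vec (p, v) - basis_vec (q, v) \<in> free.span rels"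
    by (rule rels_span) (use v pq in auto)
  from free.span_add[OF this free.span_add[OF IH]]
  show "basis_vec (p + q, v) - sec (tp (p + q) v) \<in> free.span rels"
    by (simp add: module_hom.add[OF lin_maps(6)] module_hom.add[OF lin_maps(4)] algebra_simps)
qed

lemma sec_evT_cong: "p \<in> free_on pairs \<Longrightarrow> p - sec (evT p) \<in> free.span rels"
proof (induction rule: free_on_induct)
  case (single b c)
  obtain u v where b: "b = (u, v)" by (cases b)
  have "scale c (basis_vec (u, v) - sec (tp u v)) \<in> free.span rels"
    using single b by (intro free.span_scale basis_pair_cong) auto
  also have "scale c (basis_vec (u, v) - sec (tp u v)) = scale c (basis_vec (u, v)) - sec (evT (scale c (basis_vec (u, v))))"
    by (simp only: module_hom.scale[OF lin_maps(3)] module_hom.scale[OF lin_maps(4)] evT_basis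
        free.scale_right_diff_distrib)
  finally show ?case by (simp add: scale_single b)
next
  case add
  show ?case by (simp add: module_hom.zero[OF lin_maps(3)] module_hom.zero[OF lin_maps(4)] free.span_zero)
next
  fix p q assume "p - sec (evT p) \<in> free.span rels" "q - sec (evT q) \<in> free.span rels"
  from free.span_add[OF this] show "p + q - sec (evT (p + q)) \<in> free.span rels"
    by (simp add: module_hom.add[OF lin_maps(3)] module_hom.add[OF lin_maps(4)] algebra_simps)
qed

section \<open>The action of H on coordinates\<close>

lemma act2_tp: "act2 (basis_vec (b, c)) (tp u v) = tp (basis_vec b \<odot>\<^bsub>M\<^esub> u) (basis_vec c \<odot>\<^bsub>N\<^esub> v)"
proof (rule bilin_eqI[where g = "\<lambda>u v. tp (basis_vec b \<odot>\<^bsub>M\<^esub> u) (basis_vec c \<odot>\<^bsub>N\<^esub> v)"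
      and f = "\<lambda>u v. act2 (basis_vec (b, c)) (tp u v)"])
  fix i j
  show "act2 (basis_vec (b, c)) (tp (basis_vec i) (basis_vec j)) =
      tp (basis_vec b \<odot>\<^bsub>M\<^esub> basis_vec i) (basis_vec c \<odot>\<^bsub>N\<^esub> basis_vec j)"
    by (simp add: tp_basis act2_def)
qed (rule lin_compose[OF lin_maps(6) lin_V_smult(2)] lin_compose[OF lin_maps(5) lin_V_smult(2)]
    lin_compose[OF lin_maps(7) lin_maps(5)] lin_compose[OF lin_maps(7) lin_maps(6)])+

lemma evT_act: "evT (tensor_act G \<eta> a M N h p) = act2 (comult G \<eta> a h) (evT p)"
proof -
  let ?f = "\<lambda>(b, c) (u, v). basis_vec (basis_vec b \<odot>\<^bsub>M\<^esub> u, basis_vec c \<odot>\<^bsub>N\<^esub> v)"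
  have "evT (bilin_ext ?f D p) = act2 D (evT p)" for D :: "('g, 'k) hopf2"
  proof (rule bilin_eqI[where f = "\<lambda>D p. evT (bilin_ext ?f D p)" and g = "\<lambda>D p. act2 D (evT p)"])
    fix x :: "('g \<times> nat) \<times> ('g \<times> nat)" and y :: "(nat \<Rightarrow>\<^sub>0 'k) \<times> (nat \<Rightarrow>\<^sub>0 'k)"
    show "evT (bilin_ext ?f (basis_vec x) (basis_vec y)) = act2 (basis_vec x) (evT (basis_vec y))"
      by (cases x; cases y) (simp add: evT_basis act2_tp)
  qed (rule lin_compose[OF lin_maps(3) lin_bilin_ext_left] lin_compose[OF lin_maps(3) lin_bilin_ext_right]
      lin_maps(8) lin_compose[OF lin_maps(7,3)])+
  then show ?thesis by (simp add: tensor_act_def)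
qed

abbreviation "E \<equiv> free_on ({..<n} \<times> {..<t}) :: (nat \<times> nat \<Rightarrow>\<^sub>0 'k) set"

lemma zT_closed: "e \<in> E \<Longrightarrow> (zT ^^ m) e \<in> E"
proof (induction m)
  case (Suc m)
  have "zT ((zT ^^ m) e) \<in> E"
    by (rule lin_closed_on_free[OF lin_maps(1) _ Suc.IH[OF Suc.prems]]) (auto simp: zT_def)
  then show ?case by simp
qed simp

lemma tp_single: "tp (Poly_Mapping.single i c) (Poly_Mapping.single j d) = Poly_Mapping.single (i, j) (c * d)"
  by (simp add: tp_def scale_single)

lemma act2_g:
  assumes "e \<in> E"
  shows "act2 (basis_vec ((g, 0), (g, 0))) e = gT g e"
proof (rule lin_eq_on_free[OF lin_maps(7,2) _ assms], clarify)
  fix i j assume "i < n" "j < t"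
  then show "act2 (basis_vec ((g, 0), (g, 0))) (basis_vec (i, j)) = gT g (basis_vec (i, j))"
    unfolding tp_basis[symmetric] act2_tp
    by (simp add: V_smult_basis tp_single gT_def tp_basis scale_single power_add mult_ac)
qed

lemma act2_x:
  assumes "e \<in> E"
  shows "act2 (basis_vec ((\<one>\<^bsub>G\<^esub>, 1), (a, 0)) + basis_vec ((\<one>\<^bsub>G\<^esub>, 0), (\<one>\<^bsub>G\<^esub>, 1))) e = zT e"
proof (rule lin_eq_on_free[OF lin_maps(7,1) _ assms], clarify)
  fix i j assume "i < n" "j < t"
  then show "act2 (basis_vec ((\<one>\<^bsub>G\<^esub>, 1), (a, 0)) + basis_vec ((\<one>\<^bsub>G\<^esub>, 0), (\<one>\<^bsub>G\<^esub>, 1))) (basis_vec (i, j)) = zT (basis_vec (i, j))"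
    unfolding tp_basis[symmetric] module_hom.add[OF lin_maps(8)] act2_tp
    by (simp add: V_smult_basis tp_single zT_def tp_basis scale_single char_1
        module_hom.zero[OF lin_maps(5)] module_hom.zero[OF lin_maps(6)])
qed

text \<open>Both factors are modules, and a product of two basis elements of H is a multiple of one
  basis element; so the law can be checked in each factor.\<close>

lemma act2_mult:
  assumes "D \<in> carrier H2" "D' \<in> carrier H2" "e \<in> E"
  shows "act2 (D \<otimes>\<^bsub>H2\<^esub> D') e = act2 D (act2 D' e)"
  unfolding act2_def hopf2_ring_def monoid.simps
proof (rule bilin_assoc[of _ "GN \<times> GN" _ "GN \<times> GN" _ "{..<n} \<times> {..<t}"], goal_cases)
  case (4 x y z)
  obtain x1 x2 y1 y2 i j where xyz: "x = (x1, x2)" "y = (y1, y2)" "z = (i, j)" by (cases x; cases y; cases z) blast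
  have assoc: "mult_basis G \<eta> b b' \<odot>\<^bsub>V \<chi> p \<psi>\<^esub> basis_vec k = basis_vec b \<odot>\<^bsub>V \<chi> p \<psi>\<^esub> (basis_vec b' \<odot>\<^bsub>V \<chi> p \<psi>\<^esub> basis_vec k)"
    if "b \<in> GN" "b' \<in> GN" "k < p" "\<psi> \<in> carrier (char_group G)" for b b' :: "'g \<times> nat" and k p \<psi>
    using left_module.smult_assoc1[OF left_module_V[OF group \<chi> that(4) \<eta> \<eta>\<chi>], of "basis_vec b" "basis_vec b'" "basis_vec k" p] that
    by (simp add: hopf_ring_def V_simps)
  obtain b c b' c' where mb: "mult_basis G \<eta> x1 y1 = Poly_Mapping.single b c"
      "mult_basis G \<eta> x2 y2 = Poly_Mapping.single b' c'"
    by (cases x1; cases y1; cases x2; cases y2) (simp add: mult_basis_def)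
  have sc: "Poly_Mapping.single b c = scale c (basis_vec b)" "Poly_Mapping.single b' c' = scale c' (basis_vec b')"
    by (simp_all add: scale_single)
  have "act2 (pure (mult_basis G \<eta> x1 y1) (mult_basis G \<eta> x2 y2)) (basis_vec (i, j)) =
      tp (mult_basis G \<eta> x1 y1 \<odot>\<^bsub>M\<^esub> basis_vec i) (mult_basis G \<eta> x2 y2 \<odot>\<^bsub>N\<^esub> basis_vec j)"
    unfolding mb sc module_hom.scale[OF lin_V_smult(1)] module_hom.scale[OF lin_maps(5)]
      module_hom.scale[OF lin_maps(6)] act2_tp[symmetric] tp_basis
    by (simp add: pure_def bilin_ext_scale_left bilin_ext_scale_right act2_def del: bilin_ext_single_left)
  also have "\<dots> = tp (basis_vec x1 \<odot>\<^bsub>M\<^esub> (basis_vec y1 \<odot>\<^bsub>M\<^esub> basis_vec i)) (basis_vec x2 \<odot>\<^bsub>N\<^esub> (basis_vec y2 \<odot>\<^bsub>N\<^esub> basis_vec j))"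
    using 4 \<mu> \<sigma> unfolding xyz by (simp add: assoc)
  also have "\<dots> = act2 (basis_vec x) (tp (basis_vec y1 \<odot>\<^bsub>M\<^esub> basis_vec i) (basis_vec y2 \<odot>\<^bsub>N\<^esub> basis_vec j))"
    by (simp add: xyz act2_tp)
  finally show ?case by (simp add: xyz act2_def del: bilin_ext_single_left)
qed (use assms in \<open>auto simp: hopf2_ring_def\<close>)

text \<open>As \<Delta>(g x^m) is a product of g \<otimes> g and a power of \<Delta>(x),
  \<open>act2_mult\<close> reduces the claim to these two elements, with no binomial
  expansion.\<close>

lemma act2_comult:
  assumes h: "h \<in> carrier (hopf_ring G \<eta>)" and e: "e \<in> E"
  shows "act2 (comult G \<eta> a h) e = h \<odot>\<^bsub>emod ({..<n} \<times> {..<t}) zT gT\<^esub> e"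
proof -
  interpret H2: ring H2 by (rule ring_hopf2[OF group \<eta>])
  let ?x = "basis_vec ((\<one>\<^bsub>G\<^esub>, 1), (a, 0)) + basis_vec ((\<one>\<^bsub>G\<^esub>, 0), (\<one>\<^bsub>G\<^esub>, 1)) :: ('g, 'k) hopf2"
  have x: "?x \<in> carrier H2" using a by (simp add: hopf2_ring_def)
  have one: "act2 \<one>\<^bsub>H2\<^esub> e = e" if "e \<in> E" for e
  proof -
    have "act2 \<one>\<^bsub>H2\<^esub> e = gT \<one>\<^bsub>G\<^esub> e" using act2_g[OF that, of "\<one>\<^bsub>G\<^esub>"] by (simp add: hopf2_ring_def)
    also have "\<dots> = e"
      by (rule lin_eq_on_free[OF lin_maps(2) lin_id(2) _ that]) (auto simp: gT_def char_1)
    finally show ?thesis .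
  qed
  have pow: "act2 (?x [^]\<^bsub>H2\<^esub> m) e = (zT ^^ m) e" if "e \<in> E" for m :: nat and e
    using that
  proof (induction m arbitrary: e)
    case 0
    then show ?case by (simp add: one)
  next
    case (Suc m)
    have "zT e \<in> E" using zT_closed[OF Suc.prems, of 1] by simp
    then show ?case using Suc x by (simp add: act2_mult act2_x funpow_swap1 del: One_nat_def)
  qed
  show ?thesis
  proof (rule lin_eq_on_free[of "\<lambda>h. act2 (comult G \<eta> a h) e" "\<lambda>h. h \<odot>\<^bsub>emod ({..<n} \<times> {..<t}) zT gT\<^esub> e" GN])
    show "lin (\<lambda>h. act2 (comult G \<eta> a h) e)"
      unfolding comult_def by (rule lin_compose[OF lin_maps(8) lin_lin_ext])
    show "lin (\<lambda>h. h \<odot>\<^bsub>emod ({..<n} \<times> {..<t}) zT gT\<^esub> e)"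
      by (simp add: emod_def lin_bilin_ext_left)
    show "h \<in> free_on GN" using h by (simp add: hopf_ring_def)
    fix b assume "b \<in> GN"
    then obtain g m where b: "b = (g, m)" "g \<in> carrier G" by auto
    have g: "basis_vec ((g, 0), (g, 0)) \<in> carrier H2" using b by (simp add: hopf2_ring_def)
    have "act2 (comult G \<eta> a (basis_vec b)) e = act2 (basis_vec ((g, 0), (g, 0)) \<otimes>\<^bsub>H2\<^esub> ?x [^]\<^bsub>H2\<^esub> m) e"
      by (simp add: comult_def b(1))
    also have "\<dots> = gT g ((zT ^^ m) e)"
      unfolding act2_mult[OF g H2.nat_pow_closed[OF x] e] pow[OF e] by (rule act2_g[OF zT_closed[OF e]])
    finally show "act2 (comult G \<eta> a (basis_vec b)) e = basis_vec b \<odot>\<^bsub>emod ({..<n} \<times> {..<t}) zT gT\<^esub> e"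
      unfolding b(1) emod_smult_basis[OF lin_maps(1,2)] .
  qed
qed

lemma tensor_act_closed:
  assumes h: "h \<in> carrier (hopf_ring G \<eta>)" and p: "p \<in> free_on pairs"
  shows "tensor_act G \<eta> a M N h p \<in> free_on pairs"
proof -
  interpret H2: ring H2 by (rule ring_hopf2[OF group \<eta>])
  let ?x = "basis_vec ((\<one>\<^bsub>G\<^esub>, 1), (a, 0)) + basis_vec ((\<one>\<^bsub>G\<^esub>, 0), (\<one>\<^bsub>G\<^esub>, 1)) :: ('g, 'k) hopf2"
  have x: "?x \<in> carrier H2" using a by (simp add: hopf2_ring_def)
  have "basis_vec ((g, 0), (g, 0)) \<otimes>\<^bsub>H2\<^esub> ?x [^]\<^bsub>H2\<^esub> (m :: nat) \<in> carrier H2" if "g \<in> carrier G" for g m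
    using that x by (intro H2.m_closed H2.nat_pow_closed) (auto simp: hopf2_ring_def)
  then have D: "comult G \<eta> a h \<in> free_on (GN \<times> GN)"
    using h unfolding comult_def hopf_ring_def
    by (intro lin_ext_closed[of h GN]) (auto simp: hopf2_ring_def)
  have M: "basis_vec b \<odot>\<^bsub>M\<^esub> u \<in> free_on {..<n}" if "b \<in> GN" "u \<in> free_on {..<n}" for b :: "'g \<times> nat" and u
    using left_module.smult_closed[OF left_module_M, of "basis_vec b" u] that by (simp add: hopf_ring_def V_simps)
  have N: "basis_vec b \<odot>\<^bsub>N\<^esub> u \<in> free_on {..<t}" if "b \<in> GN" "u \<in> free_on {..<t}" for b :: "'g \<times> nat" and u
    using left_module.smult_closed[OF left_module_N, of "basis_vec b" u] that by (simp add: hopf_ring_def V_simps)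
  show ?thesis unfolding tensor_act_def
    by (rule bilin_ext_closed[OF D p]) (use M N in auto)
qed

lemma coset_eq_iff: "tensor_coset G M N p = tensor_coset G M N p' \<longleftrightarrow> p - p' \<in> free.span rels"
proof
  assume "tensor_coset G M N p = tensor_coset G M N p'"
  moreover have "p \<in> tensor_coset G M N p"
    unfolding tensor_coset_def using free.span_zero by force
  ultimately show "p - p' \<in> free.span rels" by (auto simp: tensor_coset_def)
next
  assume d: "p - p' \<in> free.span rels"
  have "p + z \<in> tensor_coset G M N p'" if "z \<in> free.span rels" for z
    unfolding tensor_coset_def using free.span_add[OF d that]
    by (intro CollectI exI[of _ "p - p' + z"]) simp
  moreover have "p' + z \<in> tensor_coset G M N p" if "z \<in> free.span rels" for z
    unfolding tensor_coset_def using free.span_diff[OF that d]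
    by (intro CollectI exI[of _ "z - (p - p')"]) simp
  ultimately show "tensor_coset G M N p = tensor_coset G M N p'"
    by (auto simp: tensor_coset_def)
qed

lemma evT_closed: "p \<in> free_on pairs \<Longrightarrow> evT p \<in> E"
proof (rule lin_closed_on_free[OF lin_maps(3)])
  fix b :: "(nat \<Rightarrow>\<^sub>0 'k) \<times> (nat \<Rightarrow>\<^sub>0 'k)" assume "b \<in> pairs"
  then show "evT (basis_vec b) \<in> E"
    by (cases b) (auto simp: evT_basis tp_def intro!: bilin_ext_closed)
qed

lemma sec_closed: "e \<in> E \<Longrightarrow> sec e \<in> free_on pairs"
  by (rule lin_closed_on_free[OF lin_maps(4)]) (auto simp: sec_basis)

lemma in_coset_sec:
  assumes e: "e \<in> E" and p: "p \<in> tensor_coset G M N (sec e)"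
  shows "p \<in> free_on pairs" "evT p = e"
proof -
  obtain z where z: "z \<in> free.span rels" "p = sec e + z" using p by (auto simp: tensor_coset_def)
  then show "p \<in> free_on pairs" using rels_closed sec_closed[OF e] by auto
  show "evT p = e" using z by (simp add: module_hom.add[OF lin_maps(3)] evT_sec evT_rels)
qed

theorem tensor_iso:
  assumes "left_module (hopf_ring G \<eta>) (emod ({..<n} \<times> {..<t}) zT gT)"
  shows "left_module_iso (hopf_ring G \<eta>) (emod ({..<n} \<times> {..<t}) zT gT) (tensor G \<eta> a M N)"
proof (rule left_module_transport[OF assms, where f = "\<lambda>e. tensor_coset G M N (sec e)"])
  let ?c = "tensor_coset G M N"
  show "bij_betw (\<lambda>e. ?c (sec e)) (carrier (emod ({..<n} \<times> {..<t}) zT gT)) (carrier (tensor G \<eta> a M N))"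
  proof (rule bij_betw_imageI)
    show "inj_on (\<lambda>e. ?c (sec e)) (carrier (emod ({..<n} \<times> {..<t}) zT gT))"
    proof (rule inj_onI)
      fix e e' assume "?c (sec e) = ?c (sec e')"
      then have "evT (sec e - sec e') = 0" by (intro evT_rels) (simp add: coset_eq_iff)
      then show "e = e'" by (simp add: module_hom.diff[OF lin_maps(3)] evT_sec)
    qed
    show "(\<lambda>e. ?c (sec e)) ` carrier (emod ({..<n} \<times> {..<t}) zT gT) = carrier (tensor G \<eta> a M N)"
    proof safe
      fix e assume "e \<in> carrier (emod ({..<n} \<times> {..<t}) zT gT)"
      then show "?c (sec e) \<in> carrier (tensor G \<eta> a M N)"
        using sec_closed by (auto simp: emod_def tensor_def V_simps)
    next
      fix X assume "X \<in> carrier (tensor G \<eta> a M N)"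
      then obtain p where p: "X = ?c p" "p \<in> free_on pairs" by (auto simp: tensor_def V_simps)
      have "X = ?c (sec (evT p))" using sec_evT_cong[OF p(2)] by (simp add: p(1) coset_eq_iff)
      then show "X \<in> (\<lambda>e. ?c (sec e)) ` carrier (emod ({..<n} \<times> {..<t}) zT gT)"
        using evT_closed[OF p(2)] by (auto simp: emod_def)
    qed
  qed
  show "?c (sec \<zero>\<^bsub>emod ({..<n} \<times> {..<t}) zT gT\<^esub>) = \<zero>\<^bsub>tensor G \<eta> a M N\<^esub>"
    by (simp add: emod_def tensor_def module_hom.zero[OF lin_maps(4)])
next
  let ?c = "tensor_coset G M N"
  fix e e' assume "e \<in> carrier (emod ({..<n} \<times> {..<t}) zT gT)" "e' \<in> carrier (emod ({..<n} \<times> {..<t}) zT gT)"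
  have "{p + q | p q. p \<in> ?c (sec e) \<and> q \<in> ?c (sec e')} = ?c (sec e + sec e')"
  proof (intro equalityI subsetI)
    fix x assume "x \<in> {p + q | p q. p \<in> ?c (sec e) \<and> q \<in> ?c (sec e')}"
    then obtain z z' where z: "z \<in> free.span rels" "z' \<in> free.span rels" "x = (sec e + z) + (sec e' + z')"
      by (auto simp: tensor_coset_def)
    then show "x \<in> ?c (sec e + sec e')" unfolding tensor_coset_def
      by (intro CollectI exI[of _ "z + z'"]) (auto simp: add_ac free.span_add)
  next
    fix x assume "x \<in> ?c (sec e + sec e')"
    then obtain z where "z \<in> free.span rels" "x = (sec e + z) + (sec e' + 0)"
      by (auto simp: tensor_coset_def add_ac)
    then show "x \<in> {p + q | p q. p \<in> ?c (sec e) \<and> q \<in> ?c (sec e')}"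
      unfolding tensor_coset_def using free.span_zero by blast
  qed
  then show "?c (sec (e \<oplus>\<^bsub>emod ({..<n} \<times> {..<t}) zT gT\<^esub> e')) = ?c (sec e) \<oplus>\<^bsub>tensor G \<eta> a M N\<^esub> ?c (sec e')"
    by (simp add: emod_def tensor_def module_hom.add[OF lin_maps(4)])
next
  let ?c = "tensor_coset G M N"
  fix h e assume h: "h \<in> carrier (hopf_ring G \<eta>)" and "e \<in> carrier (emod ({..<n} \<times> {..<t}) zT gT)"
  then have e: "e \<in> E" by (simp add: emod_def)
  \<comment> \<open>The action on a coset is a union over its representatives. All of them give the
    same coset because \<open>evT\<close> takes the value e on each.\<close>
  have "?c (tensor_act G \<eta> a M N h p) = ?c (sec (h \<odot>\<^bsub>emod ({..<n} \<times> {..<t}) zT gT\<^esub> e))"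
    if p: "p \<in> ?c (sec e)" for p
    using sec_evT_cong[OF tensor_act_closed[OF h in_coset_sec(1)[OF e p]]]
    by (simp add: coset_eq_iff evT_act in_coset_sec(2)[OF e p] act2_comult[OF h e])
  moreover have "sec e \<in> ?c (sec e)" using free.span_zero by (force simp: tensor_coset_def)
  ultimately show "?c (sec (h \<odot>\<^bsub>emod ({..<n} \<times> {..<t}) zT gT\<^esub> e)) = h \<odot>\<^bsub>tensor G \<eta> a M N\<^esub> ?c (sec e)"
    by (auto simp: tensor_def)
qed

end

section \<open>The decomposition of the tensor products\<close>

lemma char_nonzero:
  assumes "\<chi> \<in> carrier (char_group G)" "g \<in> carrier G"
  shows "\<chi> g \<noteq> (0 :: 'k::field)"
  using assms unfolding char_group_def field_units_def hom_def by force

lemma char_pow: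
  fixes \<chi> :: "'g \<Rightarrow> 'k::field"
  assumes "g \<in> carrier G"
  shows "(\<chi> [^]\<^bsub>char_group G\<^esub> (j :: nat)) g = \<chi> g ^ j"
  using assms by (induction j) (auto simp: char_group_def nat_pow_def mult.commute)

lemma primitive_root_unity_inverse:
  fixes q :: "'k::field"
  assumes "primitive_root_unity s q"
  shows "primitive_root_unity s (inverse q)"
  using assms by (auto simp: primitive_root_unity_def power_inverse inverse_eq_1_iff)

locale tensor_strings = tensor_V G \<chi> \<eta> \<mu> \<sigma> a n t for G :: "('g, 'z) monoid_scheme"
    and \<chi> \<eta> \<mu> \<sigma> :: "'g \<Rightarrow> 'k::field_char_0" and a n t +
  fixes s r r' l l' :: nat and \<psi> :: "nat \<Rightarrow> 'g \<Rightarrow> 'k"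
  assumes root: "primitive_root_unity s (\<chi> a)" and \<chi>_pow: "g \<in> carrier G \<Longrightarrow> \<chi> g ^ s = 1"
    and \<psi>: "\<psi> j \<in> carrier (char_group G)" and \<psi>_eq: "g \<in> carrier G \<Longrightarrow> \<psi> j g = \<chi> g ^ j * (\<mu> g * \<sigma> g)"
begin

lemma nonzero: "\<chi> a \<noteq> 0" "\<mu> a \<noteq> 0" "\<sigma> a \<noteq> 0"
  using char_nonzero[OF \<chi> a] char_nonzero[OF \<mu> a] char_nonzero[OF \<sigma> a] by auto

lemma decomposition:
  assumes "n = r' * s + l'" "t = r * s + l" "l < s" "l' < s" "t \<le> n"
  shows "left_module_iso (hopf_ring G \<eta>)
    (direct_sum (quantum_tensor.starts s t) (\<lambda>(i, j). V \<chi> (quantum_tensor.plen s l l' n t i j) (\<psi> j)))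
    (tensor G \<eta> a (V \<chi> n \<mu>) (V \<chi> t \<sigma>))"
proof -
  \<comment> \<open>This weight makes the X-part of z match the first term of \<open>zT\<close>; the
    Y-part then forces q to be the inverse of \<chi>(a).\<close>
  define \<pi> where "\<pi> = lin_ext (\<lambda>(i, j). if i < n \<and> j < t
      then Poly_Mapping.single (i, j) ((\<chi> a ^ j * \<sigma> a) ^ i) else 0)"
  let ?q = "inverse (\<chi> a)"
  interpret Q: quantum_tensor ?q s r r' l l' n t
    using assms primitive_root_unity_inverse[OF root] by unfold_locales
  have lin_\<pi>: "lin \<pi>" by (simp add: \<pi>_def lin_lin_ext)
  have \<pi>_single: "\<pi> (Poly_Mapping.single (i, j) c) =
      (if i < n \<and> j < t then Poly_Mapping.single (i, j) (c * (\<chi> a ^ j * \<sigma> a) ^ i) else 0)" for i j c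
    by (simp add: \<pi>_def scale_single)
  interpret graded_quotient ?q s r r' l l' n t G \<chi> \<eta> "\<lambda>g. \<mu> g * \<sigma> g" \<psi> \<pi> zT gT "{..<n} \<times> {..<t}"
  proof (intro graded_quotient.intro graded_quotient_axioms.intro Q.quantum_tensor_axioms)
    show "Group.group G" "\<chi> \<in> carrier (char_group G)" "\<eta> \<in> carrier (char_group G)"
      by (rule group \<chi> \<eta>)+
    show "lin \<pi>" "lin zT" "lin (gT g)" for g by (fact lin_\<pi> lin_maps)+
    show "\<pi> (qz ?q p) = zT (\<pi> p)" for p
    proof -
      have "(\<lambda>p. \<pi> (qz ?q p)) = (\<lambda>p. zT (\<pi> p))"
      proof (rule lin_eqI[OF lin_compose[OF lin_\<pi> lin_qz(1)] lin_compose[OF lin_maps(1) lin_\<pi>]], clarify)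
        fix i j
        have "?q ^ i * (\<chi> a ^ Suc j * \<sigma> a) ^ i = (\<chi> a ^ j * \<sigma> a) ^ i"
          using nonzero by (simp add: power_mult_distrib power_inverse field_simps)
        then show "\<pi> (qz ?q (basis_vec (i, j))) = zT (\<pi> (basis_vec (i, j)))"
          by (auto simp: qz_single module_hom.add[OF lin_\<pi>] \<pi>_single zT_def
              module_hom.zero[OF lin_maps(1), unfolded zT_def] scale_single free.scale_right_distrib mult.commute)
      qed
      then show ?thesis by meson
    qed
    show "\<pi> p = 0" if "p \<in> trunc n t" for p
      by (rule lin_eq_on_free[OF lin_\<pi> _ _ that[unfolded trunc_def], where g = "\<lambda>_. 0"])
        (auto simp: \<pi>_single intro: linI)
    show "gT g (\<pi> p) = scale (\<chi> g ^ d * (\<mu> g * \<sigma> g)) (\<pi> p)" if "g \<in> carrier G" "p \<in> homog d" for g p d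
      by (rule lin_eq_on_free[OF lin_compose[OF lin_maps(2) lin_\<pi>] lin_scale[OF lin_\<pi>] _ that(2)[unfolded homog_def]])
        (auto simp: \<pi>_single gT_def scale_single mult.commute)
    show "basis_vec ` ({..<n} \<times> {..<t}) \<subseteq> range \<pi>"
    proof clarify
      fix i j assume "i < n" "j < t"
      then have "basis_vec (i, j) = \<pi> (Poly_Mapping.single (i, j) (inverse ((\<chi> a ^ j * \<sigma> a) ^ i)))"
        using nonzero by (simp add: \<pi>_single)
      then show "basis_vec (i, j) \<in> range \<pi>" by blast
    qed
    show "\<pi> p \<in> free_on ({..<n} \<times> {..<t})" for p
      by (rule lin_closed_on_free[OF lin_\<pi> _ free_on_UNIV]) (auto simp: \<pi>_single)
  qed (use assms \<eta>\<chi> \<psi> \<psi>_eq \<chi>_pow in \<open>auto simp: card_cartesian_product\<close>)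
  \<comment> \<open>\<open>strmod_iso\<close> enters twice: as an isomorphism, and as the source of
    the module laws that \<open>tensor_iso\<close> assumes for the coordinate space.\<close>
  show ?thesis
    using left_module_iso_trans[OF strmod_iso tensor_iso] strmod_iso unfolding left_module_iso_def by blast
qed

lemma decomposition_swap:
  assumes "t = r' * s + l'" "n = r * s + l" "l < s" "l' < s" "n \<le> t"
  shows "left_module_iso (hopf_ring G \<eta>)
    (direct_sum (quantum_tensor.starts s n) (\<lambda>(i, j). V \<chi> (quantum_tensor.plen s l l' t n i j) (\<psi> j)))
    (tensor G \<eta> a (V \<chi> n \<mu>) (V \<chi> t \<sigma>))"
proof -
  \<comment> \<open>The second factor is the larger one and plays X, so the indices are exchanged.
    Multiplication by Y carries the action of a: the weight absorbs \<sigma>(a), and the remaining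
    \<chi>(a)^i is the commutation factor, whence q = \<chi>(a).\<close>
  define \<pi> where "\<pi> = lin_ext (\<lambda>(i, j). if i < t \<and> j < n
      then Poly_Mapping.single (j, i) (\<sigma> a ^ j) else 0)"
  let ?q = "\<chi> a"
  interpret Q: quantum_tensor ?q s r r' l l' t n
    using assms root by unfold_locales
  have lin_\<pi>: "lin \<pi>" by (simp add: \<pi>_def lin_lin_ext)
  have \<pi>_single: "\<pi> (Poly_Mapping.single (i, j) c) =
      (if i < t \<and> j < n then Poly_Mapping.single (j, i) (c * \<sigma> a ^ j) else 0)" for i j c
    by (simp add: \<pi>_def scale_single)
  interpret graded_quotient ?q s r r' l l' t n G \<chi> \<eta> "\<lambda>g. \<mu> g * \<sigma> g" \<psi> \<pi> zT gT "{..<n} \<times> {..<t}"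
  proof (intro graded_quotient.intro graded_quotient_axioms.intro Q.quantum_tensor_axioms)
    show "Group.group G" "\<chi> \<in> carrier (char_group G)" "\<eta> \<in> carrier (char_group G)"
      by (rule group \<chi> \<eta>)+
    show "lin \<pi>" "lin zT" "lin (gT g)" for g by (fact lin_\<pi> lin_maps)+
    show "\<pi> (qz ?q p) = zT (\<pi> p)" for p
    proof -
      have "(\<lambda>p. \<pi> (qz ?q p)) = (\<lambda>p. zT (\<pi> p))"
        by (rule lin_eqI[OF lin_compose[OF lin_\<pi> lin_qz(1)] lin_compose[OF lin_maps(1) lin_\<pi>]], clarify)
          (auto simp: qz_single module_hom.add[OF lin_\<pi>] \<pi>_single zT_def
              module_hom.zero[OF lin_maps(1), unfolded zT_def] scale_single free.scale_right_distrib mult_ac)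
      then show ?thesis by meson
    qed
    show "\<pi> p = 0" if "p \<in> trunc t n" for p
      by (rule lin_eq_on_free[OF lin_\<pi> _ _ that[unfolded trunc_def], where g = "\<lambda>_. 0"])
        (auto simp: \<pi>_single intro: linI)
    show "gT g (\<pi> p) = scale (\<chi> g ^ d * (\<mu> g * \<sigma> g)) (\<pi> p)" if "g \<in> carrier G" "p \<in> homog d" for g p d
      by (rule lin_eq_on_free[OF lin_compose[OF lin_maps(2) lin_\<pi>] lin_scale[OF lin_\<pi>] _ that(2)[unfolded homog_def]])
        (auto simp: \<pi>_single gT_def scale_single mult.commute add.commute)
    show "basis_vec ` ({..<n} \<times> {..<t}) \<subseteq> range \<pi>"
    proof clarify
      fix i j assume "i < n" "j < t"
      then have "basis_vec (i, j) = \<pi> (Poly_Mapping.single (j, i) (inverse (\<sigma> a ^ i)))"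
        using nonzero by (simp add: \<pi>_single)
      then show "basis_vec (i, j) \<in> range \<pi>" by blast
    qed
    show "\<pi> p \<in> free_on ({..<n} \<times> {..<t})" for p
      by (rule lin_closed_on_free[OF lin_\<pi> _ free_on_UNIV]) (auto simp: \<pi>_single)
  qed (use assms \<eta>\<chi> \<psi> \<psi>_eq \<chi>_pow in \<open>auto simp: card_cartesian_product\<close>)
  show ?thesis
    using left_module_iso_trans[OF strmod_iso tensor_iso] strmod_iso unfolding left_module_iso_def by blast
qed

end

text \<open>The sum over \<open>starts\<close> is cut into blocks along the second index. The
  summands F have to agree with M only on their own block, so each formula for the length is used
  only where it holds.\<close>

lemma left_module_iso_four_sums:
  assumes R: "ring R" and M: "\<And>i j. left_module R (M i j)"
    and fin: "finite I1" "finite J1" "finite I2" "finite J2" "finite I3" "finite J3" "finite I4" "finite J4"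
    and F: "\<And>i j. i \<in> I1 \<Longrightarrow> j \<in> J1 \<Longrightarrow> F1 i j = M i j" "\<And>i j. i \<in> I2 \<Longrightarrow> j \<in> J2 \<Longrightarrow> F2 i j = M i j"
      "\<And>i j. i \<in> I3 \<Longrightarrow> j \<in> J3 \<Longrightarrow> F3 i j = M i j" "\<And>i j. i \<in> I4 \<Longrightarrow> j \<in> J4 \<Longrightarrow> F4 i j = M i j"
    and S: "S = I1 \<times> J1 \<union> (I2 \<times> J2 \<union> (I3 \<times> J3 \<union> I4 \<times> J4))"
    and disj: "J1 \<inter> J2 = {}" "J1 \<inter> J3 = {}" "J1 \<inter> J4 = {}" "J2 \<inter> J3 = {}" "J2 \<inter> J4 = {}" "J3 \<inter> J4 = {}"
  shows "left_module_iso R (direct_sum S (\<lambda>(i, j). M i j))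
    (direct_sum I1 (\<lambda>i. direct_sum J1 (\<lambda>j. F1 i j)) \<boxplus> direct_sum I2 (\<lambda>i. direct_sum J2 (\<lambda>j. F2 i j)) \<boxplus>
     direct_sum I3 (\<lambda>i. direct_sum J3 (\<lambda>j. F3 i j)) \<boxplus> direct_sum I4 (\<lambda>i. direct_sum J4 (\<lambda>j. F4 i j)))"
proof -
  let ?M = "\<lambda>(i, j). M i j"
  have nest: "left_module_iso R (direct_sum I (\<lambda>i. direct_sum J (\<lambda>j. F i j))) (direct_sum (I \<times> J) ?M)"
    if "finite I" "finite J" "\<And>i j. i \<in> I \<Longrightarrow> j \<in> J \<Longrightarrow> F i j = M i j" for I J F
  proof -
    have "direct_sum I (\<lambda>i. direct_sum J (\<lambda>j. F i j)) = direct_sum I (\<lambda>i. direct_sum J (\<lambda>j. M i j))"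
      using that(3) by (intro direct_sum_cong) auto
    then show ?thesis using left_module_iso_nested_sum[OF R that(1), of "\<lambda>_. J" M] that(2) M by simp
  qed
  have union: "left_module_iso R (N1 \<boxplus> N2) (direct_sum (S1 \<union> S2) ?M)"
    if "left_module_iso R N1 (direct_sum S1 ?M)" "left_module_iso R N2 (direct_sum S2 ?M)"
      "finite S1" "finite S2" "S1 \<inter> S2 = {}" for N1 N2 S1 S2
    using left_module_iso_trans[OF left_module_iso_binary_sum[OF that(1,2)] left_module_iso_union_sum[OF R that(3-5)]] M
    by auto
  show ?thesis unfolding S
    by (intro left_module_iso_sym[OF union] union nest fin F) (use fin disj in auto)
qed

theorem theorem3p15:
  fixes G :: "('g, 'z) monoid_scheme"
    and a :: 'g
    and \<chi> \<mu> \<sigma> :: "'g \<Rightarrow> 'k :: {alg_closed_field, field_char_0}"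
    and n t s r r' l l' :: nat
  assumes "group G"
    and "a \<in> group_center G"
    and "\<chi> \<in> carrier (char_group G)"
    and "\<chi> a \<noteq> 1"
    and "group.ord (char_group G) \<chi> = s" and "s > 0"
    and "primitive_root_unity s ((inv\<^bsub>char_group G\<^esub> \<chi>) a)"
    and "\<mu> \<in> carrier (char_group G)" and "\<sigma> \<in> carrier (char_group G)"
    and "n \<ge> t" and "t \<ge> 1"
    and "n = r' * s + l'" and "t = r * s + l"
    and "l' \<le> s - 1" and "l \<le> s - 1"
  shows "let \<eta> = inv\<^bsub>char_group G\<^esub> \<chi>;
             H = hopf_ring G \<eta>;
             VV = tensor G \<eta> a (V \<chi> n \<mu>) (V \<chi> t \<sigma>);
             VV' = tensor G \<eta> a (V \<chi> t \<sigma>) (V \<chi> n \<mu>);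
             \<psi> = (\<lambda>j::nat. \<chi> [^]\<^bsub>char_group G\<^esub> j \<otimes>\<^bsub>char_group G\<^esub> \<mu> \<otimes>\<^bsub>char_group G\<^esub> \<sigma>);
             A = (\<lambda>i j. V \<chi> (n + t - 1 - 2*i*s - 2*j) (\<psi> j));
             B = (\<lambda>i j. V \<chi> ((r + r' - 2*i) * s) (\<psi> j));
             C = (\<lambda>i j. V \<chi> ((r + r' - 1 - 2*i) * s) (\<psi> j));
             D = (\<lambda>i j. V \<chi> ((r + r' + 1 - 2*i) * s) (\<psi> j));
             m = l + l' - s - 1
         in
           (l + l' \<le> s \<longrightarrow>
              (l \<le> l' \<longrightarrow>
                 left_module_iso H VV VV' \<and>
                 left_module_iso H VV'
                   (direct_sum {0..r} (\<lambda>i. direct_sum {0..<l} (\<lambda>j. A i j)) \<boxplus>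
                    direct_sum {0..<r} (\<lambda>i. direct_sum {l..<l'} (\<lambda>j. B i j)) \<boxplus>
                    direct_sum {0..<r} (\<lambda>i. direct_sum {l'..<l + l'} (\<lambda>j. A i j)) \<boxplus>
                    direct_sum {0..<r} (\<lambda>i. direct_sum {l + l'..<s} (\<lambda>j. C i j)))) \<and>
              (l \<ge> l' \<longrightarrow>
                 left_module_iso H VV VV' \<and>
                 left_module_iso H VV'
                   (direct_sum {0..r} (\<lambda>i. direct_sum {0..<l'} (\<lambda>j. A i j)) \<boxplus>
                    direct_sum {0..r} (\<lambda>i. direct_sum {l'..<l} (\<lambda>j. B i j)) \<boxplus>
                    direct_sum {0..<r} (\<lambda>i. direct_sum {l..<l + l'} (\<lambda>j. A i j)) \<boxplus>
                    direct_sum {0..<r} (\<lambda>i. direct_sum {l + l'..<s} (\<lambda>j. C i j))))) \<and>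
           (l + l' \<ge> s + 1 \<longrightarrow>
              (l \<le> l' \<longrightarrow>
                 left_module_iso H VV VV' \<and>
                 left_module_iso H VV'
                   (direct_sum {0..r} (\<lambda>i. direct_sum {0..m} (\<lambda>j. D i j)) \<boxplus>
                    direct_sum {0..r} (\<lambda>i. direct_sum {m + 1..<l} (\<lambda>j. A i j)) \<boxplus>
                    direct_sum {0..<r} (\<lambda>i. direct_sum {l..<l'} (\<lambda>j. B i j)) \<boxplus>
                    direct_sum {0..<r} (\<lambda>i. direct_sum {l'..<s} (\<lambda>j. A i j)))) \<and>
              (l \<ge> l' \<longrightarrow>
                 left_module_iso H VV VV' \<and>
                 left_module_iso H VV'
                   (direct_sum {0..r} (\<lambda>i. direct_sum {0..m} (\<lambda>j. D i j)) \<boxplus>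
                    direct_sum {0..r} (\<lambda>i. direct_sum {m + 1..<l'} (\<lambda>j. A i j)) \<boxplus>
                    direct_sum {0..r} (\<lambda>i. direct_sum {l'..<l} (\<lambda>j. B i j)) \<boxplus>
                    direct_sum {0..<r} (\<lambda>i. direct_sum {l..<s} (\<lambda>j. A i j)))))"
proof -
  interpret group G by fact
  interpret C: group "char_group G :: ('g \<Rightarrow> 'k) monoid" by (rule group_char_group[OF assms(1)])
  define \<eta> where "\<eta> = inv\<^bsub>char_group G\<^esub> \<chi>"
  define \<psi> where "\<psi> j = \<chi> [^]\<^bsub>char_group G\<^esub> j \<otimes>\<^bsub>char_group G\<^esub> \<mu> \<otimes>\<^bsub>char_group G\<^esub> \<sigma>" for j :: nat
  have a: "a \<in> carrier G" using assms(2) by (simp add: group_center_def)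
  have \<eta>: "\<eta> \<in> carrier (char_group G)" unfolding \<eta>_def using assms(3) by (rule C.inv_closed)
  have inv: "\<eta> g = inverse (\<chi> g)" if "g \<in> carrier G" for g
    unfolding \<eta>_def using group_char_group(2)[OF assms(1,3) that] .
  have \<eta>\<chi>: "\<eta> g * \<chi> g = 1" if "g \<in> carrier G" for g
    using inv[OF that] char_nonzero[OF assms(3) that] by simp
  have root: "primitive_root_unity s (\<chi> a)"
    using primitive_root_unity_inverse[OF assms(7)] inv[OF a] by (simp flip: \<eta>_def)
  \<comment> \<open>The order of \<chi> gives this for every g, whereas the primitive root only
    concerns a.\<close>
  have \<chi>_pow: "\<chi> g ^ s = 1" if "g \<in> carrier G" for g
    using char_pow[OF that, of \<chi> s] C.pow_ord_eq_1[OF assms(3)] that assms(5) by (simp add: char_group_def)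
  have \<psi>: "\<psi> j \<in> carrier (char_group G)" for j
    unfolding \<psi>_def using assms(3,8,9) by simp
  have \<psi>_eq: "\<psi> j g = \<chi> g ^ j * (\<mu> g * \<sigma> g)" if "g \<in> carrier G" for j g
  proof -
    have "\<psi> j g = (\<chi> [^]\<^bsub>char_group G\<^esub> j) g * \<mu> g * \<sigma> g"
      using that by (simp add: \<psi>_def char_group_def)
    then show ?thesis by (simp add: char_pow[OF that])
  qed
  have ls: "l < s" "l' < s" using assms(6,14,15) by auto
  note nt = assms(12,13)
  interpret Q: quantum_tensor "\<chi> a" s r r' l l' n t
    using root nt ls by unfold_locales
  interpret T1: tensor_strings G \<chi> \<eta> \<mu> \<sigma> a n t s r r' l l' \<psi>
    using assms(1,3,8,9) a \<eta> \<eta>\<chi> root \<chi>_pow \<psi> \<psi>_eq by unfold_locales auto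
  interpret T2: tensor_strings G \<chi> \<eta> \<sigma> \<mu> a t n s r r' l l' \<psi>
    using assms(1,3,8,9) a \<eta> \<eta>\<chi> root \<chi>_pow \<psi> \<psi>_eq by unfold_locales (auto simp: mult.commute)
  note t1 = T1.decomposition[OF nt ls assms(10)]
  note t2 = T2.decomposition_swap[OF nt ls assms(10)]
  \<comment> \<open>The direct sums in \<open>t1\<close> and \<open>t2\<close> are literally equal:
    starts, lengths and characters are the same for both orders.\<close>
  note VV = left_module_iso_trans[OF left_module_iso_sym[OF t1] t2]
  have V: "left_module (hopf_ring G \<eta>) (V \<chi> (Q.plen i j) (\<psi> j))" for i j
    using left_module_V[OF assms(1,3) \<psi> \<eta> \<eta>\<chi>] .
  note sums = left_module_iso_trans[OF left_module_iso_sym[OF t2]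
      left_module_iso_four_sums[OF ring_hopf_ring[OF assms(1) \<eta>] V]]
  have A: "Q.plen i j = n + t - 1 - 2 * i * s - 2 * j"
    if "l + l' \<le> j + s \<and> j < l \<and> j < l' \<or> l \<le> j \<and> l' \<le> j \<and> j < l + l' \<and> j < s" for i j
    using that by (intro Q.plen_fixed) (auto simp: Q.om_def)
  have B1: "Q.plen i j = (r + r' - 2 * i) * s" if "i < r" "l \<le> j" "j < l'" for i j
    using that ls by (intro Q.plen_mid[OF assms(10)]) (auto simp: Q.in_starts_iff)
  have B2: "Q.plen i j = (r + r' - 2 * i) * s" if "i \<le> r" "l' \<le> j" "j < l" for i j
    using that ls by (intro Q.plen_mid[OF assms(10)]) (auto simp: Q.in_starts_iff)
  have C: "Q.plen i j = (r + r' - 1 - 2 * i) * s" if "i < r" "l + l' \<le> j" "j < s" for i j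
    using that by (intro Q.plen_ge[OF assms(10)]) (auto simp: Q.in_starts_iff)
  have D: "Q.plen i j = (r + r' + 1 - 2 * i) * s" if "i \<le> r" "j + s < l + l'" for i j
    using that ls by (intro Q.plen_gt[OF assms(10)]) (auto simp: Q.in_starts_iff)
  note eqs = A B1 B2 C D Q.in_starts_iff
  show ?thesis
    unfolding Let_def \<eta>_def[symmetric] \<psi>_def[symmetric]
  proof (intro conjI impI VV)
    show "left_module_iso (hopf_ring G \<eta>) (tensor G \<eta> a (V \<chi> t \<sigma>) (V \<chi> n \<mu>))
      (direct_sum {0..r} (\<lambda>i. direct_sum {0..<l} (\<lambda>j. V \<chi> (n + t - 1 - 2*i*s - 2*j) (\<psi> j))) \<boxplus>
       direct_sum {0..<r} (\<lambda>i. direct_sum {l..<l'} (\<lambda>j. V \<chi> ((r + r' - 2*i) * s) (\<psi> j))) \<boxplus>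
       direct_sum {0..<r} (\<lambda>i. direct_sum {l'..<l + l'} (\<lambda>j. V \<chi> (n + t - 1 - 2*i*s - 2*j) (\<psi> j))) \<boxplus>
       direct_sum {0..<r} (\<lambda>i. direct_sum {l + l'..<s} (\<lambda>j. V \<chi> ((r + r' - 1 - 2*i) * s) (\<psi> j))))"
      if "l + l' \<le> s" "l \<le> l'"
      by (rule sums) (use that ls in \<open>auto simp: eqs\<close>)
    show "left_module_iso (hopf_ring G \<eta>) (tensor G \<eta> a (V \<chi> t \<sigma>) (V \<chi> n \<mu>))
      (direct_sum {0..r} (\<lambda>i. direct_sum {0..<l'} (\<lambda>j. V \<chi> (n + t - 1 - 2*i*s - 2*j) (\<psi> j))) \<boxplus>
       direct_sum {0..r} (\<lambda>i. direct_sum {l'..<l} (\<lambda>j. V \<chi> ((r + r' - 2*i) * s) (\<psi> j))) \<boxplus>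
       direct_sum {0..<r} (\<lambda>i. direct_sum {l..<l + l'} (\<lambda>j. V \<chi> (n + t - 1 - 2*i*s - 2*j) (\<psi> j))) \<boxplus>
       direct_sum {0..<r} (\<lambda>i. direct_sum {l + l'..<s} (\<lambda>j. V \<chi> ((r + r' - 1 - 2*i) * s) (\<psi> j))))"
      if "l + l' \<le> s" "l' \<le> l"
      by (rule sums) (use that ls in \<open>auto simp: eqs\<close>)
    show "left_module_iso (hopf_ring G \<eta>) (tensor G \<eta> a (V \<chi> t \<sigma>) (V \<chi> n \<mu>))
      (direct_sum {0..r} (\<lambda>i. direct_sum {0..l + l' - s - 1} (\<lambda>j. V \<chi> ((r + r' + 1 - 2*i) * s) (\<psi> j))) \<boxplus>
       direct_sum {0..r} (\<lambda>i. direct_sum {l + l' - s - 1 + 1..<l} (\<lambda>j. V \<chi> (n + t - 1 - 2*i*s - 2*j) (\<psi> j))) \<boxplus>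
       direct_sum {0..<r} (\<lambda>i. direct_sum {l..<l'} (\<lambda>j. V \<chi> ((r + r' - 2*i) * s) (\<psi> j))) \<boxplus>
       direct_sum {0..<r} (\<lambda>i. direct_sum {l'..<s} (\<lambda>j. V \<chi> (n + t - 1 - 2*i*s - 2*j) (\<psi> j))))"
      if "s + 1 \<le> l + l'" "l \<le> l'"
      by (rule sums) (use that ls in \<open>auto simp: eqs\<close>)
    show "left_module_iso (hopf_ring G \<eta>) (tensor G \<eta> a (V \<chi> t \<sigma>) (V \<chi> n \<mu>))
      (direct_sum {0..r} (\<lambda>i. direct_sum {0..l + l' - s - 1} (\<lambda>j. V \<chi> ((r + r' + 1 - 2*i) * s) (\<psi> j))) \<boxplus>
       direct_sum {0..r} (\<lambda>i. direct_sum {l + l' - s - 1 + 1..<l'} (\<lambda>j. V \<chi> (n + t - 1 - 2*i*s - 2*j) (\<psi> j))) \<boxplus>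
       direct_sum {0..r} (\<lambda>i. direct_sum {l'..<l} (\<lambda>j. V \<chi> ((r + r' - 2*i) * s) (\<psi> j))) \<boxplus>
       direct_sum {0..<r} (\<lambda>i. direct_sum {l..<s} (\<lambda>j. V \<chi> (n + t - 1 - 2*i*s - 2*j) (\<psi> j))))"
      if "s + 1 \<le> l + l'" "l' \<le> l"
      by (rule sums) (use that ls in \<open>auto simp: eqs\<close>)
  qed
qed

end
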